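(* Let $m\ge2$ be an integer, $b\in(0,1]$, $C_0>0$ and $\delta\in(0,1]$. There are constants $C>0$ and $\rho\in\mathbb{R}$ depending only on $b,C_0,\delta,m$ such that the following holds. Let $\mu$ be a probability distribution on $[m]^n$ (identified with $\mathbb{Z}_m^n$) with full support such that (i) (Marginal boundedness) for every $i\in[n]$, $k\in[m-1]$ and $x\in[m]^n$, $\ b\le\sqrt{\mu(x^{ke_i})/\mu(x)}\le 1/b$; (ii) (Dobrushin condition) the Dobrushin matrix $R$ of $\mu$ satisfies $\|R\|_1\le C_0$ and $\|R\|_2\le1-\delta$. Then for every $f:[m]^n\to\{\pm1\}$: (1) (KKL) $\displaystyle \max_{i\in[n]}\mathsf{Inf}_{\mu,i}(f)\ge C\,\frac{\log n}{n}\,\mathrm{Var}_\mu(f)$; (2) (Talagrand's $L^1$–$L^2$) with $L_if(x)=\sum_{k=1}^{m-1}q^\star_{ke_i}(x)(f(x^{ke_i})-f(x))$, $$C\,\mathrm{Var}_\mu(f)\le\sum_{i=1}^n\frac{\|L_if\|_{2,\mu}^2}{1+\log(\|L_if\|_{2,\mu}/\|L_if\|_{1,\mu})};$$ (3) (Talagrand's variance–surface-area) $\displaystyle \mathsf{SA}_\mu(f)\ge C\,\mathrm{Var}_\mu(f)\sqrt{\log\frac{e}{\mathrm{Var}_\mu(f)}}$; (4) (Eldan–Gross) $\displaystyle \mathsf{SA}_\mu(f)\ge C\,\mathrm{Var}_\mu(f)\sqrt{\log\left(1+\frac{e}{\mathsf{SqInf}_\mu(f)}\right)}$. Finally, the local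 Bobkov inequality holds: for every $f:[m]^n\to[0,1]$ and $t\ge0$, pointwise on $[m]^n$, $$\mathcal I(P_tf)\le P_t\left(\sqrt{\mathcal I(f)^2+\gamma(t)\Gamma^\star(f)}\right),$$ where $\gamma(t)=\frac{2(1-e^{-2\rho t})}{b\rho}$ if $\rho\ne0$ and $\gamma(t)=\frac{4t}{b}$ if $\rho=0$.
   Context: For $x\in\mathbb{Z}_m^n$, $x^{ke_i}=x+ke_i$, where $e_i$ is the $i$-th standard generator; $[m-1]=\{1,\dots,m-1\}$. $\log$ is natural and $\|g\|_{p,\mu}=(\mathbb{E}_\mu|g|^p)^{1/p}$. Canonical rates: $q^\star_{ke_i}(x)=\frac12\sqrt{\mu(x^{ke_i})/\mu(x)}$; generator $Lf(x)=\sum_{i=1}^n\sum_{k=1}^{m-1}q^\star_{ke_i}(x)(f(x^{ke_i})-f(x))$; $P_t=e^{tL}$; $\Gamma^\star(f)(x)=\sum_{i=1}^n\sum_{k=1}^{m-1}q^\star_{ke_i}(x)^2(f(x^{ke_i})-f(x))^2$. For $f:[m]^n\to\{\pm1\}$: $\mathsf{Inf}_{\mu,i}(f)=\sum_{k=1}^{m-1}\Pr_{x\sim\mu}[f(x)\ne f(x^{ke_i})]$; $s(f)(x)=\#\{(i,k)\in[n]\times[m-1]:f(x^{ke_i})\ne f(x)\}$; $\mathsf{SA}_\mu(f)=\mathbb{E}_\mu[\sqrt{s(f)}]$; $\mathsf{SqInf}_\mu(f)=\sum_{i=1}^n\left(\mathbb{E}_{x\sim\mu}\left[\sqrt{\#\{k\in[m-1]:f(x)\ne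 f(x^{ke_i})\}}\right]\right)^2$. Dobrushin matrix: $R_{ij}=\sup\, d_{\mathrm{TV}}(\mu_i(\cdot\mid x_{-i}),\mu_i(\cdot\mid y_{-i}))$, the supremum over $x,y\in[m]^n$ with $x_{-j}=y_{-j}$ (agreeing off coordinate $j$), where $\mu_i(\cdot\mid x_{-i})$ is the conditional law of coordinate $i$ given the others. $\|\cdot\|_1$ is the maximum absolute column sum, $\|\cdot\|_2$ the spectral norm. $\mathcal I(x)=\varphi(\Phi^{-1}(x))$ on $[0,1]$ ($\mathcal I(0)=\mathcal I(1)=0$) is the Gaussian isoperimetric profile, with $\varphi,\Phi$ the standard Gaussian density and distribution function. Conventions: summands in (2) with $L_if=0$ are $0$; the right-hand sides of (3),(4) are $0$ if $\mathrm{Var}_\mu(f)=0$. *)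

theory Defs
  imports "HOL-Probability.Probability"
begin

text \<open>
  The dimension \<open>n\<close> is quantified after the constants, so it cannot be a type.
  Points of \<open>\<int>\<^sub>m\<^sup>n\<close> are functions on \<open>{..<n}\<close> with values in \<open>{..<m}\<close> (extensional,
  i.e. \<open>undefined\<close> off \<open>{..<n}\<close>); coordinates are numbered from \<open>0\<close>.
\<close>

definition cube :: "nat \<Rightarrow> nat \<Rightarrow> (nat \<Rightarrow> nat) set" where
  "cube m n = ({..<n} \<rightarrow>\<^sub>E {..<m})"

definition coord_shift :: "nat \<Rightarrow> nat \<Rightarrow> nat \<Rightarrow> (nat \<Rightarrow> nat) \<Rightarrow> (nat \<Rightarrow> nat)" where
  "coord_shift m i k x = x(i := (x i + k) mod m)"

definition lp_norm :: "real \<Rightarrow> 'a pmf \<Rightarrow> ('a \<Rightarrow> real) \<Rightarrow> real" where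
  "lp_norm p \<mu> g = measure_pmf.expectation \<mu> (\<lambda>x. \<bar>g x\<bar> powr p) powr (1 / p)"

definition qstar :: "nat \<Rightarrow> (nat \<Rightarrow> nat) pmf \<Rightarrow> nat \<Rightarrow> nat \<Rightarrow> (nat \<Rightarrow> nat) \<Rightarrow> real" where
  "qstar m \<mu> i k x = 1 / 2 * sqrt (pmf \<mu> (coord_shift m i k x) / pmf \<mu> x)"

definition gen_coord ::
    "nat \<Rightarrow> (nat \<Rightarrow> nat) pmf \<Rightarrow> nat \<Rightarrow> ((nat \<Rightarrow> nat) \<Rightarrow> real) \<Rightarrow> (nat \<Rightarrow> nat) \<Rightarrow> real" where
  "gen_coord m \<mu> i f x = (\<Sum>k\<in>{1..<m}. qstar m \<mu> i k x * (f (coord_shift m i k x) - f x))"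

definition gen ::
    "nat \<Rightarrow> nat \<Rightarrow> (nat \<Rightarrow> nat) pmf \<Rightarrow> ((nat \<Rightarrow> nat) \<Rightarrow> real) \<Rightarrow> (nat \<Rightarrow> nat) \<Rightarrow> real" where
  "gen m n \<mu> f x = (\<Sum>i<n. \<Sum>k\<in>{1..<m}. qstar m \<mu> i k x * (f (coord_shift m i k x) - f x))"

text \<open>\<open>P\<^sub>t = e\<^sup>t\<^sup>L\<close> as the exponential series of the operator \<open>L\<close>, evaluated pointwise.\<close>

definition heat ::
    "nat \<Rightarrow> nat \<Rightarrow> (nat \<Rightarrow> nat) pmf \<Rightarrow> real \<Rightarrow> ((nat \<Rightarrow> nat) \<Rightarrow> real) \<Rightarrow> (nat \<Rightarrow> nat) \<Rightarrow> real" where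
  "heat m n \<mu> t f x = (\<Sum>j. t ^ j / fact j * ((gen m n \<mu> ^^ j) f) x)"

definition Gamma_star ::
    "nat \<Rightarrow> nat \<Rightarrow> (nat \<Rightarrow> nat) pmf \<Rightarrow> ((nat \<Rightarrow> nat) \<Rightarrow> real) \<Rightarrow> (nat \<Rightarrow> nat) \<Rightarrow> real" where
  "Gamma_star m n \<mu> f x =
     (\<Sum>i<n. \<Sum>k\<in>{1..<m}. (qstar m \<mu> i k x)\<^sup>2 * (f (coord_shift m i k x) - f x)\<^sup>2)"

definition Influence ::
    "nat \<Rightarrow> (nat \<Rightarrow> nat) pmf \<Rightarrow> nat \<Rightarrow> ((nat \<Rightarrow> nat) \<Rightarrow> real) \<Rightarrow> real" where
  "Influence m \<mu> i f = (\<Sum>k\<in>{1..<m}. measure_pmf.prob \<mu> {x. f x \<noteq> f (coord_shift m i k x)})"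

definition sensitivity ::
    "nat \<Rightarrow> nat \<Rightarrow> ((nat \<Rightarrow> nat) \<Rightarrow> real) \<Rightarrow> (nat \<Rightarrow> nat) \<Rightarrow> nat" where
  "sensitivity m n f x = card {(i, k) \<in> {..<n} \<times> {1..<m}. f (coord_shift m i k x) \<noteq> f x}"

definition surface_area ::
    "nat \<Rightarrow> nat \<Rightarrow> (nat \<Rightarrow> nat) pmf \<Rightarrow> ((nat \<Rightarrow> nat) \<Rightarrow> real) \<Rightarrow> real" where
  "surface_area m n \<mu> f = measure_pmf.expectation \<mu> (\<lambda>x. sqrt (real (sensitivity m n f x)))"

definition SqInf ::
    "nat \<Rightarrow> nat \<Rightarrow> (nat \<Rightarrow> nat) pmf \<Rightarrow> ((nat \<Rightarrow> nat) \<Rightarrow> real) \<Rightarrow> real" where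
  "SqInf m n \<mu> f =
     (\<Sum>i<n. (measure_pmf.expectation \<mu>
        (\<lambda>x. sqrt (real (card {k \<in> {1..<m}. f x \<noteq> f (coord_shift m i k x)}))))\<^sup>2)"

definition cond_law :: "nat \<Rightarrow> (nat \<Rightarrow> nat) pmf \<Rightarrow> nat \<Rightarrow> (nat \<Rightarrow> nat) \<Rightarrow> nat pmf" where
  "cond_law n \<mu> i x = map_pmf (\<lambda>z. z i) (cond_pmf \<mu> {z. \<forall>l<n. l \<noteq> i \<longrightarrow> z l = x l})"

definition tv_dist :: "'a pmf \<Rightarrow> 'a pmf \<Rightarrow> real" where
  "tv_dist p q = (SUP A. \<bar>measure_pmf.prob p A - measure_pmf.prob q A\<bar>)"

definition Dobrushin :: "nat \<Rightarrow> nat \<Rightarrow> (nat \<Rightarrow> nat) pmf \<Rightarrow> nat \<Rightarrow> nat \<Rightarrow> real" where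
  "Dobrushin m n \<mu> i j =
     (SUP (x, y) \<in> {(x, y) \<in> cube m n \<times> cube m n. \<forall>l<n. l \<noteq> j \<longrightarrow> x l = y l}.
        tv_dist (cond_law n \<mu> i x) (cond_law n \<mu> i y))"

definition col_sum_norm :: "nat \<Rightarrow> (nat \<Rightarrow> nat \<Rightarrow> real) \<Rightarrow> real" where
  "col_sum_norm n A = (MAX j \<in> {..<n}. \<Sum>i<n. \<bar>A i j\<bar>)"

text \<open>The spectral norm is the operator norm with respect to the Euclidean norm on \<open>\<real>\<^sup>n\<close>.\<close>

definition spectral_norm :: "nat \<Rightarrow> (nat \<Rightarrow> nat \<Rightarrow> real) \<Rightarrow> real" where
  "spectral_norm n A =
     (SUP v \<in> {v :: nat \<Rightarrow> real. L2_set v {..<n} \<le> 1}. L2_set (\<lambda>i. \<Sum>j<n. A i j * v j) {..<n})"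

text \<open>The distribution function is a bijection from the reals onto the open unit interval, so
  \<open>inv\<close> is its genuine inverse there.\<close>

definition gauss_profile :: "real \<Rightarrow> real" where
  "gauss_profile x =
     (if 0 < x \<and> x < 1 then std_normal_density (inv (cdf std_normal_distribution) x) else 0)"

definition bobkov_gamma :: "real \<Rightarrow> real \<Rightarrow> real \<Rightarrow> real" where
  "bobkov_gamma b \<rho> t =
     (if \<rho> = 0 then 4 * t / b else 2 * (1 - exp (- 2 * \<rho> * t)) / (b * \<rho>))"

end

theory Submission
  imports Defs
begin

text \<open>
  Everything is driven by the semigroup \<open>P\<^sub>t = e\<^sup>t\<^sup>L\<close>. Write \<open>D\<^sub>a f = q\<^sub>a (f \<circ> \<tau>\<^sub>a - f)\<close>, where
  \<open>a = (i, k)\<close> and \<open>\<tau>\<^sub>a\<close> adds \<open>k\<close> to coordinate \<open>i\<close>, so that \<open>L\<close> is the sum of the \<open>D\<^sub>a\<close>. For the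
  canonical rates the product \<open>q\<^sub>a(\<tau>\<^sub>c x) q\<^sub>c(x)\<close> is symmetric in \<open>a\<close> and \<open>c\<close>. Because of this the
  commutator of \<open>D\<^sub>a\<close> with \<open>L\<close> contains no second differences: it is a matrix \<open>B(x)\<close> acting on the
  vector \<open>(D\<^sub>c f(x))\<^sub>c\<close> at the same point (\<open>D_L_commutator\<close>). The entries of \<open>B\<close> are differences of
  rates, hence they are dominated by the Dobrushin matrix: its spectral norm controls the part
  coming from \<open>q\<^sub>a\<close> changing in the directions \<open>c\<close>, its maximal column sum the diagonal part. So \<open>B\<close>
  has a bound \<open>K\<close> that is independent of the dimension.

  The local Bobkov inequality follows by showing that
  \<open>s \<mapsto> P\<^sub>s (sqrt (I(P\<^sub>t\<^sub>-\<^sub>s f)\<^sup>2 + \<gamma>(s) \<Gamma>\<^sup>*(P\<^sub>t\<^sub>-\<^sub>s f)))\<close> increases, with \<open>\<rho> = -K\<close>. The commutator formula deals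
  with the gradient part. The profile part reduces to the two-point inequality
  \<open>I(a) (I(d) - I(a) - I'(a) (d - a)) \<ge> - (d - a)\<^sup>2\<close>, which is Birnbaum's bound for the Gaussian tail in
  disguise (\<open>gauss_profile_two_point\<close>); its constant one is exactly what the value \<open>4 / b\<close> of
  \<open>\<gamma>'(0)\<close> pays for.

  The four inequalities for boolean functions also need global information, namely a spectral gap
  and a logarithmic Sobolev inequality. Both come from tensorization. For a set \<open>I\<close> of free
  coordinates, average the chain rule for variance or entropy over the coordinate that is exposed
  first; an induction on the size of \<open>I\<close> then leaves only one estimate to prove: the sum over \<open>i\<close> of
  the variances of the one-dimensional marginals is bounded by the squares of the single-site
  fluctuations (\<open>marginal_variance_bound\<close>). This is Dobrushin's comparison argument: run the Glauber
  dynamics, telescope, and note that each step contracts the vector of oscillations by the factor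
  \<open>1 - \<delta> / card I\<close>.

  The logarithmic Sobolev inequality yields a Nash inequality, and thus a smoothing estimate
  between the \<open>L\<^sup>1\<close> and \<open>L\<^sup>2\<close> norms (\<open>hypercontractive\<close>). The commutator formula also yields a domination
  of \<open>\<bar>D\<^sub>a P\<^sub>s f\<bar>\<close> by \<open>P\<^sub>s\<close> applied to the initial gradients, up to a matrix of norm \<open>e\<^sup>K\<^sup>s\<close>
  (\<open>gradient_comparison\<close>). Now integrate the decay of the variance of \<open>P\<^sub>s f\<close> over \<open>0 \<le> s \<le> 1\<close>, and
  smooth each gradient: this is Talagrand's influence inequality, which implies the KKL bound. For
  the surface area, the Bobkov inequality for an indicator \<open>g\<close> bounds the mean of \<open>I(P\<^sub>t g)\<close> by the
  surface area times \<open>sqrt (\<gamma>(t))\<close>. At \<open>t = 1\<close>, smoothing forces \<open>P\<^sub>1 g\<close> to be small on most of its mass,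
  and there \<open>I(u)\<close> exceeds \<open>u\<close> by a logarithmic factor; this is the variance-surface-area inequality. For the
  Eldan-Gross inequality, smoothing bounds the variance of \<open>P\<^sub>2 f\<close> by a power of the squared
  influences \<open>W\<close> (\<open>noise_sensitivity\<close>), and the log-convexity of \<open>t \<mapsto> Var(P\<^sub>t f)\<close> shows that already the
  time \<open>t \<approx> 1 / log(1/W)\<close> destroys a fixed part of the variance.
\<close>

section \<open>The Gaussian isoperimetric profile\<close>

abbreviation \<phi> :: "real \<Rightarrow> real" where "\<phi> \<equiv> std_normal_density"
definition \<Phi> :: "real \<Rightarrow> real" where "\<Phi> = cdf std_normal_distribution"

lemma std_normal_density_DERIV: "(\<phi> has_real_derivative - (u * \<phi> u)) (at u)"
  unfolding std_normal_density_def
  by (auto intro!: derivative_eq_intros simp: field_simps)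

lemmas [derivative_intros] = std_normal_density_DERIV[THEN DERIV_chain2]

lemma std_normal_density_uminus: "\<phi> (- u) = \<phi> u"
  by (simp add: std_normal_density_def)

lemma std_normal_density_pos [simp]: "0 < \<phi> u"
  by (rule normal_density_pos) simp

text \<open>
  The distribution function is defined by a measure; its derivative is accessible only through
  the fundamental theorem of calculus, so its increments are first written as integrals.
\<close>

lemma \<Phi>_diff:
  assumes "a \<le> b"
  shows "\<Phi> b - \<Phi> a = integral {a..b} \<phi>"
proof -
  interpret real_distribution std_normal_distribution by (rule real_dist_normal_dist)
  let ?F = "\<lambda>u. integral {a - 1..u} \<phi>"
  have cont: "continuous_on S \<phi>" for S
    by (rule continuous_at_imp_continuous_on) (auto intro: DERIV_isCont std_normal_density_DERIV)
  have F: "(?F has_real_derivative \<phi> u) (at u)" if "u \<in> {a..b}" for u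
  proof -
    have "(?F has_real_derivative \<phi> u) (at u within {a - 1..b + 1})"
      by (rule integral_has_real_derivative[OF cont]) (use that in auto)
    thus ?thesis using that by (subst (asm) at_within_interior) auto
  qed
  have "(\<integral>\<^sup>+x. ennreal (\<phi> x) * indicator {a..b} x \<partial>lborel) = ?F b - ?F a"
    by (rule nn_integral_FTC_Icc) (use assms F in auto)
  also have "?F b - ?F a = integral {a..b} \<phi>"
  proof -
    have "integral {a - 1..a} \<phi> + integral {a..b} \<phi> = integral {a - 1..b} \<phi>"
      by (rule Henstock_Kurzweil_Integration.integral_combine) (use assms in \<open>auto intro: integrable_continuous_real cont\<close>)
    thus ?thesis by simp
  qed
  finally have *: "emeasure std_normal_distribution {a..b} = ennreal (integral {a..b} \<phi>)"
    by (simp add: emeasure_density)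
  have "emeasure std_normal_distribution {a} = 0"
    by (subst emeasure_density) (auto intro: nn_integral_null_set)
  hence z: "measure std_normal_distribution {a} = 0" by (simp add: measure_def)
  have "measure std_normal_distribution {a..b} = integral {a..b} \<phi>"
    using * by (simp add: measure_def integral_nonneg integrable_continuous_real cont)
  moreover have "measure std_normal_distribution {a..b} = measure std_normal_distribution {a<..b}"
  proof -
    have "{a..b} = {a} \<union> {a<..b}" using assms by auto
    hence "measure std_normal_distribution {a..b} = measure std_normal_distribution {a} + measure std_normal_distribution {a<..b}"
      by (subst finite_measure_Union[symmetric]) auto
    thus ?thesis using z by simp
  qed
  ultimately show ?thesis
    using cdf_diff_eq[of a b] assms unfolding \<Phi>_def by (cases "a = b") auto
qed

lemma \<Phi>_DERIV: "(\<Phi> has_real_derivative \<phi> u) (at u)"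
proof -
  have cont: "continuous_on S \<phi>" for S
    by (rule continuous_at_imp_continuous_on) (auto intro: DERIV_isCont std_normal_density_DERIV)
  have "u \<in> {u - 1..u + 1}" by simp
  from integral_has_real_derivative[OF cont this]
  have "((\<lambda>x. integral {u - 1..x} \<phi>) has_real_derivative \<phi> u) (at u within {u - 1..u + 1})" .
  from DERIV_add[OF DERIV_const[of "\<Phi> (u - 1)"] this]
  have d: "((\<lambda>x. \<Phi> (u - 1) + integral {u - 1..x} \<phi>) has_real_derivative \<phi> u) (at u within {u - 1..u + 1})"
    by simp
  have "(\<Phi> has_real_derivative \<phi> u) (at u within {u - 1..u + 1})"
  proof (rule has_field_derivative_transform_within[OF d zero_less_one])
    show "\<Phi> (u - 1) + integral {u - 1..x} \<phi> = \<Phi> x" if "x \<in> {u - 1..u + 1}" for x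
      using \<Phi>_diff[of "u - 1" x] that by simp
  qed simp
  thus ?thesis
    by (subst (asm) at_within_interior) auto
qed

lemmas [derivative_intros] = \<Phi>_DERIV[THEN DERIV_chain2]

lemma \<Phi>_strict_mono: "strict_mono \<Phi>"
proof (rule strict_monoI)
  fix u v :: real assume uv: "u < v"
  have "\<exists>y. DERIV \<Phi> x :> y \<and> 0 < y" for x
    using \<Phi>_DERIV[of x] std_normal_density_pos[of x] by (intro exI[of _ "\<phi> x"]) simp
  thus "\<Phi> u < \<Phi> v" using DERIV_pos_imp_increasing[of u v \<Phi>, OF uv] by blast
qed

lemma \<Phi>_less_iff [simp]: "\<Phi> u < \<Phi> v \<longleftrightarrow> u < v"
  using \<Phi>_strict_mono by (rule strict_mono_less)

lemma \<Phi>_le_iff [simp]: "\<Phi> u \<le> \<Phi> v \<longleftrightarrow> u \<le> v"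
  using \<Phi>_strict_mono by (rule strict_mono_less_eq)

lemma \<Phi>_at_top: "(\<Phi> \<longlongrightarrow> 1) at_top"
proof -
  interpret real_distribution std_normal_distribution by (rule real_dist_normal_dist)
  show ?thesis unfolding \<Phi>_def by (rule cdf_lim_at_top_prob)
qed

lemma \<Phi>_at_bot: "(\<Phi> \<longlongrightarrow> 0) at_bot"
proof -
  interpret real_distribution std_normal_distribution by (rule real_dist_normal_dist)
  show ?thesis unfolding \<Phi>_def by (rule cdf_lim_at_bot)
qed

lemma \<Phi>_bounds [simp]: "0 < \<Phi> u" "\<Phi> u < 1"
proof -
  interpret real_distribution std_normal_distribution by (rule real_dist_normal_dist)
  have "0 \<le> \<Phi> (u - 1)" unfolding \<Phi>_def by (rule cdf_nonneg)
  also have "\<dots> < \<Phi> u" by simp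
  finally show "0 < \<Phi> u" .
  have "\<Phi> u < \<Phi> (u + 1)" by simp
  also have "\<dots> \<le> 1" unfolding \<Phi>_def by (rule cdf_bounded_prob)
  finally show "\<Phi> u < 1" .
qed

lemma \<Phi>_surj:
  assumes "0 < x" "x < 1"
  obtains u where "x = \<Phi> u"
proof -
  have "\<forall>\<^sub>F u in at_top. x < \<Phi> u" by (rule order_tendstoD[OF \<Phi>_at_top]) (use assms in auto)
  then obtain v where v: "x < \<Phi> v" using eventually_happens'[OF trivial_limit_at_top_linorder] by blast
  have "\<forall>\<^sub>F u in at_bot. \<Phi> u < x" by (rule order_tendstoD[OF \<Phi>_at_bot]) (use assms in auto)
  then obtain w where w: "\<Phi> w < x" using eventually_happens'[OF trivial_limit_at_bot_linorder] by blast
  have "w \<le> v" using v w by (meson \<Phi>_less_iff less_trans less_imp_le)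
  then obtain u where "\<Phi> u = x"
    using IVT[of \<Phi> w x v] v w \<Phi>_DERIV by (auto intro: DERIV_isCont)
  thus ?thesis using that by auto
qed

lemma inv_\<Phi> [simp]: "inv \<Phi> (\<Phi> u) = u"
  by (simp add: \<Phi>_strict_mono strict_mono_imp_inj_on)

lemma \<phi>_at_infinity: "(\<phi> \<longlongrightarrow> 0) at_top" "(\<phi> \<longlongrightarrow> 0) at_bot"
  unfolding std_normal_density_def by real_asymp+

lemma \<Phi>_uminus: "\<Phi> (- u) = 1 - \<Phi> u"
proof -
  have "((\<lambda>u. \<Phi> u + \<Phi> (- u)) has_real_derivative 0) (at v)" for v
    by (auto intro!: derivative_eq_intros simp: std_normal_density_uminus)
  hence c: "\<Phi> v + \<Phi> (- v) = \<Phi> u + \<Phi> (- u)" for v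
    using DERIV_isconst_all[of "\<lambda>u. \<Phi> u + \<Phi> (- u)" v u] by auto
  have "((\<lambda>v. \<Phi> v + \<Phi> (- v)) \<longlongrightarrow> 1 + 0) at_top"
    by (intro tendsto_add \<Phi>_at_top filterlim_compose[OF \<Phi>_at_bot] filterlim_uminus_at_bot_at_top)
  moreover have "(\<lambda>v. \<Phi> v + \<Phi> (- v)) = (\<lambda>v. \<Phi> u + \<Phi> (- u))" using c by auto
  ultimately have "((\<lambda>v::real. \<Phi> u + \<Phi> (- u)) \<longlongrightarrow> 1 + 0) at_top" by metis
  hence "\<Phi> u + \<Phi> (- u) = 1"
    using tendsto_const_iff[of "at_top :: real filter" "\<Phi> u + \<Phi> (-u)" 1] by simp
  thus ?thesis by simp
qed

lemma gauss_profile_\<Phi> [simp]: "gauss_profile (\<Phi> u) = \<phi> u"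
  by (simp add: gauss_profile_def flip: \<Phi>_def)

lemma gauss_profile_nonneg: "0 \<le> gauss_profile x"
  by (simp add: gauss_profile_def)

lemma gauss_profile_pos: "0 < x \<Longrightarrow> x < 1 \<Longrightarrow> 0 < gauss_profile x"
  by (simp add: gauss_profile_def)

lemma gauss_profile_reflect: "gauss_profile (1 - x) = gauss_profile x"
proof (cases "0 < x \<and> x < 1")
  case True
  then obtain u where "x = \<Phi> u" by (metis \<Phi>_surj)
  thus ?thesis by (simp add: std_normal_density_uminus flip: \<Phi>_uminus)
qed (auto simp: gauss_profile_def)

text \<open>
  The profile solves \<open>I' = - \<Phi>\<^sup>-\<^sup>1\<close>. Stating it at a point \<open>\<Phi> u\<close> avoids the inverse function in all
  that follows.
\<close>

lemma gauss_profile_DERIV: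
  "(gauss_profile has_real_derivative - u) (at (\<Phi> u))"
proof -
  have d: "((inv \<Phi>) has_real_derivative inverse (\<phi> u)) (at (\<Phi> u))"
  proof (rule DERIV_inverse_function[where f=\<Phi> and a=0 and b=1])
    show "isCont (inv \<Phi>) (\<Phi> u)"
      by (rule isCont_inverse_function[where d=1]) (auto intro: DERIV_isCont[OF \<Phi>_DERIV])
    show "\<Phi> (inv \<Phi> y) = y" if "0 < y" "y < 1" for y
      using \<Phi>_surj[OF that] by (metis inv_\<Phi>)
  qed (use \<Phi>_DERIV in \<open>auto simp: less_imp_neq[OF std_normal_density_pos, symmetric]\<close>)
  have "((\<lambda>x. \<phi> (inv \<Phi> x)) has_real_derivative - (u * \<phi> u) * inverse (\<phi> u)) (at (\<Phi> u))"
    by (rule DERIV_chain2[OF _ d]) (simp add: std_normal_density_DERIV)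
  also have "- (u * \<phi> u) * inverse (\<phi> u) = - u"
    using std_normal_density_pos[of u] by (simp add: field_simps del: std_normal_density_pos)
  finally have *: "((\<lambda>x. \<phi> (inv \<Phi> x)) has_real_derivative - u) (at (\<Phi> u))" .
  show ?thesis
  proof (rule has_field_derivative_transform_within_open[OF *, of "{0<..<1}"])
    fix x :: real assume "x \<in> {0<..<1}"
    thus "\<phi> (inv \<Phi> x) = gauss_profile x"
      using \<Phi>_surj[of x] by (metis gauss_profile_\<Phi> greaterThanLessThan_iff inv_\<Phi>)
  qed auto
qed

text \<open>
  Like the two next bounds for the Gaussian tail \<open>Q = 1 - \<Phi>\<close>, this holds because the difference of
  the two sides decreases to its limit \<open>0\<close> at infinity.
\<close>

lemma mills_upper:
  assumes "0 \<le> u"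
  shows "u * (1 - \<Phi> u) \<le> \<phi> u"
proof -
  let ?G = "\<lambda>v. \<phi> v - u * (1 - \<Phi> v)"
  have "?G v \<le> ?G u" if "u \<le> v" for v
  proof (rule DERIV_nonpos_imp_nonincreasing[OF that])
    fix x assume "u \<le> x" "x \<le> v"
    hence "(?G has_real_derivative - (x * \<phi> x) + u * \<phi> x) (at x)" "- (x * \<phi> x) + u * \<phi> x \<le> 0"
      by (auto intro!: derivative_eq_intros mult_right_mono)
    thus "\<exists>y. DERIV ?G x :> y \<and> y \<le> 0" by blast
  qed
  hence ev: "\<forall>\<^sub>F v in at_top. ?G v \<le> ?G u"
    by (rule eventually_mono[OF eventually_ge_at_top[of u]])
  have "(?G \<longlongrightarrow> 0 - u * (1 - 1)) at_top"
    by (intro tendsto_intros \<phi>_at_infinity \<Phi>_at_top)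
  from tendsto_upperbound[OF this ev] show ?thesis by simp
qed

lemma mills_lower: "u * \<phi> u \<le> (1 + u\<^sup>2) * (1 - \<Phi> u)"
proof -
  let ?G = "\<lambda>v. (1 - \<Phi> v) - v / (1 + v\<^sup>2) * \<phi> v"
  have "?G v \<le> ?G u" if "u \<le> v" for v
  proof (rule DERIV_nonpos_imp_nonincreasing[OF that])
    fix x assume "u \<le> x" "x \<le> v"
    have nz: "1 + x\<^sup>2 \<noteq> 0" by (smt (verit) zero_le_power2)
    have "((\<lambda>v. v / (1 + v\<^sup>2)) has_real_derivative (1 * (1 + x\<^sup>2) - x * (2 * x)) / ((1 + x\<^sup>2) * (1 + x\<^sup>2))) (at x)"
      using nz by (intro DERIV_divide) (auto intro!: derivative_eq_intros)
    from DERIV_mult[OF this std_normal_density_DERIV] \<Phi>_DERIV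
    have "(?G has_real_derivative 0 - \<phi> x - ((1 * (1 + x\<^sup>2) - x * (2 * x)) / ((1 + x\<^sup>2) * (1 + x\<^sup>2)) * \<phi> x + - (x * \<phi> x) * (x / (1 + x\<^sup>2)))) (at x)"
      by (intro DERIV_diff DERIV_const)
    also have "0 - \<phi> x - ((1 * (1 + x\<^sup>2) - x * (2 * x)) / ((1 + x\<^sup>2) * (1 + x\<^sup>2)) * \<phi> x + - (x * \<phi> x) * (x / (1 + x\<^sup>2)))
       = - (2 / (1 + x\<^sup>2)\<^sup>2) * \<phi> x"
    proof -
      have e: "- 1 - ((1 * (1 + x\<^sup>2) - x * (2 * x)) / ((1 + x\<^sup>2) * (1 + x\<^sup>2)) - x / (1 + x\<^sup>2) * x) = - (2 / (1 + x\<^sup>2)\<^sup>2)"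
        using nz by (simp add: divide_simps power2_eq_square) (simp add: algebra_simps)
      show ?thesis unfolding e[symmetric] by (simp add: algebra_simps)
    qed
    finally show "\<exists>y. DERIV ?G x :> y \<and> y \<le> 0" by (intro exI conjI) (auto intro!: mult_nonneg_nonneg)
  qed
  hence ev: "\<forall>\<^sub>F v in at_top. ?G v \<le> ?G u"
    by (rule eventually_mono[OF eventually_ge_at_top[of u]])
  have "(?G \<longlongrightarrow> (1 - 1) - 0 * 0) at_top"
    by (intro tendsto_intros \<phi>_at_infinity \<Phi>_at_top) real_asymp
  from tendsto_upperbound[OF this ev] have "u / (1 + u\<^sup>2) * \<phi> u \<le> 1 - \<Phi> u" by simp
  moreover have "1 + u\<^sup>2 > 0" by (smt (verit) zero_le_power2)
  ultimately show ?thesis by (simp add: field_simps)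
qed

text \<open>
  Birnbaum's lower bound \<open>2 Q \<ge> (sqrt (u\<^sup>2 + 4) - u) \<phi>\<close>, written as the sign of the quadratic form
  whose root it is. The derivative of that form is \<open>\<phi>\<close> times the defect in \<open>mills_lower\<close>.
\<close>

lemma birnbaum: "0 \<le> (1 - \<Phi> u)\<^sup>2 + u * \<phi> u * (1 - \<Phi> u) - (\<phi> u)\<^sup>2"
proof -
  let ?G = "\<lambda>v. (1 - \<Phi> v)\<^sup>2 + v * \<phi> v * (1 - \<Phi> v) - (\<phi> v)\<^sup>2"
  have "?G v \<le> ?G u" if "u \<le> v" for v
  proof (rule DERIV_nonpos_imp_nonincreasing[OF that])
    fix x assume "u \<le> x" "x \<le> v"
    have "(?G has_real_derivative 2 * (1 - \<Phi> x) * (- \<phi> x) + ((1 * \<phi> x + x * (- (x * \<phi> x))) * (1 - \<Phi> x) + x * \<phi> x * (- \<phi> x))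
       - 2 * \<phi> x * (- (x * \<phi> x))) (at x)"
      by (auto intro!: derivative_eq_intros simp: algebra_simps)
    also have "2 * (1 - \<Phi> x) * (- \<phi> x) + ((1 * \<phi> x + x * (- (x * \<phi> x))) * (1 - \<Phi> x) + x * \<phi> x * (- \<phi> x))
       - 2 * \<phi> x * (- (x * \<phi> x)) = \<phi> x * (x * \<phi> x - (1 + x\<^sup>2) * (1 - \<Phi> x))"
      by (simp add: algebra_simps power2_eq_square)
    finally show "\<exists>y. DERIV ?G x :> y \<and> y \<le> 0"
      using mills_lower[of x] by (intro exI conjI) (auto intro!: mult_nonneg_nonpos)
  qed
  hence ev: "\<forall>\<^sub>F v in at_top. ?G v \<le> ?G u"
    by (rule eventually_mono[OF eventually_ge_at_top[of u]])
  have "((\<lambda>v. v * \<phi> v) \<longlongrightarrow> 0) at_top"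
    unfolding std_normal_density_def by real_asymp
  hence "(?G \<longlongrightarrow> (1 - 1)\<^sup>2 + 0 * (1 - 1) - 0\<^sup>2) at_top"
    by (intro tendsto_intros \<phi>_at_infinity \<Phi>_at_top)
  from tendsto_upperbound[OF this ev] show ?thesis by simp
qed


lemma gauss_profile_near_0:
  assumes "0 < e"
  shows "\<exists>d>0. \<forall>x<d. gauss_profile x < e"
proof -
  have "\<forall>\<^sub>F u in at_bot. \<phi> u < e" by (rule order_tendstoD(2)[OF \<phi>_at_infinity(2) assms])
  then obtain V where V: "\<And>u. u \<le> V \<Longrightarrow> \<phi> u < e" by (auto simp: eventually_at_bot_linorder)
  have "gauss_profile x < e" if "x < \<Phi> V" for x
  proof (cases "0 < x")
    case True
    moreover have "x < 1" using that \<Phi>_bounds(2)[of V] by linarith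
    ultimately obtain u where u: "x = \<Phi> u" by (rule \<Phi>_surj)
    thus ?thesis using that V[of u] by simp
  qed (use assms in \<open>simp add: gauss_profile_def\<close>)
  thus ?thesis using \<Phi>_bounds(1)[of V] by blast
qed

text \<open>
  Continuity at the end points \<open>0\<close> and \<open>1\<close> is what allows the Bobkov inequality to be proved first
  for functions with values away from them.
\<close>

lemma isCont_gauss_profile: "isCont gauss_profile x"
proof -
  have left: "isCont gauss_profile x" if "x \<le> 0" for x
    unfolding continuous_at_eps_delta
  proof (intro allI impI)
    fix e :: real assume "0 < e"
    then obtain d where d: "d > 0" "\<forall>y<d. gauss_profile y < e" using gauss_profile_near_0 by blast
    show "\<exists>d>0. \<forall>y. dist y x < d \<longrightarrow> dist (gauss_profile y) (gauss_profile x) < e"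
    proof (intro exI[of _ d] conjI allI impI d(1))
      fix y assume "dist y x < d"
      hence "y < d" using that by (simp add: dist_real_def)
      thus "dist (gauss_profile y) (gauss_profile x) < e"
        using d(2) that gauss_profile_nonneg[of y] by (simp add: gauss_profile_def[of x] dist_real_def)
    qed
  qed
  consider "x \<le> 0" | "0 < x" "x < 1" | "1 \<le> x" by linarith
  thus ?thesis
  proof cases
    case 2
    then obtain u where "x = \<Phi> u" by (rule \<Phi>_surj)
    thus ?thesis using gauss_profile_DERIV by (auto intro: DERIV_isCont)
  next
    case 3
    have "isCont (\<lambda>x. gauss_profile (1 - x)) x"
      by (rule isCont_o2[OF _ left]) (use 3 in \<open>auto intro!: continuous_intros\<close>)
    thus ?thesis by (simp add: gauss_profile_reflect)
  qed (rule left)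
qed

text \<open>
  As a function of \<open>v\<close> the right-hand side vanishes at \<open>v = u\<close>, first increases and then, once its
  derivative has become negative, decreases forever. So it is at least the smaller of \<open>0\<close> and its
  limit at infinity, and that limit is nonnegative by Birnbaum's inequality.
\<close>

lemma gauss_profile_two_point_pos:
  assumes "u \<le> v"
  shows "0 \<le> \<phi> u * \<phi> v - (\<phi> u)\<^sup>2 + u * \<phi> u * (\<Phi> v - \<Phi> u) + (\<Phi> v - \<Phi> u)\<^sup>2"
proof -
  let ?G = "\<lambda>v. \<phi> u * \<phi> v - (\<phi> u)\<^sup>2 + u * \<phi> u * (\<Phi> v - \<Phi> u) + (\<Phi> v - \<Phi> u)\<^sup>2"
  let ?h = "\<lambda>v. 2 * (\<Phi> v - \<Phi> u) - (v - u) * \<phi> u"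
  have dG: "(?G has_real_derivative \<phi> v * ?h v) (at v)" for v
    by (auto intro!: derivative_eq_intros simp: algebra_simps)
  have dh: "(?h has_real_derivative 2 * \<phi> v - \<phi> u) (at v)" for v
    by (auto intro!: derivative_eq_intros simp: algebra_simps)
  have phi_mono: "\<phi> b \<le> \<phi> a" if "\<bar>a\<bar> \<le> \<bar>b\<bar>" for a b
    using that unfolding std_normal_density_def by (intro mult_left_mono) (auto simp: abs_le_square_iff)
  have Glim: "0 \<le> - (\<phi> u)\<^sup>2 + u * \<phi> u * (1 - \<Phi> u) + (1 - \<Phi> u)\<^sup>2"
    using birnbaum[of u] by simp
  have "(?G \<longlongrightarrow> \<phi> u * 0 - (\<phi> u)\<^sup>2 + u * \<phi> u * (1 - \<Phi> u) + (1 - \<Phi> u)\<^sup>2) at_top"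
    by (intro tendsto_intros \<phi>_at_infinity \<Phi>_at_top)
  hence lim: "(?G \<longlongrightarrow> - (\<phi> u)\<^sup>2 + u * \<phi> u * (1 - \<Phi> u) + (1 - \<Phi> u)\<^sup>2) at_top" by simp
  (* h is quasi-concave on [u, \<infinity>): once it is negative it stays negative *)
  have hdrop: "?h w \<le> 0" if "u \<le> v" "?h v < 0" "v \<le> w" for v w
  proof -
    have "\<exists>\<xi>. u < \<xi> \<and> \<xi> < v \<and> ?h v - ?h u = (v - u) * (2 * \<phi> \<xi> - \<phi> u)"
      by (rule MVT2) (use that dh in \<open>auto simp: le_less\<close>)
    then obtain \<xi> where xi: "u < \<xi>" "\<xi> < v" "?h v - ?h u = (v - u) * (2 * \<phi> \<xi> - \<phi> u)" by blast
    have "(v - u) * (2 * \<phi> \<xi> - \<phi> u) < 0" using xi(3) that by simp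
    hence neg: "2 * \<phi> \<xi> - \<phi> u < 0" using xi by (simp add: mult_less_0_iff)
    have "\<phi> \<xi> < \<phi> u" using neg std_normal_density_pos[of \<xi>] by linarith
    hence "\<not> \<bar>\<xi>\<bar> \<le> \<bar>u\<bar>" using phi_mono[of \<xi> u] by linarith
    hence "0 < \<xi>" using xi(1) by linarith
    have "?h w \<le> ?h v"
    proof (rule DERIV_nonpos_imp_nonincreasing[OF that(3)])
      fix x assume "v \<le> x" "x \<le> w"
      hence "\<phi> x \<le> \<phi> \<xi>" using phi_mono[of \<xi> x] \<open>0 < \<xi>\<close> xi(2) by simp
      thus "\<exists>y. DERIV ?h x :> y \<and> y \<le> 0" using dh[of x] neg by (intro exI[of _ "2 * \<phi> x - \<phi> u"]) simp
    qed
    thus ?thesis using that(2) by simp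
  qed
  show ?thesis
  proof (cases "\<forall>x\<in>{u..v}. 0 \<le> ?h x")
    case True
    have "?G u \<le> ?G v"
    proof (rule DERIV_nonneg_imp_nondecreasing[OF assms])
      fix x assume "u \<le> x" "x \<le> v"
      hence "0 \<le> \<phi> x * ?h x" using True by simp
      thus "\<exists>y. DERIV ?G x :> y \<and> 0 \<le> y" using dG[of x] by blast
    qed
    moreover have "?G u = 0" by (simp add: power2_eq_square)
    ultimately show ?thesis by simp
  next
    case False
    then obtain x where x: "u \<le> x" "x \<le> v" "?h x < 0" by force
    have "?G w \<le> ?G v" if "v \<le> w" for w
    proof (rule DERIV_nonpos_imp_nonincreasing[OF that])
      fix y assume "v \<le> y" "y \<le> w"
      hence "?h y \<le> 0" using hdrop[of x y] x by simp
      hence "\<phi> y * ?h y \<le> 0" by (simp add: mult_nonneg_nonpos)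
      thus "\<exists>z. DERIV ?G y :> z \<and> z \<le> 0" using dG[of y] by blast
    qed
    hence ev: "\<forall>\<^sub>F w in at_top. ?G w \<le> ?G v"
      by (rule eventually_mono[OF eventually_ge_at_top[of v]])
    show ?thesis using tendsto_upperbound[OF lim ev] Glim by simp
  qed
qed

text \<open>
  The substitute for \<open>I I'' = -1\<close> when the second point is at a positive distance. The case \<open>v < u\<close>
  follows from the symmetry of the Gaussian law.
\<close>

lemma gauss_profile_two_point:
  assumes "0 < d" "d < 1"
  shows "gauss_profile (\<Phi> u) * (gauss_profile d - gauss_profile (\<Phi> u) + u * (d - \<Phi> u)) \<ge> - (d - \<Phi> u)\<^sup>2"
proof -
  obtain v where v: "d = \<Phi> v" using assms by (rule \<Phi>_surj)
  have "0 \<le> \<phi> u * \<phi> v - (\<phi> u)\<^sup>2 + u * \<phi> u * (\<Phi> v - \<Phi> u) + (\<Phi> v - \<Phi> u)\<^sup>2"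
  proof (cases "u \<le> v")
    case True
    thus ?thesis by (rule gauss_profile_two_point_pos)
  next
    case False
    thus ?thesis using gauss_profile_two_point_pos[of "- u" "- v"]
      by (simp add: \<Phi>_uminus std_normal_density_uminus power2_commute algebra_simps)
  qed
  thus ?thesis unfolding v by (simp add: algebra_simps power2_eq_square)
qed

lemma mills_upper_linear:
  assumes "0 \<le> u"
  shows "(1 - \<Phi> u) * (1 + u) \<le> 3 * \<phi> u"
proof -
  let ?G = "\<lambda>v. \<phi> v - (1 - \<Phi> v) / 2"
  have half: "\<Phi> 0 = 1 / 2" using \<Phi>_uminus[of 0] by simp
  have ph0: "1 / 4 \<le> \<phi> 0"
  proof -
    have "2 * pi \<le> 4\<^sup>2" using pi_less_4 by simp
    hence "sqrt (2 * pi) \<le> sqrt (4\<^sup>2)" by (rule real_sqrt_le_mono)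
    hence "sqrt (2 * pi) \<le> 4" by simp
    thus ?thesis by (simp add: std_normal_density_def field_simps)
  qed
  have b: "(1 - \<Phi> u) / 2 \<le> \<phi> u"
  proof (cases "u \<le> 1 / 2")
    case True
    have "?G 0 \<le> ?G u"
    proof (rule DERIV_nonneg_imp_nondecreasing[OF assms])
      fix x :: real assume "0 \<le> x" "x \<le> u"
      have "(?G has_real_derivative (1 / 2 - x) * \<phi> x) (at x)"
        by (auto intro!: derivative_eq_intros simp: algebra_simps)
      moreover have "0 \<le> (1 / 2 - x) * \<phi> x" using \<open>x \<le> u\<close> True by simp
      ultimately show "\<exists>y. DERIV ?G x :> y \<and> 0 \<le> y" by blast
    qed
    moreover have "(1 - \<Phi> 0) / 2 = 1 / 4" using half by simp
    ultimately show ?thesis using ph0 by (metis diff_ge_0_iff_ge order_trans)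
  next
    case False
    hence "1 / 2 * (1 - \<Phi> u) \<le> u * (1 - \<Phi> u)"
      by (intro mult_right_mono) (auto intro: less_imp_le[OF \<Phi>_bounds(2)])
    thus ?thesis using mills_upper[OF assms] by linarith
  qed
  show ?thesis using b mills_upper[OF assms] by (simp add: algebra_simps)
qed

lemma mills_lower_linear:
  assumes "0 \<le> u"
  shows "\<phi> u \<le> (1 - \<Phi> u) * (1 + u)"
proof (rule ccontr)
  define Q where "Q = 1 - \<Phi> u"
  have Q: "0 < Q" by (simp add: Q_def)
  assume "\<not> ?thesis"
  hence l: "Q * (1 + u) < \<phi> u" by (simp add: Q_def)
  have "Q\<^sup>2 + u * \<phi> u * Q - (\<phi> u)\<^sup>2 < 0"
  proof -
    have "u * Q \<le> \<phi> u - Q" using l by (simp add: algebra_simps)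
    hence "\<phi> u * (u * Q) \<le> \<phi> u * (\<phi> u - Q)" by (intro mult_left_mono) auto
    moreover have "Q < \<phi> u" using l assms Q by (smt (verit) mult_le_cancel_left1 mult_nonneg_nonneg distrib_left mult.right_neutral)
    hence "Q * Q < Q * \<phi> u" using Q by simp
    ultimately show ?thesis by (simp add: algebra_simps power2_eq_square)
  qed
  thus False using birnbaum[of u] by (simp add: Q_def)
qed

text \<open>
  Write \<open>x = 1 - \<Phi> u\<close> with \<open>u \<ge> 0\<close>. The lower bound for the tail gives \<open>log (1/x) \<le> (1 + u)\<^sup>2\<close>, and the
  upper bound \<open>x (1 + u) \<le> 3 \<phi> u\<close> replaces \<open>1 + u\<close> by the profile.
\<close>

lemma gauss_profile_ge_log:
  assumes "0 < x" "x \<le> 1 / 2"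
  shows "x * sqrt (ln (1 / x)) / 3 \<le> gauss_profile x" "x / 3 \<le> gauss_profile x"
proof -
  obtain v where v: "x = \<Phi> v" by (rule \<Phi>_surj[of x]) (use assms in auto)
  define u where "u = - v"
  have xu: "x = 1 - \<Phi> u" by (simp add: v u_def \<Phi>_uminus)
  have half: "\<Phi> 0 = 1 / 2" using \<Phi>_uminus[of 0] by simp
  have "\<Phi> v \<le> \<Phi> 0" using assms v half by linarith
  hence u0: "0 \<le> u" by (simp add: u_def)
  have I: "gauss_profile x = \<phi> u" by (simp add: v u_def std_normal_density_uminus)
  have "ln (\<phi> u) \<le> ln (x * (1 + u))"
    using mills_lower_linear[OF u0] assms u0 by (subst ln_le_cancel_iff) (auto simp flip: xu)
  also have "\<dots> = ln x + ln (1 + u)" using assms u0 by (simp add: ln_mult)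
  also have "ln (1 + u) \<le> u" using u0 by (rule ln_add_one_self_le_self)
  finally have l1: "ln (\<phi> u) \<le> ln x + u" by simp
  have "ln (sqrt (2 * pi)) \<le> 1"
  proof -
    have "2 * pi \<le> 7" using pi_approx by simp
    also have "7 \<le> (41 / 32 :: real) ^ 8" by (simp add: power_divide)
    also have "(41 / 32 :: real) ^ 8 \<le> exp (1 / 4) ^ 8"
      using exp_lower_Taylor_quadratic[of "1 / 4 :: real"] by (intro power_mono) (auto simp: power_divide)
    also have "\<dots> = exp (2::real)" by (simp flip: exp_of_nat_mult)
    finally have "ln (2 * pi) \<le> 2" by (subst (asm) ln_le_cancel_iff[symmetric]) auto
    thus ?thesis by (simp add: ln_sqrt)
  qed
  moreover have "ln (\<phi> u) = - ln (sqrt (2 * pi)) - u\<^sup>2 / 2"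
    unfolding std_normal_density_def by (subst ln_mult) (auto simp: ln_div)
  ultimately have "- ln x \<le> 1 + u + u\<^sup>2 / 2" using l1 by linarith
  also have "\<dots> \<le> (1 + u)\<^sup>2" using u0 by (simp add: power2_eq_square algebra_simps)
  finally have "ln (1 / x) \<le> (1 + u)\<^sup>2" using assms by (simp add: ln_div)
  hence "sqrt (ln (1 / x)) \<le> 1 + u" using u0 by (intro real_le_lsqrt) auto
  hence "x * sqrt (ln (1 / x)) \<le> x * (1 + u)" using assms by (intro mult_left_mono) auto
  also have "\<dots> \<le> 3 * \<phi> u" using mills_upper_linear[OF u0] by (simp flip: xu)
  finally show "x * sqrt (ln (1 / x)) / 3 \<le> gauss_profile x" by (simp add: I)
  have "x * 1 \<le> x * (1 + u)" using assms u0 by (intro mult_left_mono) auto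
  also have "\<dots> \<le> 3 * \<phi> u" using mills_upper_linear[OF u0] by (simp flip: xu)
  finally show "x / 3 \<le> gauss_profile x" by (simp add: I)
qed

lemma gauss_profile_ge_variance:
  assumes "0 \<le> x" "x \<le> 1"
  shows "x * (1 - x) / 3 \<le> gauss_profile x"
proof -
  have *: "x * (1 - x) / 3 \<le> gauss_profile x" if "0 \<le> x" "x \<le> 1 / 2" for x
  proof (cases "x = 0")
    case False
    have "x * (1 - x) \<le> x * 1" using that by (intro mult_left_mono) auto
    thus ?thesis using gauss_profile_ge_log(2)[of x] that False by linarith
  qed (simp add: gauss_profile_def)
  show ?thesis
  proof (cases "x \<le> 1 / 2")
    case True
    thus ?thesis using * assms by simp
  next
    case False
    thus ?thesis using *[of "1 - x"] assms by (simp add: gauss_profile_reflect mult.commute)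
  qed
qed

section \<open>Exponentials of operators on functions over a finite set\<close>

lemma sum_indicator_mult:
  assumes "finite S" "x \<in> S"
  shows "(\<Sum>y\<in>S. (if x = y then 1 else 0) * f y) = (f x :: real)"
    and "(\<Sum>y\<in>S. f y * (if y = x then 1 else 0)) = f x"
proof -
  have "(\<Sum>y\<in>S. (if x = y then 1 else 0) * f y) = (\<Sum>y\<in>S. if x = y then f y else 0)"
    by (rule sum.cong) auto
  thus "(\<Sum>y\<in>S. (if x = y then 1 else 0) * f y) = f x" using assms by simp
  have "(\<Sum>y\<in>S. f y * (if y = x then 1 else 0)) = (\<Sum>y\<in>S. if y = x then f y else 0)"
    by (rule sum.cong) auto
  thus "(\<Sum>y\<in>S. f y * (if y = x then 1 else 0)) = f x" using assms by simp
qed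

text \<open>
  The exponential series \<open>e\<^sup>t\<^sup>T f\<close> at a point. No norm on the function space enters: \<open>T\<close> will always
  act through a matrix on a finite set, where the series converges pointwise.
\<close>

definition expo :: "(('a \<Rightarrow> real) \<Rightarrow> 'a \<Rightarrow> real) \<Rightarrow> real \<Rightarrow> ('a \<Rightarrow> real) \<Rightarrow> 'a \<Rightarrow> real" where
  "expo T t f x = (\<Sum>j. t ^ j / fact j * ((T ^^ j) f) x)"

locale kernel_op =
  fixes S :: "'a set" and T :: "('a \<Rightarrow> real) \<Rightarrow> 'a \<Rightarrow> real" and A :: "'a \<Rightarrow> 'a \<Rightarrow> real"
  assumes finite_S: "finite S"
    and kernel: "x \<in> S \<Longrightarrow> T f x = (\<Sum>y\<in>S. A x y * f y)"
begin

lemma op_cong: "(\<And>y. y \<in> S \<Longrightarrow> f y = g y) \<Longrightarrow> x \<in> S \<Longrightarrow> T f x = T g x"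
  by (simp add: kernel)

lemma funpow_cong:
  "(\<And>y. y \<in> S \<Longrightarrow> f y = g y) \<Longrightarrow> x \<in> S \<Longrightarrow> (T ^^ j) f x = (T ^^ j) g x"
  by (induction j arbitrary: x) (auto intro: op_cong)

lemma expo_cong: "(\<And>y. y \<in> S \<Longrightarrow> f y = g y) \<Longrightarrow> x \<in> S \<Longrightarrow> expo T t f x = expo T t g x"
  unfolding expo_def using funpow_cong[of f g x] by simp

lemma funpow_kernel:
  "\<exists>B. \<forall>f. \<forall>x\<in>S. (T ^^ j) f x = (\<Sum>y\<in>S. B x y * f y)"
proof (induction j)
  case 0
  show ?case
  proof (intro exI[of _ "\<lambda>x y. if x = y then 1 else 0"] allI ballI)
    fix f :: "'a \<Rightarrow> real" and x assume "x \<in> S"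
    thus "(T ^^ 0) f x = (\<Sum>y\<in>S. (if x = y then 1 else 0) * f y)"
      using sum_indicator_mult(1)[OF finite_S] by simp
  qed
next
  case (Suc j)
  then obtain B where B: "\<And>f x. x \<in> S \<Longrightarrow> (T ^^ j) f x = (\<Sum>y\<in>S. B x y * f y)" by blast
  show ?case
  proof (intro exI[of _ "\<lambda>x y. \<Sum>z\<in>S. A x z * B z y"] allI ballI)
    fix f :: "'a \<Rightarrow> real" and x assume "x \<in> S"
    have "(T ^^ Suc j) f x = (\<Sum>z\<in>S. A x z * (\<Sum>y\<in>S. B z y * f y))"
      using \<open>x \<in> S\<close> by (simp add: kernel B)
    also have "\<dots> = (\<Sum>z\<in>S. \<Sum>y\<in>S. A x z * B z y * f y)" by (simp add: sum_distrib_left mult.assoc)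
    also have "\<dots> = (\<Sum>y\<in>S. \<Sum>z\<in>S. A x z * B z y * f y)" by (rule sum.swap)
    finally show "(T ^^ Suc j) f x = (\<Sum>y\<in>S. (\<Sum>z\<in>S. A x z * B z y) * f y)" by (simp add: sum_distrib_right)
  qed
qed

definition bnd :: real where "bnd = (\<Sum>x\<in>S. \<Sum>y\<in>S. \<bar>A x y\<bar>)"

lemma funpow_bound:
  assumes "x \<in> S"
  shows "\<bar>(T ^^ j) f x\<bar> \<le> bnd ^ j * (\<Sum>y\<in>S. \<bar>f y\<bar>)"
  using assms
proof (induction j arbitrary: x)
  case 0
  thus ?case using member_le_sum[of x S "\<lambda>y. \<bar>f y\<bar>"] finite_S by simp
next
  case (Suc j)
  have "\<bar>(T ^^ Suc j) f x\<bar> \<le> (\<Sum>y\<in>S. \<bar>A x y\<bar> * \<bar>(T ^^ j) f y\<bar>)"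
    using sum_abs[of "\<lambda>y. A x y * (T ^^ j) f y" S] Suc.prems by (simp add: kernel abs_mult)
  also have "\<dots> \<le> (\<Sum>y\<in>S. \<bar>A x y\<bar> * (bnd ^ j * (\<Sum>y\<in>S. \<bar>f y\<bar>)))"
    by (intro sum_mono mult_left_mono Suc.IH) auto
  also have "\<dots> = (\<Sum>y\<in>S. \<bar>A x y\<bar>) * (bnd ^ j * (\<Sum>y\<in>S. \<bar>f y\<bar>))" by (simp add: sum_distrib_right)
  also have "(\<Sum>y\<in>S. \<bar>A x y\<bar>) \<le> bnd"
    unfolding bnd_def by (rule member_le_sum[of x S "\<lambda>x. \<Sum>y\<in>S. \<bar>A x y\<bar>"])
      (use Suc.prems finite_S in \<open>auto intro: sum_nonneg\<close>)
  hence "(\<Sum>y\<in>S. \<bar>A x y\<bar>) * (bnd ^ j * (\<Sum>y\<in>S. \<bar>f y\<bar>)) \<le> bnd * (bnd ^ j * (\<Sum>y\<in>S. \<bar>f y\<bar>))"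
    by (rule mult_right_mono) (auto intro!: mult_nonneg_nonneg sum_nonneg zero_le_power simp: bnd_def)
  finally show ?case by (simp add: mult.assoc)
qed

lemma summable_expo:
  assumes "x \<in> S"
  shows "summable (\<lambda>j. ((T ^^ j) f x / fact j) * t ^ j)"
proof (rule summable_comparison_test')
  show "summable (\<lambda>j. (\<Sum>y\<in>S. \<bar>f y\<bar>) * ((bnd * \<bar>t\<bar>) ^ j /\<^sub>R fact j))"
    by (intro summable_mult summable_exp_generic)
  fix j :: nat
  have "norm ((T ^^ j) f x / fact j * t ^ j) = \<bar>(T ^^ j) f x\<bar> * (\<bar>t\<bar> ^ j / fact j)"
    by (simp add: abs_mult power_abs)
  also have "\<dots> \<le> bnd ^ j * (\<Sum>y\<in>S. \<bar>f y\<bar>) * (\<bar>t\<bar> ^ j / fact j)"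
    by (intro mult_right_mono funpow_bound assms) auto
  finally show "norm ((T ^^ j) f x / fact j * t ^ j) \<le> (\<Sum>y\<in>S. \<bar>f y\<bar>) * ((bnd * \<bar>t\<bar>) ^ j /\<^sub>R fact j)"
    by (simp add: power_mult_distrib field_simps)
qed

lemma summable_expo': "x \<in> S \<Longrightarrow> summable (\<lambda>j. t ^ j / fact j * (T ^^ j) f x)"
  using summable_expo[of x f t] by (simp add: mult.commute)

lemma expo_0 [simp]: "expo T 0 f x = f x"
proof -
  have "(\<lambda>j. 0 ^ j / fact j * (T ^^ j) f x) = (\<lambda>j. if j = 0 then f x else 0)" by auto
  thus ?thesis unfolding expo_def using sums_single[of 0 "\<lambda>_. f x"] by (simp add: sums_iff)
qed

lemma expo_op: "x \<in> S \<Longrightarrow> expo T t (T f) x = T (expo T t f) x"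
proof -
  assume x: "x \<in> S"
  have "T (expo T t f) x = (\<Sum>y\<in>S. A x y * (\<Sum>j. t ^ j / fact j * (T ^^ j) f y))"
    using x by (simp add: kernel expo_def)
  also have "\<dots> = (\<Sum>y\<in>S. \<Sum>j. A x y * (t ^ j / fact j * (T ^^ j) f y))"
    by (intro sum.cong refl suminf_mult[symmetric] summable_expo') auto
  also have "\<dots> = (\<Sum>j. \<Sum>y\<in>S. A x y * (t ^ j / fact j * (T ^^ j) f y))"
    by (intro suminf_sum[symmetric] summable_mult summable_expo') auto
  also have "\<dots> = (\<Sum>j. t ^ j / fact j * T ((T ^^ j) f) x)"
    using x by (simp add: kernel sum_distrib_left mult_ac)
  finally show ?thesis unfolding expo_def by (simp add: funpow_swap1)
qed

lemma DERIV_expo: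
  assumes "x \<in> S"
  shows "((\<lambda>t. expo T t f x) has_real_derivative expo T t (T f) x) (at t)"
proof -
  define c where "c j = (T ^^ j) f x / fact j" for j
  have "((\<lambda>t. \<Sum>j. c j * t ^ j) has_real_derivative (\<Sum>j. diffs c j * t ^ j)) (at t)"
    by (rule termdiffs_strong_converges_everywhere) (use summable_expo[OF assms] in \<open>simp add: c_def\<close>)
  moreover have "diffs c j = (T ^^ j) (T f) x / fact j" for j
    by (simp add: diffs_def c_def funpow_swap1 field_simps del: of_nat_Suc)
  ultimately show ?thesis by (simp add: c_def expo_def mult.commute)
qed

lemma op_sum_left:
  "x \<in> S \<Longrightarrow> T (\<lambda>x. \<Sum>y\<in>S. c y * k y x) x = (\<Sum>y\<in>S. c y * T (k y) x)"
proof -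
  assume "x \<in> S"
  hence "T (\<lambda>x. \<Sum>y\<in>S. c y * k y x) x = (\<Sum>z\<in>S. \<Sum>y\<in>S. A x z * (c y * k y z))"
    by (simp add: kernel sum_distrib_left)
  also have "\<dots> = (\<Sum>y\<in>S. \<Sum>z\<in>S. A x z * (c y * k y z))" by (rule sum.swap)
  also have "\<dots> = (\<Sum>y\<in>S. c y * T (k y) x)" using \<open>x \<in> S\<close> by (simp add: kernel sum_distrib_left mult_ac)
  finally show ?thesis .
qed

definition hk :: "real \<Rightarrow> 'a \<Rightarrow> 'a \<Rightarrow> real" where "hk t x y = expo T t (\<lambda>z. if z = y then 1 else 0) x"

lemma expo_hk:
  assumes "x \<in> S"
  shows "expo T t f x = (\<Sum>y\<in>S. hk t x y * f y)"
proof -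
  have pow: "(T ^^ j) f x = (\<Sum>y\<in>S. f y * (T ^^ j) (\<lambda>z. if z = y then 1 else 0) x)" for j
  proof -
    obtain B where B: "\<And>f x. x \<in> S \<Longrightarrow> (T ^^ j) f x = (\<Sum>y\<in>S. B x y * f y)" using funpow_kernel by blast
    have "(T ^^ j) (\<lambda>z. if z = y then 1 else 0) x = B x y" if "y \<in> S" for y
      using sum_indicator_mult(2)[OF finite_S that] by (simp add: B[OF assms])
    thus ?thesis by (simp add: B[OF assms] mult.commute)
  qed
  have "expo T t f x = (\<Sum>j. \<Sum>y\<in>S. f y * (t ^ j / fact j * (T ^^ j) (\<lambda>z. if z = y then 1 else 0) x))"
    unfolding expo_def by (subst pow) (simp add: sum_distrib_left mult_ac)
  also have "\<dots> = (\<Sum>y\<in>S. \<Sum>j. f y * (t ^ j / fact j * (T ^^ j) (\<lambda>z. if z = y then 1 else 0) x))"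
    by (intro suminf_sum summable_mult summable_expo' assms)
  also have "\<dots> = (\<Sum>y\<in>S. f y * hk t x y)"
    unfolding hk_def expo_def by (intro sum.cong refl suminf_mult summable_expo' assms)
  finally show ?thesis by (simp add: mult.commute)
qed

lemma expo_linear:
  assumes "x \<in> S"
  shows "expo T t (\<lambda>y. a * f y + b * g y) x = a * expo T t f x + b * expo T t g x"
  by (simp add: expo_hk assms sum.distrib sum_distrib_left algebra_simps)

text \<open>
  The product rule behind all interpolations along a semigroup.
\<close>

lemma DERIV_expo_compose:
  assumes "x \<in> S" and v: "\<And>y. y \<in> S \<Longrightarrow> ((\<lambda>s. v s y) has_real_derivative v' y) (at s)"
    and r: "(r has_real_derivative r') (at s)"
  shows "((\<lambda>s. expo T (r s) (v s) x) has_real_derivative expo T (r s) (\<lambda>y. r' * T (v s) y + v' y) x) (at s)"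
proof -
  have k: "((\<lambda>t. hk t x y) has_real_derivative expo T t (T (\<lambda>z. if z = y then 1 else 0)) x) (at t)" for t y
    unfolding hk_def by (rule DERIV_expo[OF assms(1)])
  have "((\<lambda>s. \<Sum>y\<in>S. hk (r s) x y * v s y) has_real_derivative
     (\<Sum>y\<in>S. expo T (r s) (T (\<lambda>z. if z = y then 1 else 0)) x * r' * v s y + v' y * hk (r s) x y)) (at s)"
    by (intro DERIV_sum DERIV_mult DERIV_chain2[OF k r] v)
  also have "(\<Sum>y\<in>S. expo T (r s) (T (\<lambda>z. if z = y then 1 else 0)) x * r' * v s y + v' y * hk (r s) x y)
      = r' * (\<Sum>y\<in>S. v s y * T (\<lambda>x. hk (r s) x y) x) + (\<Sum>y\<in>S. hk (r s) x y * v' y)"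
  proof -
    have "expo T (r s) (T (\<lambda>z. if z = y then 1 else 0)) x = T (\<lambda>x. hk (r s) x y) x" for y
      by (simp add: expo_op[OF assms(1)] hk_def)
    thus ?thesis by (simp add: sum.distrib sum_distrib_left mult_ac)
  qed
  also have "(\<Sum>y\<in>S. v s y * T (\<lambda>x. hk (r s) x y) x) = T (expo T (r s) (v s)) x"
  proof -
    have "T (expo T (r s) (v s)) x = T (\<lambda>x. \<Sum>y\<in>S. v s y * hk (r s) x y) x"
      by (rule op_cong) (auto simp: expo_hk assms(1) mult.commute)
    thus ?thesis by (simp add: op_sum_left[OF assms(1)])
  qed
  also have "r' * T (expo T (r s) (v s)) x + (\<Sum>y\<in>S. hk (r s) x y * v' y)
     = expo T (r s) (\<lambda>y. r' * T (v s) y + 1 * v' y) x"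
    by (subst expo_linear[OF assms(1)]) (simp add: expo_op assms(1) expo_hk[of x _ v'])
  finally have "((\<lambda>s. \<Sum>y\<in>S. hk (r s) x y * v s y) has_real_derivative
     expo T (r s) (\<lambda>y. r' * T (v s) y + v' y) x) (at s)" by simp
  thus ?thesis by (simp add: expo_hk[OF assms(1), of "r _" "v _"])
qed

text \<open>
  If \<open>v\<close> solves the differential equation, then \<open>e\<^sup>(\<^sup>t\<^sup>-\<^sup>s\<^sup>)\<^sup>T v(s)\<close> has zero derivative in \<open>s\<close>; compare \<open>s = 0\<close> and
  \<open>s = t\<close>.
\<close>

lemma expo_unique:
  assumes v: "\<And>s y. y \<in> S \<Longrightarrow> ((\<lambda>s. v s y) has_real_derivative T (v s) y) (at s)"
    and "\<And>y. y \<in> S \<Longrightarrow> v 0 y = f y" and "x \<in> S"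
  shows "v t x = expo T t f x"
proof -
  have "((\<lambda>s. expo T (t - s) (v s) x) has_real_derivative 0) (at s)" for s
  proof -
    have "((\<lambda>s. expo T (t - s) (v s) x) has_real_derivative expo T (t - s) (\<lambda>y. - 1 * T (v s) y + T (v s) y) x) (at s)"
      by (intro DERIV_expo_compose assms(3) v) (auto intro!: derivative_eq_intros)
    also have "expo T (t - s) (\<lambda>y. - 1 * T (v s) y + T (v s) y) x = 0"
      by (simp add: expo_hk[OF assms(3)])
    finally show ?thesis .
  qed
  hence "expo T (t - t) (v t) x = expo T (t - 0) (v 0) x"
    using DERIV_isconst_all[of "\<lambda>s. expo T (t - s) (v s) x" t 0] by blast
  thus ?thesis using expo_cong[of "v 0" f x t] assms by simp
qed

lemma expo_add: "x \<in> S \<Longrightarrow> expo T (s + t) f x = expo T s (expo T t f) x"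
proof -
  assume x: "x \<in> S"
  show ?thesis
  proof (rule expo_unique[where v="\<lambda>s. expo T (s + t) f"])
    fix s y assume "y \<in> S"
    have "((\<lambda>s. expo T (s + t) f y) has_real_derivative expo T (s + t) (T f) y * (1 + 0)) (at s)"
      by (rule DERIV_chain2[OF DERIV_expo[OF \<open>y \<in> S\<close>]]) (auto intro!: derivative_eq_intros)
    thus "((\<lambda>s. expo T (s + t) f y) has_real_derivative T (expo T (s + t) f) y) (at s)"
      using \<open>y \<in> S\<close> by (simp add: expo_op)
  qed (use x in auto)
qed

end

text \<open>
  Adding a large multiple \<open>c\<close> of the identity to both operators makes the first matrix
  nonnegative on the diagonal, so that the domination holds for every term of the two series; it
  only multiplies both exponentials by \<open>e\<^sup>c\<^sup>t\<close>. With equal operators this is positivity of the semigroup.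
\<close>

lemma expo_comparison:
  assumes "kernel_op S T A" "kernel_op S T' A'"
    and off: "\<And>x y. x \<in> S \<Longrightarrow> y \<in> S \<Longrightarrow> x \<noteq> y \<Longrightarrow> \<bar>A x y\<bar> \<le> A' x y"
    and diag: "\<And>x. x \<in> S \<Longrightarrow> A x x \<le> A' x x"
    and fg: "\<And>x. x \<in> S \<Longrightarrow> \<bar>f x\<bar> \<le> g x"
    and "0 \<le> t" "x \<in> S"
  shows "\<bar>expo T t f x\<bar> \<le> expo T' t g x"
proof -
  interpret T: kernel_op S T A by fact
  interpret T': kernel_op S T' A' by fact
  obtain c where c: "\<And>x. x \<in> S \<Longrightarrow> 0 \<le> A x x + c"
  proof
    fix x assume "x \<in> S"
    have "\<bar>A x x\<bar> \<le> (\<Sum>x\<in>S. \<bar>A x x\<bar>)"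
      using member_le_sum[of x S "\<lambda>x. \<bar>A x x\<bar>"] \<open>x \<in> S\<close> T.finite_S by auto
    thus "0 \<le> A x x + (\<Sum>x\<in>S. \<bar>A x x\<bar>)" by linarith
  qed
  have shift: "kernel_op S (\<lambda>f x. T f x + c * f x) (\<lambda>x y. A x y + (if x = y then c else 0))" if "kernel_op S T A" for T A
  proof -
    interpret kernel_op S T A by fact
    show ?thesis
    proof
      fix f and x assume x: "x \<in> S"
      have "(\<Sum>y\<in>S. (A x y + (if x = y then c else 0)) * f y) = (\<Sum>y\<in>S. A x y * f y + (if x = y then c * f y else 0))"
        by (rule sum.cong) (auto simp: algebra_simps)
      thus "T f x + c * f x = (\<Sum>y\<in>S. (A x y + (if x = y then c else 0)) * f y)"
        using x finite_S by (simp add: kernel sum.distrib sum.delta)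
    qed (rule finite_S)
  qed
  have expo_shift: "expo (\<lambda>f x. T f x + c * f x) t f x = exp (c * t) * expo T t f x"
    if "kernel_op S T A" "x \<in> S" for T A t f x
  proof -
    interpret K: kernel_op S T A by fact
    interpret K': kernel_op S "\<lambda>f x. T f x + c * f x" "\<lambda>x y. A x y + (if x = y then c else 0)" by (rule shift) fact
    show ?thesis
    proof (rule K'.expo_unique[symmetric, where v="\<lambda>t x. exp (c * t) * expo T t f x"])
      fix s y assume y: "y \<in> S"
      have "((\<lambda>s. exp (c * s) * expo T s f y) has_real_derivative
          (exp (c * s) * c) * expo T s f y + T (expo T s f) y * exp (c * s)) (at s)"
        unfolding K.expo_op[OF y, symmetric]
        by (intro DERIV_mult K.DERIV_expo y) (auto intro!: derivative_eq_intros)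
      also have "T (expo T s f) y * exp (c * s) = T (\<lambda>x. exp (c * s) * expo T s f x) y"
        using y by (simp add: K.kernel sum_distrib_left mult_ac)
      finally show "((\<lambda>s. exp (c * s) * expo T s f y) has_real_derivative
        T (\<lambda>x. exp (c * s) * expo T s f x) y + c * (exp (c * s) * expo T s f y)) (at s)" by (simp add: mult_ac add_ac)
    qed (use that in auto)
  qed
  let ?T = "\<lambda>f x. T f x + c * f x" and ?T' = "\<lambda>f x. T' f x + c * f x"
  interpret U: kernel_op S ?T "\<lambda>x y. A x y + (if x = y then c else 0)" by (rule shift) fact
  interpret U': kernel_op S ?T' "\<lambda>x y. A' x y + (if x = y then c else 0)" by (rule shift) fact
  have pow: "\<bar>(?T ^^ j) f x\<bar> \<le> (?T' ^^ j) g x" if "x \<in> S" for j x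
    using that
  proof (induction j arbitrary: x)
    case (Suc j)
    have "\<bar>(?T ^^ Suc j) f x\<bar> \<le> (\<Sum>y\<in>S. \<bar>(A x y + (if x = y then c else 0)) * (?T ^^ j) f y\<bar>)"
      using U.kernel[OF Suc.prems, of "(?T ^^ j) f"] by (simp add: sum_abs)
    also have "\<dots> \<le> (\<Sum>y\<in>S. (A' x y + (if x = y then c else 0)) * (?T' ^^ j) g y)"
    proof (rule sum_mono)
      fix y assume y: "y \<in> S"
      have "\<bar>A x y + (if x = y then c else 0)\<bar> \<le> A' x y + (if x = y then c else 0)"
        using off[OF Suc.prems y] diag[OF y] c[OF y] by auto
      thus "\<bar>(A x y + (if x = y then c else 0)) * (?T ^^ j) f y\<bar> \<le> (A' x y + (if x = y then c else 0)) * (?T' ^^ j) g y"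
        unfolding abs_mult using Suc.IH[OF y] by (intro mult_mono) auto
    qed
    also have "\<dots> = (?T' ^^ Suc j) g x"
      using U'.kernel[OF Suc.prems, of "(?T' ^^ j) g"] by simp
    finally show ?case .
  qed (use fg in auto)
  have "\<bar>expo ?T t f x\<bar> \<le> expo ?T' t g x"
  proof -
    have b: "norm (t ^ j / fact j * (?T ^^ j) f x) \<le> t ^ j / fact j * (?T' ^^ j) g x" for j
      using pow[OF \<open>x \<in> S\<close>, of j] \<open>0 \<le> t\<close> by (simp add: abs_mult mult_left_mono divide_right_mono)
    have "norm (\<Sum>j. t ^ j / fact j * (?T ^^ j) f x) \<le> (\<Sum>j. t ^ j / fact j * (?T' ^^ j) g x)"
      by (rule norm_suminf_le[OF b U'.summable_expo'[OF \<open>x \<in> S\<close>]])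
    thus ?thesis by (simp add: expo_def)
  qed
  hence "\<bar>exp (c * t) * expo T t f x\<bar> \<le> exp (c * t) * expo T' t g x"
    unfolding expo_shift[OF assms(1) \<open>x \<in> S\<close>] expo_shift[OF assms(2) \<open>x \<in> S\<close>] .
  thus ?thesis by (simp add: abs_mult)
qed

section \<open>Reversible flows along commuting shifts and the local Bobkov inequality\<close>

text \<open>
  The abstract setting: finitely many commuting shifts, closed under inversion, and a positive
  weight. This is the structure of \<open>\<int>\<^sub>m\<^sup>n\<close> on which the local Bobkov inequality rests.
\<close>

locale flow =
  fixes S :: "'a set" and A :: "'b set" and \<tau> :: "'b \<Rightarrow> 'a \<Rightarrow> 'a" and \<iota> :: "'b \<Rightarrow> 'b"
    and \<mu> :: "'a \<Rightarrow> real" and b :: real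
  assumes finite_S: "finite S" and finite_A: "finite A"
    and \<tau>_S: "a \<in> A \<Longrightarrow> x \<in> S \<Longrightarrow> \<tau> a x \<in> S"
    and \<iota>_A: "a \<in> A \<Longrightarrow> \<iota> a \<in> A"
    and \<iota>_\<iota>: "a \<in> A \<Longrightarrow> \<iota> (\<iota> a) = a"
    and \<tau>_\<iota>: "a \<in> A \<Longrightarrow> x \<in> S \<Longrightarrow> \<tau> (\<iota> a) (\<tau> a x) = x"
    and \<tau>_comm: "a \<in> A \<Longrightarrow> c \<in> A \<Longrightarrow> x \<in> S \<Longrightarrow> \<tau> a (\<tau> c x) = \<tau> c (\<tau> a x)"
    and \<mu>_pos: "x \<in> S \<Longrightarrow> 0 < \<mu> x" and \<mu>_sum: "sum \<mu> S = 1"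
    and b: "0 < b" "b \<le> 1"
    and ratio: "a \<in> A \<Longrightarrow> x \<in> S \<Longrightarrow> b \<le> sqrt (\<mu> (\<tau> a x) / \<mu> x)"
      "a \<in> A \<Longrightarrow> x \<in> S \<Longrightarrow> sqrt (\<mu> (\<tau> a x) / \<mu> x) \<le> 1 / b"
begin

definition q :: "'b \<Rightarrow> 'a \<Rightarrow> real" where "q a x = 1 / 2 * sqrt (\<mu> (\<tau> a x) / \<mu> x)"
definition D :: "'b \<Rightarrow> ('a \<Rightarrow> real) \<Rightarrow> 'a \<Rightarrow> real" where "D a f x = q a x * (f (\<tau> a x) - f x)"
definition L :: "('a \<Rightarrow> real) \<Rightarrow> 'a \<Rightarrow> real" where "L f x = (\<Sum>a\<in>A. D a f x)"
definition E :: "('a \<Rightarrow> real) \<Rightarrow> real" where "E f = (\<Sum>x\<in>S. \<mu> x * f x)"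
definition dir :: "('a \<Rightarrow> real) \<Rightarrow> ('a \<Rightarrow> real) \<Rightarrow> real" where
  "dir f g = 1 / 2 * E (\<lambda>x. \<Sum>a\<in>A. q a x * ((f (\<tau> a x) - f x) * (g (\<tau> a x) - g x)))"
abbreviation P :: "real \<Rightarrow> ('a \<Rightarrow> real) \<Rightarrow> 'a \<Rightarrow> real" where "P \<equiv> expo L"
definition Lker :: "'a \<Rightarrow> 'a \<Rightarrow> real" where
  "Lker x y = (\<Sum>a\<in>A. q a x * ((if \<tau> a x = y then 1 else 0) - (if x = y then 1 else 0)))"

sublocale heat: kernel_op S L Lker
proof
  fix f :: "'a \<Rightarrow> real" and x assume x: "x \<in> S"
  have "(\<Sum>y\<in>S. Lker x y * f y) = (\<Sum>a\<in>A. \<Sum>y\<in>S. q a x * ((if \<tau> a x = y then 1 else 0) * f y - (if x = y then 1 else 0) * f y))"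
    unfolding Lker_def sum_distrib_right by (subst sum.swap) (simp add: algebra_simps)
  also have "\<dots> = (\<Sum>a\<in>A. D a f x)"
    using x by (intro sum.cong refl)
      (simp add: sum_distrib_left[symmetric] sum_subtractf sum_indicator_mult(1)[OF finite_S] \<tau>_S D_def)
  finally show "L f x = (\<Sum>y\<in>S. Lker x y * f y)" by (simp add: L_def)
qed (rule finite_S)

lemma q_bounds:
  assumes "a \<in> A" "x \<in> S"
  shows "b / 2 \<le> q a x" "q a x \<le> 1 / (2 * b)" "0 < q a x"
  using ratio[OF assms] b \<mu>_pos[OF assms(2)] \<mu>_pos[OF \<tau>_S[OF assms]] by (auto simp: q_def)

lemma Lker_offdiag: "x \<in> S \<Longrightarrow> x \<noteq> y \<Longrightarrow> 0 \<le> Lker x y"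
  unfolding Lker_def by (intro sum_nonneg) (auto intro: less_imp_le[OF q_bounds(3)])

lemma \<mu>_q: 
  assumes "a \<in> A" "x \<in> S"
  shows "\<mu> x * q a x = \<mu> (\<tau> a x) * q (\<iota> a) (\<tau> a x)"
proof -
  have *: "u * sqrt (v / u) = v * sqrt (u / v)" if "0 < u" "0 < v" for u v :: real
  proof -
    define r w where "r = sqrt u" and "w = sqrt v"
    have "r > 0" "w > 0" "u = r * r" "v = w * w" using that by (simp_all add: r_def w_def)
    thus ?thesis by (simp add: real_sqrt_divide real_sqrt_mult)
  qed
  show ?thesis
    using *[OF \<mu>_pos[OF assms(2)] \<mu>_pos[OF \<tau>_S[OF assms]]] by (simp add: q_def \<tau>_\<iota> assms)
qed

text \<open>
  Both sides are \<open>sqrt (\<mu>(\<tau>\<^sub>a \<tau>\<^sub>c x) / \<mu>(x)) / 4\<close>: the rate of a two-step path depends only on its end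
  points. This is the property of the canonical rates on which the commutator formula rests.
\<close>

lemma q_curl:
  assumes "a \<in> A" "c \<in> A" "x \<in> S"
  shows "q a (\<tau> c x) * q c x = q c (\<tau> a x) * q a x"
proof -
  have *: "sqrt (w / v) * sqrt (v / u) = sqrt (w / u)" if "0 < v" for u v w :: real
    using that by (simp flip: real_sqrt_mult)
  show ?thesis
    using *[OF \<mu>_pos[OF \<tau>_S[OF assms(1,3)]]] *[OF \<mu>_pos[OF \<tau>_S[OF assms(2,3)]]]
    by (simp add: q_def \<tau>_comm[OF assms] )
qed

lemma \<tau>_bij: "a \<in> A \<Longrightarrow> bij_betw (\<tau> a) S S"
proof (rule bij_betw_byWitness[where f'="\<tau> (\<iota> a)"])
  assume a: "a \<in> A"
  show "\<forall>x\<in>S. \<tau> (\<iota> a) (\<tau> a x) = x" using a by (simp add: \<tau>_\<iota>)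
  show "\<forall>x\<in>S. \<tau> a (\<tau> (\<iota> a) x) = x" using a \<tau>_\<iota>[OF \<iota>_A[OF a]] by (simp add: \<iota>_\<iota>)
qed (auto intro: \<tau>_S \<iota>_A)

text \<open>
  Detailed balance, in the form of an exchange of the two ends of every jump.
\<close>

lemma reversal:
  "(\<Sum>x\<in>S. \<mu> x * (\<Sum>a\<in>A. q a x * F x (\<tau> a x))) = (\<Sum>x\<in>S. \<mu> x * (\<Sum>a\<in>A. q a x * F (\<tau> a x) x))"
proof -
  have one: "(\<Sum>x\<in>S. \<mu> x * (q a x * F x (\<tau> a x))) = (\<Sum>x\<in>S. \<mu> x * (q (\<iota> a) x * F (\<tau> (\<iota> a) x) x))"
    if a: "a \<in> A" for a
  proof -
    have "(\<Sum>x\<in>S. \<mu> x * (q (\<iota> a) x * F (\<tau> (\<iota> a) x) x))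
        = (\<Sum>x\<in>S. \<mu> (\<tau> a x) * (q (\<iota> a) (\<tau> a x) * F (\<tau> (\<iota> a) (\<tau> a x)) (\<tau> a x)))"
      by (rule sum.reindex_bij_betw[OF \<tau>_bij[OF a], symmetric])
    also have "\<dots> = (\<Sum>x\<in>S. \<mu> x * (q a x * F x (\<tau> a x)))"
      by (intro sum.cong refl) (simp add: \<tau>_\<iota> a \<mu>_q mult.assoc[symmetric])
    finally show ?thesis by simp
  qed
  have bij: "bij_betw \<iota> A A"
    by (rule bij_betw_byWitness[where f'="\<iota>"]) (auto simp: \<iota>_\<iota> \<iota>_A)
  have "(\<Sum>x\<in>S. \<mu> x * (\<Sum>a\<in>A. q a x * F x (\<tau> a x))) = (\<Sum>a\<in>A. \<Sum>x\<in>S. \<mu> x * (q a x * F x (\<tau> a x)))"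
    unfolding sum_distrib_left by (rule sum.swap)
  also have "\<dots> = (\<Sum>a\<in>A. \<Sum>x\<in>S. \<mu> x * (q (\<iota> a) x * F (\<tau> (\<iota> a) x) x))"
    by (intro sum.cong refl one)
  also have "\<dots> = (\<Sum>a\<in>A. \<Sum>x\<in>S. \<mu> x * (q a x * F (\<tau> a x) x))"
    by (rule sum.reindex_bij_betw[OF bij])
  also have "\<dots> = (\<Sum>x\<in>S. \<mu> x * (\<Sum>a\<in>A. q a x * F (\<tau> a x) x))"
    unfolding sum_distrib_left by (rule sum.swap)
  finally show ?thesis .
qed

lemma E_cong: "(\<And>x. x \<in> S \<Longrightarrow> f x = g x) \<Longrightarrow> E f = E g"
  by (simp add: E_def)
lemma E_mono: "(\<And>x. x \<in> S \<Longrightarrow> f x \<le> g x) \<Longrightarrow> E f \<le> E g"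
  unfolding E_def by (intro sum_mono mult_left_mono less_imp_le[OF \<mu>_pos])
lemma E_nonneg: "(\<And>x. x \<in> S \<Longrightarrow> 0 \<le> f x) \<Longrightarrow> 0 \<le> E f"
  unfolding E_def by (intro sum_nonneg mult_nonneg_nonneg less_imp_le[OF \<mu>_pos])
lemma E_const [simp]: "E (\<lambda>x. c) = c"
  by (simp add: E_def \<mu>_sum flip: sum_distrib_right)
lemma E_add: "E (\<lambda>x. f x + g x) = E f + E g"
  by (simp add: E_def sum.distrib algebra_simps)
lemma E_diff: "E (\<lambda>x. f x - g x) = E f - E g"
  by (simp add: E_def sum_subtractf algebra_simps)
lemma E_cmult: "E (\<lambda>x. c * f x) = c * E f"
  by (simp add: E_def sum_distrib_left mult_ac)
lemma E_sum: "E (\<lambda>x. \<Sum>i\<in>I. f i x) = (\<Sum>i\<in>I. E (f i))"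
  by (simp add: E_def sum_distrib_left) (rule sum.swap)

lemma E_L: "E (\<lambda>x. g x * L f x) = - dir f g"
proof -
  let ?d = "\<lambda>x y. (f y - f x)"
  have "E (\<lambda>x. g x * L f x) = (\<Sum>x\<in>S. \<mu> x * (\<Sum>a\<in>A. q a x * ((f (\<tau> a x) - f x) * g x)))"
    by (simp add: E_def L_def D_def sum_distrib_left mult_ac)
  moreover have "\<dots> = (\<Sum>x\<in>S. \<mu> x * (\<Sum>a\<in>A. q a x * ((f x - f (\<tau> a x)) * g (\<tau> a x))))"
    by (rule reversal[of "\<lambda>x y. (f y - f x) * g x"])
  ultimately have "2 * E (\<lambda>x. g x * L f x) = (\<Sum>x\<in>S. \<mu> x * (\<Sum>a\<in>A. q a x * ((f (\<tau> a x) - f x) * g x)))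
      + (\<Sum>x\<in>S. \<mu> x * (\<Sum>a\<in>A. q a x * ((f x - f (\<tau> a x)) * g (\<tau> a x))))" by simp
  also have "\<dots> = - (\<Sum>x\<in>S. \<mu> x * (\<Sum>a\<in>A. q a x * ((f (\<tau> a x) - f x) * (g (\<tau> a x) - g x))))"
    unfolding sum.distrib[symmetric] sum_negf[symmetric] distrib_left[symmetric] mult_minus_right[symmetric]
    by (intro sum.cong refl arg_cong2[where f="(*)"]) (simp add: algebra_simps)
  finally show ?thesis by (simp add: dir_def E_def)
qed

lemma dir_commute: "dir f g = dir g f"
  by (simp add: dir_def mult_ac)

lemma dir_gradient_bounds:
  "dir f f \<le> 1 / b * (\<Sum>a\<in>A. E (\<lambda>x. (D a f x)\<^sup>2))" "(\<Sum>a\<in>A. E (\<lambda>x. (D a f x)\<^sup>2)) \<le> 1 / b * dir f f"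
proof -
  have *: "b * (q * d\<^sup>2) \<le> 2 * (q * d)\<^sup>2" "(q * d)\<^sup>2 \<le> 1 / (2 * b) * (q * d\<^sup>2)"
    if "b / 2 \<le> q" "q \<le> 1 / (2 * b)" "0 < q" for q d :: real
  proof -
    have "b * (q * d\<^sup>2) \<le> (2 * q) * (q * d\<^sup>2)" using that by (intro mult_right_mono) auto
    thus "b * (q * d\<^sup>2) \<le> 2 * (q * d)\<^sup>2" by (simp add: power2_eq_square algebra_simps)
    have "q * (q * d\<^sup>2) \<le> 1 / (2 * b) * (q * d\<^sup>2)" using that by (intro mult_right_mono) auto
    thus "(q * d)\<^sup>2 \<le> 1 / (2 * b) * (q * d\<^sup>2)" by (simp add: power2_eq_square algebra_simps)
  qed
  have "b * dir f f = 1 / 2 * E (\<lambda>x. \<Sum>a\<in>A. b * (q a x * (f (\<tau> a x) - f x)\<^sup>2))"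
    by (simp add: dir_def E_cmult power2_eq_square flip: sum_distrib_left)
  also have "\<dots> \<le> 1 / 2 * E (\<lambda>x. \<Sum>a\<in>A. 2 * (D a f x)\<^sup>2)"
    unfolding D_def by (intro mult_left_mono E_mono sum_mono *(1) q_bounds) auto
  also have "\<dots> = (\<Sum>a\<in>A. E (\<lambda>x. (D a f x)\<^sup>2))"
    by (simp add: E_sum E_cmult flip: sum_distrib_left)
  finally show "dir f f \<le> 1 / b * (\<Sum>a\<in>A. E (\<lambda>x. (D a f x)\<^sup>2))" using b by (simp add: field_simps)
  have "E (\<lambda>x. \<Sum>a\<in>A. (D a f x)\<^sup>2) \<le> E (\<lambda>x. \<Sum>a\<in>A. 1 / (2 * b) * (q a x * (f (\<tau> a x) - f x)\<^sup>2))"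
    unfolding D_def by (intro E_mono sum_mono *(2) q_bounds) auto
  also have "\<dots> = 1 / b * dir f f"
    unfolding sum_distrib_left[symmetric] E_cmult by (simp add: dir_def power2_eq_square)
  finally show "(\<Sum>a\<in>A. E (\<lambda>x. (D a f x)\<^sup>2)) \<le> 1 / b * dir f f" by (simp add: E_sum)
qed

lemma P_mono:
  assumes "0 \<le> t" "x \<in> S" "\<And>y. y \<in> S \<Longrightarrow> f y \<le> g y"
  shows "P t f x \<le> P t g x"
proof -
  have "\<bar>P t (\<lambda>y. g y - f y) x\<bar> \<le> P t (\<lambda>y. g y - f y) x"
    by (rule expo_comparison[OF heat.kernel_op_axioms heat.kernel_op_axioms])
      (use assms Lker_offdiag in auto)
  hence "0 \<le> P t (\<lambda>y. 1 * g y + (- 1) * f y) x" by simp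
  thus ?thesis by (subst (asm) heat.expo_linear[OF assms(2)]) simp
qed

lemma P_const: "x \<in> S \<Longrightarrow> P t (\<lambda>_. c) x = c"
proof -
  assume x: "x \<in> S"
  have "(\<lambda>_ _. c) t x = P t (\<lambda>_. c) x"
    by (rule heat.expo_unique) (use x in \<open>auto simp: L_def D_def\<close>)
  thus ?thesis by simp
qed

lemma P_nonneg: "0 \<le> t \<Longrightarrow> x \<in> S \<Longrightarrow> (\<And>y. y \<in> S \<Longrightarrow> 0 \<le> f y) \<Longrightarrow> 0 \<le> P t f x"
  using P_mono[of t x "\<lambda>_. 0" f] by (simp add: P_const)

lemma DERIV_P: "x \<in> S \<Longrightarrow> ((\<lambda>t. P t f x) has_real_derivative L (P t f) x) (at t)"
  using heat.DERIV_expo[of x f t] by (simp add: heat.expo_op)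

lemma DERIV_E:
  assumes "\<And>x. x \<in> S \<Longrightarrow> ((\<lambda>t. v t x) has_real_derivative v' x) (at t)"
  shows "((\<lambda>t. E (v t)) has_real_derivative E v') (at t)"
  unfolding E_def by (intro DERIV_sum DERIV_cmult assms)

lemma E_P: "E (P t f) = E f"
proof -
  have "((\<lambda>t. E (P t f)) has_real_derivative 0) (at t)" for t
  proof -
    have "((\<lambda>t. E (P t f)) has_real_derivative E (L (P t f))) (at t)" by (intro DERIV_E DERIV_P)
    thus ?thesis using E_L[of "\<lambda>_. 1" "P t f"] by (simp add: dir_def)
  qed
  hence "E (P t f) = E (P 0 f)" using DERIV_isconst_all[of "\<lambda>t. E (P t f)" t 0] by blast
  thus ?thesis using E_cong[of "P 0 f" f] by simp
qed

lemma DERIV_E_P_square: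
  "((\<lambda>t. E (\<lambda>x. (P t f x)\<^sup>2)) has_real_derivative - 2 * dir (P t f) (P t f)) (at t)"
proof -
  have "((\<lambda>t. E (\<lambda>x. (P t f x)\<^sup>2)) has_real_derivative E (\<lambda>x. 2 * (P t f x * L (P t f) x))) (at t)"
    by (intro DERIV_E) (auto intro!: derivative_eq_intros DERIV_P)
  also have "E (\<lambda>x. 2 * (P t f x * L (P t f) x)) = - 2 * dir (P t f) (P t f)"
    by (simp only: E_cmult E_L)
  finally show ?thesis .
qed

text \<open>
  Since \<open>L\<close> is self-adjoint both occurrences of \<open>P\<^sub>t f\<close> contribute equally. It follows that the energy
  decreases and that the variance is log-convex in time.
\<close>

lemma DERIV_dir_P:
  "((\<lambda>t. dir (P t f) (P t f)) has_real_derivative - 2 * E (\<lambda>x. (L (P t f) x)\<^sup>2)) (at t)"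
proof -
  have dL: "((\<lambda>t. L (P t f) x) has_real_derivative L (L (P t f)) x) (at t)" if "x \<in> S" for x
  proof -
    have "((\<lambda>t. \<Sum>y\<in>S. Lker x y * P t f y) has_real_derivative (\<Sum>y\<in>S. Lker x y * L (P t f) y)) (at t)"
      by (intro DERIV_sum DERIV_cmult DERIV_P)
    thus ?thesis by (simp add: heat.kernel[OF that])
  qed
  have "((\<lambda>t. E (\<lambda>x. P t f x * L (P t f) x)) has_real_derivative
     E (\<lambda>x. L (P t f) x * L (P t f) x + L (L (P t f)) x * P t f x)) (at t)"
    by (intro DERIV_E DERIV_mult DERIV_P dL)
  also have "E (\<lambda>x. L (P t f) x * L (P t f) x + L (L (P t f)) x * P t f x)
     = 2 * E (\<lambda>x. (L (P t f) x)\<^sup>2)"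
  proof -
    have "E (\<lambda>x. P t f x * L (L (P t f)) x) = E (\<lambda>x. L (P t f) x * L (P t f) x)"
      using E_L[of "P t f" "L (P t f)"] E_L[of "L (P t f)" "P t f"] by (simp add: dir_commute)
    thus ?thesis by (simp add: E_add power2_eq_square mult.commute)
  qed
  finally have "((\<lambda>t. - E (\<lambda>x. P t f x * L (P t f) x)) has_real_derivative - (2 * E (\<lambda>x. (L (P t f) x)\<^sup>2))) (at t)"
    by (rule DERIV_minus)
  thus ?thesis by (simp add: E_L)
qed

text \<open>
  The commutator of \<open>D\<^sub>a\<close> with \<open>L\<close> as a matrix acting on the vector of gradients.
\<close>

definition Bc :: "'b \<Rightarrow> 'b \<Rightarrow> 'a \<Rightarrow> real" where
  "Bc a c x = (q a (\<tau> c x) - q a x) - (if a = c then \<Sum>d\<in>A. q d (\<tau> a x) - q d x else 0)"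

text \<open>
  All second differences cancel: with \<open>M\<close> the common value of the two products of rates in \<open>q_curl\<close>, the
  terms with \<open>f(\<tau>\<^sub>a \<tau>\<^sub>c x)\<close> have coefficients \<open>M\<close> and \<open>-M\<close>, and what remains is \<open>M - q\<^sub>a q\<^sub>c\<close> times
  \<open>f(\<tau>\<^sub>c x) - f(\<tau>\<^sub>a x)\<close>.
\<close>

lemma D_L_commutator:
  assumes "a \<in> A" "x \<in> S"
  shows "D a (L f) x = L (D a f) x + (\<Sum>c\<in>A. Bc a c x * D c f x)"
proof -
  have "D a (L f) x - L (D a f) x = (\<Sum>c\<in>A. q a x * (D c f (\<tau> a x) - D c f x) - q c x * (D a f (\<tau> c x) - D a f x))"
    by (simp add: D_def[of a "L f"] L_def D_def[of _ "D a f"] sum_subtractf sum_distrib_left right_diff_distrib)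
  also have "\<dots> = (\<Sum>c\<in>A. (q a (\<tau> c x) - q a x) * D c f x - (q c (\<tau> a x) - q c x) * D a f x)"
  proof (intro sum.cong refl)
    fix c assume c: "c \<in> A"
    define M where "M = q a (\<tau> c x) * q c x"
    have M: "q c (\<tau> a x) * q a x = M" by (simp add: M_def q_curl[OF assms(1) c assms(2)])
    have "q a x * (D c f (\<tau> a x) - D c f x) - q c x * (D a f (\<tau> c x) - D a f x)
      = (q c (\<tau> a x) * q a x) * (f (\<tau> c (\<tau> a x)) - f (\<tau> a x)) - q a x * q c x * (f (\<tau> c x) - f x)
        - (q a (\<tau> c x) * q c x) * (f (\<tau> a (\<tau> c x)) - f (\<tau> c x)) + q a x * q c x * (f (\<tau> a x) - f x)"
      by (simp add: D_def algebra_simps)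
    also have "\<dots> = (M - q a x * q c x) * (f (\<tau> c x) - f (\<tau> a x))"
      unfolding M M_def[symmetric] by (simp add: \<tau>_comm[OF assms(1) c assms(2)] algebra_simps)
    also have "\<dots> = ((q a (\<tau> c x) * q c x) - q a x * q c x) * (f (\<tau> c x) - f x) - ((q c (\<tau> a x) * q a x) - q a x * q c x) * (f (\<tau> a x) - f x)"
      unfolding M M_def[symmetric] by (simp add: algebra_simps)
    finally show "q a x * (D c f (\<tau> a x) - D c f x) - q c x * (D a f (\<tau> c x) - D a f x)
       = (q a (\<tau> c x) - q a x) * D c f x - (q c (\<tau> a x) - q c x) * D a f x"
      by (simp add: D_def algebra_simps)
  qed
  also have "\<dots> = (\<Sum>c\<in>A. (q a (\<tau> c x) - q a x) * D c f x) - (\<Sum>c\<in>A. if a = c then (\<Sum>d\<in>A. q d (\<tau> a x) - q d x) * D c f x else 0)"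
    using assms(1) finite_A by (simp add: sum_subtractf sum_distrib_right left_diff_distrib)
  also have "\<dots> = (\<Sum>c\<in>A. Bc a c x * D c f x)"
    unfolding sum_subtractf[symmetric] by (intro sum.cong refl) (auto simp: Bc_def algebra_simps)
  finally show ?thesis by simp
qed


text \<open>
  The Cauchy-Schwarz inequality in \<open>\<real> \<times> \<real>\<^sup>J\<close>, with the second factor scaled by \<open>sqrt g\<close>.
\<close>

lemma sqrt_sum_cauchy:
  fixes u v :: "'c \<Rightarrow> real"
  assumes "finite J" "0 \<le> g"
  shows "s * t + g * (\<Sum>j\<in>J. u j * v j) \<le> sqrt (s\<^sup>2 + g * (\<Sum>j\<in>J. (u j)\<^sup>2)) * sqrt (t\<^sup>2 + g * (\<Sum>j\<in>J. (v j)\<^sup>2))"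
proof -
  define U V where "U = (\<Sum>j\<in>J. (u j)\<^sup>2)" and "V = (\<Sum>j\<in>J. (v j)\<^sup>2)"
  have U0: "0 \<le> U" "0 \<le> V" by (auto simp: U_def V_def intro: sum_nonneg)
  have "(\<Sum>j\<in>J. u j * v j) \<le> sqrt U * sqrt V"
    using L2_set_mult_ineq[of u v J] sum_mono[of J "\<lambda>j. u j * v j" "\<lambda>j. \<bar>u j\<bar> * \<bar>v j\<bar>"]
    by (fastforce simp: L2_set_def U_def V_def simp flip: abs_mult)
  hence "g * (\<Sum>j\<in>J. u j * v j) \<le> g * (sqrt U * sqrt V)" using assms by (intro mult_left_mono)
  moreover have "s * t + g * (sqrt U * sqrt V) \<le> sqrt (s\<^sup>2 + g * U) * sqrt (t\<^sup>2 + g * V)"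
  proof -
    have "(s * t + g * (sqrt U * sqrt V))\<^sup>2 \<le> (s\<^sup>2 + g * U) * (t\<^sup>2 + g * V)"
    proof -
      define p r where "p = sqrt U" and "r = sqrt V"
      have pr: "U = p\<^sup>2" "V = r\<^sup>2" using U0 by (simp_all add: p_def r_def)
      have "0 \<le> g * (s * r - t * p)\<^sup>2" using assms by simp
      thus ?thesis unfolding pr using U0 by (simp add: algebra_simps power2_eq_square p_def r_def)
    qed
    hence "\<bar>s * t + g * (sqrt U * sqrt V)\<bar> \<le> sqrt ((s\<^sup>2 + g * U) * (t\<^sup>2 + g * V))"
      by (rule real_le_rsqrt[of "\<bar>_\<bar>", simplified power2_abs])
    thus ?thesis by (simp add: real_sqrt_mult)
  qed
  ultimately show ?thesis unfolding U_def V_def by linarith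
qed

text \<open>
  A lower bound \<open>-K\<close> for the curvature, in the sense of Bakry and Emery: the quadratic form of the
  commutator at every point is at most \<open>K\<close> times the square of the gradient.
\<close>

definition curved :: "real \<Rightarrow> bool" where
  "curved K \<longleftrightarrow> (\<forall>x\<in>S. \<forall>w. (\<Sum>a\<in>A. \<Sum>c\<in>A. w a * Bc a c x * w c) \<le> K * (\<Sum>a\<in>A. (w a)\<^sup>2))"

definition Gstar :: "('a \<Rightarrow> real) \<Rightarrow> 'a \<Rightarrow> real" where "Gstar f x = (\<Sum>a\<in>A. (D a f x)\<^sup>2)"

lemma P_range:
  assumes "0 \<le> t" "x \<in> S" "\<And>y. y \<in> S \<Longrightarrow> l \<le> f y" "\<And>y. y \<in> S \<Longrightarrow> f y \<le> h"
  shows "l \<le> P t f x" "P t f x \<le> h"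
  using P_mono[of t x "\<lambda>_. l" f] P_mono[of t x f "\<lambda>_. h"] assms by (auto simp: P_const)

text \<open>
  The differential inequality that makes the interpolation increase. The Cauchy-Schwarz inequality
  bounds \<open>F(x) F(\<tau>\<^sub>c x)\<close> from below by the inner product of the vectors whose lengths these are. The
  gradient components then produce the commutator, controlled by \<open>K\<close>, and the profile components
  lose at most the sum of \<open>q\<^sub>c (u(\<tau>\<^sub>c x) - u(x))\<^sup>2\<close> by the two-point inequality; since \<open>q\<^sub>c \<ge> b / 2\<close>, this is
  at most \<open>2 / b\<close> times the squared gradient.
\<close>

lemma bobkov_generator:
  assumes curv: "curved K" and x: "x \<in> S" and g0: "0 \<le> g"
    and u01: "\<And>y. y \<in> S \<Longrightarrow> 0 < u y \<and> u y < 1" and v: "u x = \<Phi> v"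
    and F: "\<And>y. F y = sqrt ((gauss_profile (u y))\<^sup>2 + g * Gstar u y)"
  shows "0 \<le> F x * L F x + (gauss_profile (u x) * (v * L u x) + (2 / b + K * g) * Gstar u x
       - g * (\<Sum>a\<in>A. D a u x * D a (L u) x))"
proof -
  let ?I = "\<lambda>y. gauss_profile (u y)"
  have G0: "0 \<le> Gstar u y" for y by (simp add: Gstar_def sum_nonneg)
  have Fsq: "F x * F x = (?I x)\<^sup>2 + g * Gstar u x"
    unfolding F using G0 g0 by simp
  have qle: "q c x * (?I x * (?I (\<tau> c x) - ?I x) + g * (\<Sum>a\<in>A. D a u x * (D a u (\<tau> c x) - D a u x)))
      \<le> q c x * (F x * F (\<tau> c x) - F x * F x)" if c: "c \<in> A" for c
  proof (rule mult_left_mono)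
    have "?I x * ?I (\<tau> c x) + g * (\<Sum>a\<in>A. D a u x * D a u (\<tau> c x)) \<le> F x * F (\<tau> c x)"
      unfolding F Gstar_def by (rule sqrt_sum_cauchy[OF finite_A g0])
    thus "?I x * (?I (\<tau> c x) - ?I x) + g * (\<Sum>a\<in>A. D a u x * (D a u (\<tau> c x) - D a u x)) \<le> F x * F (\<tau> c x) - F x * F x"
      unfolding Fsq Gstar_def by (simp add: right_diff_distrib sum_subtractf power2_eq_square algebra_simps)
  qed (use q_bounds(3)[OF c x] in simp)
  have "(\<Sum>c\<in>A. q c x * (?I x * (?I (\<tau> c x) - ?I x) + g * (\<Sum>a\<in>A. D a u x * (D a u (\<tau> c x) - D a u x))))
      \<le> (\<Sum>c\<in>A. q c x * (F x * F (\<tau> c x) - F x * F x))"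
    by (intro sum_mono qle)
  also have "\<dots> = F x * L F x"
    by (simp add: L_def D_def sum_distrib_left algebra_simps)
  finally have 1: "(\<Sum>c\<in>A. q c x * (?I x * (?I (\<tau> c x) - ?I x))) + g * (\<Sum>c\<in>A. \<Sum>a\<in>A. q c x * (D a u x * (D a u (\<tau> c x) - D a u x))) \<le> F x * L F x"
    by (simp add: distrib_left sum.distrib sum_distrib_left mult_ac)
  have 2: "(\<Sum>c\<in>A. \<Sum>a\<in>A. q c x * (D a u x * (D a u (\<tau> c x) - D a u x))) = (\<Sum>a\<in>A. D a u x * L (D a u) x)"
    by (subst sum.swap) (simp add: L_def D_def[of _ "D _ u"] sum_distrib_left mult_ac)
  have 3: "(\<Sum>a\<in>A. D a u x * D a (L u) x) = (\<Sum>a\<in>A. D a u x * L (D a u) x) + (\<Sum>a\<in>A. \<Sum>c\<in>A. D a u x * Bc a c x * D c u x)"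
    unfolding sum.distrib[symmetric]
    by (intro sum.cong refl) (simp add: D_L_commutator[OF _ x] distrib_left sum_distrib_left mult_ac)
  have 4: "(\<Sum>a\<in>A. \<Sum>c\<in>A. D a u x * Bc a c x * D c u x) \<le> K * Gstar u x"
    using curv[unfolded curved_def, THEN bspec, OF x, THEN spec, of "\<lambda>a. D a u x"] unfolding Gstar_def .
  have 5: "- (q c x * (u (\<tau> c x) - u x)\<^sup>2) \<le> q c x * (?I x * (?I (\<tau> c x) - ?I x)) + ?I x * (v * D c u x)" if c: "c \<in> A" for c
  proof -
    have "- (u (\<tau> c x) - u x)\<^sup>2 \<le> ?I x * (?I (\<tau> c x) - ?I x + v * (u (\<tau> c x) - u x))"
      using gauss_profile_two_point[of "u (\<tau> c x)" v] u01[OF \<tau>_S[OF c x]] by (simp add: v)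
    from mult_left_mono[OF this less_imp_le[OF q_bounds(3)[OF c x]]]
    show ?thesis by (simp add: D_def algebra_simps)
  qed
  have "- (\<Sum>c\<in>A. q c x * (u (\<tau> c x) - u x)\<^sup>2) \<le> (\<Sum>c\<in>A. q c x * (?I x * (?I (\<tau> c x) - ?I x)) + ?I x * (v * D c u x))"
    unfolding sum_negf[symmetric] by (intro sum_mono 5)
  also have "\<dots> = (\<Sum>c\<in>A. q c x * (?I x * (?I (\<tau> c x) - ?I x))) + ?I x * (v * L u x)"
    by (simp add: sum.distrib L_def sum_distrib_left)
  finally have 6: "- (\<Sum>c\<in>A. q c x * (u (\<tau> c x) - u x)\<^sup>2) \<le> (\<Sum>c\<in>A. q c x * (?I x * (?I (\<tau> c x) - ?I x))) + ?I x * (v * L u x)" .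
  have 7: "(\<Sum>c\<in>A. q c x * (u (\<tau> c x) - u x)\<^sup>2) \<le> 2 / b * Gstar u x"
    unfolding Gstar_def D_def sum_distrib_left
  proof (rule sum_mono)
    fix c assume c: "c \<in> A"
    have "1 * (q c x * (u (\<tau> c x) - u x)\<^sup>2) \<le> (2 / b * q c x) * (q c x * (u (\<tau> c x) - u x)\<^sup>2)"
      using q_bounds[OF c x] b by (intro mult_right_mono) (auto simp: field_simps)
    thus "q c x * (u (\<tau> c x) - u x)\<^sup>2 \<le> 2 / b * (q c x * (u (\<tau> c x) - u x))\<^sup>2"
      by (simp add: power2_eq_square algebra_simps)
  qed
  have 8: "g * (\<Sum>a\<in>A. \<Sum>c\<in>A. D a u x * Bc a c x * D c u x) \<le> g * (K * Gstar u x)"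
    using 4 g0 by (rule mult_left_mono)
  show ?thesis using 1 6 7 8 unfolding 2 3 by (simp add: algebra_simps)
qed

text \<open>
  For values in \<open>[e, 1 - e]\<close> the quantity under the square root stays positive, so everything is
  differentiable. The differential equation for \<open>\<gamma>\<close> matches the terms in \<open>bobkov_generator\<close>.
\<close>

lemma local_bobkov_interior:
  assumes curv: "curved K" and t: "0 \<le> t" and x: "x \<in> S"
    and \<gamma>: "\<gamma> 0 = 0" "\<And>s. 0 \<le> s \<Longrightarrow> 0 \<le> \<gamma> s"
      "\<And>s. (\<gamma> has_real_derivative 4 / b + 2 * K * \<gamma> s) (at s)"
    and e: "0 < e" "e < 1" and f: "\<And>y. y \<in> S \<Longrightarrow> e \<le> f y \<and> f y \<le> 1 - e"
  shows "gauss_profile (P t f x) \<le> P t (\<lambda>y. sqrt ((gauss_profile (f y))\<^sup>2 + \<gamma> t * Gstar f y)) x"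
proof -
  define u where "u s = P (t - s) f" for s
  define F where "F s y = sqrt ((gauss_profile (u s y))\<^sup>2 + \<gamma> s * Gstar (u s) y)" for s y
  have du: "((\<lambda>s. u s y) has_real_derivative - L (u s) y) (at s)" if "y \<in> S" for s y
  proof -
    have "((\<lambda>s. P (t - s) f y) has_real_derivative L (P (t - s) f) y * (- 1)) (at s)"
      by (rule DERIV_chain2[OF DERIV_P[OF that]]) (auto intro!: derivative_eq_intros)
    thus ?thesis by (simp add: u_def)
  qed
  have dD: "((\<lambda>s. D a (u s) y) has_real_derivative - D a (L (u s)) y) (at s)" if "y \<in> S" "a \<in> A" for s y a
  proof -
    have "((\<lambda>s. D a (u s) y) has_real_derivative q a y * (- L (u s) (\<tau> a y) - - L (u s) y)) (at s)"
      unfolding D_def by (intro DERIV_cmult DERIV_diff du that \<tau>_S)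
    thus ?thesis by (simp add: D_def algebra_simps)
  qed
  have "P 0 (F 0) x \<le> P t (F t) x"
  proof (rule DERIV_nonneg_imp_nondecreasing[OF t])
    fix s assume s: "0 \<le> s" "s \<le> t"
    have u01: "0 < u s y \<and> u s y < 1" if "y \<in> S" for y
      using P_range[of "t - s" y e f "1 - e"] that s f e unfolding u_def by fastforce
    define F' where "F' y = (2 * (gauss_profile (u s y) * (inv \<Phi> (u s y) * L (u s) y))
       + ((4 / b + 2 * K * \<gamma> s) * Gstar (u s) y + (- 2 * (\<Sum>a\<in>A. D a (u s) y * D a (L (u s)) y)) * \<gamma> s)) * (inverse (F s y) / 2)" for y
    have Fpos: "0 < (gauss_profile (u s y))\<^sup>2 + \<gamma> s * Gstar (u s) y" if "y \<in> S" for y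
      using u01[OF that] \<gamma>(2)[OF s(1)] gauss_profile_pos[of "u s y"]
      by (intro add_pos_nonneg mult_nonneg_nonneg) (auto simp: Gstar_def intro: sum_nonneg)
    have v: "u s y = \<Phi> (inv \<Phi> (u s y))" if "y \<in> S" for y
      using u01[OF that] \<Phi>_surj[of "u s y"] by (metis inv_\<Phi>)
    have dF: "((\<lambda>s. F s y) has_real_derivative F' y) (at s)" if y: "y \<in> S" for y
    proof -
      have "(gauss_profile has_real_derivative - inv \<Phi> (u s y)) (at (u s y))"
        using gauss_profile_DERIV[of "inv \<Phi> (u s y)"] v[OF y] by simp
      hence 1: "((\<lambda>s. gauss_profile (u s y)) has_real_derivative (- inv \<Phi> (u s y)) * (- L (u s) y)) (at s)"
        by (rule DERIV_chain2) (rule du[OF y])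
      have 2: "((\<lambda>s. (gauss_profile (u s y))\<^sup>2) has_real_derivative 2 * (gauss_profile (u s y) * (inv \<Phi> (u s y) * L (u s) y))) (at s)"
        using DERIV_power[OF 1, of 2] by (simp add: mult_ac)
      have 3: "((\<lambda>s. Gstar (u s) y) has_real_derivative - 2 * (\<Sum>a\<in>A. D a (u s) y * D a (L (u s)) y)) (at s)"
      proof -
        have "((\<lambda>s. Gstar (u s) y) has_real_derivative (\<Sum>a\<in>A. - 2 * (D a (u s) y * D a (L (u s)) y))) (at s)"
          unfolding Gstar_def
        proof (rule DERIV_sum)
          fix a assume "a \<in> A"
          from DERIV_power[OF dD[OF y this], of 2]
          show "((\<lambda>s. (D a (u s) y)\<^sup>2) has_real_derivative - 2 * (D a (u s) y * D a (L (u s)) y)) (at s)"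
            by (simp add: mult_ac)
        qed
        thus ?thesis by (simp add: sum_distrib_left)
      qed
      have 4: "((\<lambda>s. (gauss_profile (u s y))\<^sup>2 + \<gamma> s * Gstar (u s) y) has_real_derivative
        2 * (gauss_profile (u s y) * (inv \<Phi> (u s y) * L (u s) y))
       + ((4 / b + 2 * K * \<gamma> s) * Gstar (u s) y + (- 2 * (\<Sum>a\<in>A. D a (u s) y * D a (L (u s)) y)) * \<gamma> s)) (at s)"
        by (intro DERIV_add DERIV_mult 2 3 \<gamma>)
      from DERIV_chain2[OF DERIV_real_sqrt[OF Fpos[OF y]] 4]
      show ?thesis unfolding F_def F'_def by (simp add: mult.commute)
    qed
    have "((\<lambda>s. P s (F s) x) has_real_derivative P s (\<lambda>y. 1 * L (F s) y + F' y) x) (at s)"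
      by (intro heat.DERIV_expo_compose x dF) (auto intro!: derivative_eq_intros)
    moreover have "0 \<le> P s (\<lambda>y. 1 * L (F s) y + F' y) x"
    proof (rule P_nonneg[OF s(1) x])
      fix y assume y: "y \<in> S"
      have Fp: "0 < F s y" using Fpos[OF y] by (simp add: F_def)
      have "0 \<le> F s y * L (F s) y + (gauss_profile (u s y) * (inv \<Phi> (u s y) * L (u s) y) + (2 / b + K * \<gamma> s) * Gstar (u s) y
       - \<gamma> s * (\<Sum>a\<in>A. D a (u s) y * D a (L (u s)) y))"
        by (rule bobkov_generator[where u="u s" and F="F s" and v="inv \<Phi> (u s y)", OF curv y \<gamma>(2)[OF s(1)] u01 v[OF y]])
           (simp_all add: F_def)
      also have "\<dots> = F s y * (1 * L (F s) y + F' y)"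
        using Fp unfolding F'_def by (simp add: field_simps)
      finally show "0 \<le> 1 * L (F s) y + F' y" using Fp by (simp add: zero_le_mult_iff)
    qed
    ultimately show "\<exists>z. DERIV (\<lambda>s. P s (F s) x) s :> z \<and> 0 \<le> z" by blast
  qed
  moreover have "F 0 x = gauss_profile (P t f x)"
    using gauss_profile_nonneg by (simp add: F_def u_def \<gamma>)
  moreover have "u t = f" by (simp add: u_def fun_eq_iff)
  ultimately show ?thesis by (simp add: F_def[abs_def])
qed

text \<open>
  Contract the range to \<open>[e, 1 - e]\<close> and let \<open>e\<close> tend to \<open>0\<close>.
\<close>

theorem local_bobkov:
  assumes curv: "curved K" and t: "0 \<le> t" and x: "x \<in> S"
    and \<gamma>: "\<gamma> 0 = 0" "\<And>s. 0 \<le> s \<Longrightarrow> 0 \<le> \<gamma> s"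
      "\<And>s. (\<gamma> has_real_derivative 4 / b + 2 * K * \<gamma> s) (at s)"
    and f: "\<And>y. y \<in> S \<Longrightarrow> 0 \<le> f y \<and> f y \<le> 1"
  shows "gauss_profile (P t f x) \<le> P t (\<lambda>y. sqrt ((gauss_profile (f y))\<^sup>2 + \<gamma> t * Gstar f y)) x"
proof -
  define e where "e n = 1 / (real n + 3)" for n
  have e: "0 < e n" "e n < 1 / 2" for n by (auto simp: e_def field_simps)
  have e0: "e \<longlonglongrightarrow> 0" unfolding e_def by real_asymp
  define h where "h n y = 1 * e n + (1 - 2 * e n) * f y" for n y
  have h_lim: "(\<lambda>n. h n y) \<longlonglongrightarrow> 1 * 0 + (1 - 2 * 0) * f y" for y
    unfolding h_def by (intro tendsto_intros e0)
  have G: "Gstar (h n) y = (1 - 2 * e n)\<^sup>2 * Gstar f y" for n y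
    unfolding Gstar_def D_def h_def sum_distrib_left
    by (intro sum.cong refl) (simp add: power2_eq_square algebra_simps)
  have Ph: "P t (h n) x = 1 * e n + (1 - 2 * e n) * P t f x" for n
    using heat.expo_linear[OF x, of t 1 "\<lambda>_. e n" "1 - 2 * e n" f] by (simp add: h_def[abs_def] P_const x)
  have ineq: "gauss_profile (P t (h n) x) \<le> P t (\<lambda>y. sqrt ((gauss_profile (h n y))\<^sup>2 + \<gamma> t * Gstar (h n) y)) x" for n
  proof (rule local_bobkov_interior[OF curv t x \<gamma> e(1)])
    fix y assume "y \<in> S"
    with f have "0 \<le> (1 - 2 * e n) * f y" "(1 - 2 * e n) * f y \<le> (1 - 2 * e n) * 1"
      using e[of n] by (auto intro!: mult_left_mono mult_nonneg_nonneg)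
    thus "e n \<le> h n y \<and> h n y \<le> 1 - e n" by (simp add: h_def)
  qed (use e[of n] in auto)
  have "(\<lambda>n. gauss_profile (P t (h n) x)) \<longlonglongrightarrow> gauss_profile (1 * 0 + (1 - 2 * 0) * P t f x)"
    unfolding Ph by (intro isCont_tendsto_compose[OF isCont_gauss_profile] tendsto_intros e0)
  moreover have "(\<lambda>n. P t (\<lambda>y. sqrt ((gauss_profile (h n y))\<^sup>2 + \<gamma> t * Gstar (h n) y)) x) \<longlonglongrightarrow>
      P t (\<lambda>y. sqrt ((gauss_profile (1 * 0 + (1 - 2 * 0) * f y))\<^sup>2 + \<gamma> t * ((1 - 2 * 0)\<^sup>2 * Gstar f y))) x"
    unfolding G heat.expo_hk[OF x]
    by (intro tendsto_intros isCont_tendsto_compose[OF isCont_gauss_profile h_lim] e0)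
  ultimately have "gauss_profile (1 * 0 + (1 - 2 * 0) * P t f x)
     \<le> P t (\<lambda>y. sqrt ((gauss_profile (1 * 0 + (1 - 2 * 0) * f y))\<^sup>2 + \<gamma> t * ((1 - 2 * 0)\<^sup>2 * Gstar f y))) x"
    by (rule LIMSEQ_le) (use ineq in blast)
  thus ?thesis by simp
qed

end

section \<open>Weakly coupled coordinates: gradient comparison, smoothing, influences\<close>

text \<open>
  Hoelder's inequality with exponents \<open>1/\<theta>\<close> and \<open>1/(1 - \<theta>)\<close>, from Young's inequality applied to the
  terms after dividing by the two sums.
\<close>

lemma sum_powr_Holder:
  fixes X Y :: "'j \<Rightarrow> real"
  assumes "finite J" "\<And>j. j \<in> J \<Longrightarrow> 0 \<le> X j" "\<And>j. j \<in> J \<Longrightarrow> 0 \<le> Y j" "0 < \<theta>" "\<theta> < 1"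
  shows "(\<Sum>j\<in>J. X j powr \<theta> * Y j powr (1 - \<theta>)) \<le> (\<Sum>j\<in>J. X j) powr \<theta> * (\<Sum>j\<in>J. Y j) powr (1 - \<theta>)"
proof -
  define SX SY where "SX = (\<Sum>j\<in>J. X j)" and "SY = (\<Sum>j\<in>J. Y j)"
  have nn: "0 \<le> SX" "0 \<le> SY" using assms by (auto simp: SX_def SY_def intro: sum_nonneg)
  show ?thesis
  proof (cases "SX = 0 \<or> SY = 0")
    case True
    hence "X j powr \<theta> * Y j powr (1 - \<theta>) = 0" if "j \<in> J" for j
      using that assms sum_nonneg_0[of J X j] sum_nonneg_0[of J Y j] unfolding SX_def SY_def by auto
    hence "(\<Sum>j\<in>J. X j powr \<theta> * Y j powr (1 - \<theta>)) = 0" by (intro sum.neutral) blast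
    thus ?thesis by simp
  next
    case False
    hence pos: "0 < SX" "0 < SY" using nn by auto
    have "X j powr \<theta> * Y j powr (1 - \<theta>) \<le> (\<theta> * (X j / SX) + (1 - \<theta>) * (Y j / SY)) * (SX powr \<theta> * SY powr (1 - \<theta>))"
      if "j \<in> J" for j
    proof (cases "X j = 0 \<or> Y j = 0")
      case True
      thus ?thesis using assms that pos by auto
    next
      case False
      hence xy: "0 < X j" "0 < Y j" using assms(2,3)[OF that] by auto
      have "(X j / SX) powr \<theta> * (Y j / SY) powr (1 - \<theta>) \<le> \<theta> * (X j / SX) + (1 - \<theta>) * (Y j / SY)"
        by (rule Youngs_inequality_0) (use xy pos assms in auto)
      hence "(X j / SX) powr \<theta> * (Y j / SY) powr (1 - \<theta>) * (SX powr \<theta> * SY powr (1 - \<theta>))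
         \<le> (\<theta> * (X j / SX) + (1 - \<theta>) * (Y j / SY)) * (SX powr \<theta> * SY powr (1 - \<theta>))"
        by (rule mult_right_mono) auto
      thus ?thesis using xy pos by (simp add: powr_divide)
    qed
    hence "(\<Sum>j\<in>J. X j powr \<theta> * Y j powr (1 - \<theta>))
        \<le> (\<Sum>j\<in>J. (\<theta> * (X j / SX) + (1 - \<theta>) * (Y j / SY)) * (SX powr \<theta> * SY powr (1 - \<theta>)))"
      by (rule sum_mono)
    also have "\<dots> = (\<theta> * (SX / SX) + (1 - \<theta>) * (SY / SY)) * (SX powr \<theta> * SY powr (1 - \<theta>))"
      by (simp add: SX_def SY_def sum.distrib flip: sum_distrib_left sum_distrib_right sum_divide_distrib)
    also have "\<dots> = SX powr \<theta> * SY powr (1 - \<theta>)" using pos by simp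
    finally show ?thesis by (simp add: SX_def SY_def)
  qed
qed

context flow
begin

definition var :: "('a \<Rightarrow> real) \<Rightarrow> real" where "var f = E (\<lambda>x. (f x)\<^sup>2) - (E f)\<^sup>2"

lemma E_pos: 
  assumes "\<And>x. x \<in> S \<Longrightarrow> 0 \<le> f x" "x \<in> S" "0 < f x"
  shows "0 < E f"
  unfolding E_def
  by (rule sum_pos2[OF finite_S assms(2)]) (use assms \<mu>_pos in \<open>auto intro: mult_nonneg_nonneg less_imp_le\<close>)

lemma var_eq: "var f = E (\<lambda>x. (f x - E f)\<^sup>2)"
proof -
  have "E (\<lambda>x. (f x - E f)\<^sup>2) = E (\<lambda>x. ((f x)\<^sup>2 - 2 * E f * f x) + (E f)\<^sup>2)"
    by (intro E_cong) (simp add: power2_diff)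
  thus ?thesis by (simp only: E_add E_diff E_cmult E_const) (simp add: var_def power2_eq_square)
qed

lemma var_nonneg: "0 \<le> var f"
  unfolding var_eq by (intro E_nonneg) simp

lemma E_square_le: "(E f)\<^sup>2 \<le> E (\<lambda>x. (f x)\<^sup>2)"
  using var_nonneg[of f] by (simp add: var_def)

lemma var_zero_iff_const: "var f = 0 \<longleftrightarrow> (\<forall>x\<in>S. f x = E f)"
proof
  assume "var f = 0"
  show "\<forall>x\<in>S. f x = E f"
  proof (rule ballI, rule ccontr)
    fix x assume "x \<in> S" "f x \<noteq> E f"
    hence "0 < E (\<lambda>x. (f x - E f)\<^sup>2)" by (intro E_pos[of _ x]) auto
    thus False using \<open>var f = 0\<close> by (simp add: var_eq)
  qed
next
  assume "\<forall>x\<in>S. f x = E f"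
  hence "E (\<lambda>x. (f x - E f)\<^sup>2) = E (\<lambda>x. 0)" by (intro E_cong) auto
  thus "var f = 0" by (simp add: var_eq)
qed

lemma dir_cong: "(\<And>x. x \<in> S \<Longrightarrow> f x = g x) \<Longrightarrow> dir f f = dir g g"
proof -
  assume "\<And>x. x \<in> S \<Longrightarrow> f x = g x"
  thus ?thesis unfolding dir_def by (intro arg_cong2[where f="(*)"] refl E_cong sum.cong) (simp_all add: \<tau>_S)
qed

lemma DERIV_var_P: "((\<lambda>t. var (P t f)) has_real_derivative - 2 * dir (P t f) (P t f)) (at t)"
proof -
  have "((\<lambda>t. E (\<lambda>x. (P t f x)\<^sup>2) - (E f)\<^sup>2) has_real_derivative - 2 * dir (P t f) (P t f) - 0) (at t)"
    by (intro DERIV_diff DERIV_E_P_square DERIV_const)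
  thus ?thesis by (simp add: var_def E_P)
qed

lemma P_0: "P 0 f = f" by (simp add: fun_eq_iff)

lemma P_inverse: "x \<in> S \<Longrightarrow> P (- t) (P t f) x = f x"
  using heat.expo_add[of x "- t" t f] by simp

text \<open>
  The semigroup is invertible, so it cannot turn a non-constant function into a constant one.
\<close>

lemma var_P_pos:
  assumes "0 < var f"
  shows "0 < var (P t f)"
proof (rule ccontr)
  assume "\<not> ?thesis"
  hence "var (P t f) = 0" using var_nonneg[of "P t f"] by simp
  hence c: "\<And>x. x \<in> S \<Longrightarrow> P t f x = E (P t f)" by (simp add: var_zero_iff_const)
  have "f x = E (P t f)" if "x \<in> S" for x
  proof -
    have "f x = P (- t) (P t f) x" using P_inverse[OF that] by simp
    also have "\<dots> = P (- t) (\<lambda>_. E (P t f)) x" by (rule heat.expo_cong[OF c that])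
    finally show ?thesis by (simp add: P_const that)
  qed
  hence "var f = 0" by (simp add: var_zero_iff_const E_P)
  thus False using assms by simp
qed

text \<open>
  The second derivative of the logarithm of the variance is nonnegative by the Cauchy-Schwarz inequality for
  \<open>P\<^sub>t f - E f\<close> and \<open>L P\<^sub>t f\<close>.
\<close>

lemma var_P_log_convex:
  assumes "0 < var f" "0 < T" "0 \<le> t" "t \<le> T"
  shows "var (P t f) \<le> var f powr (1 - t / T) * var (P T f) powr (t / T)"
proof -
  let ?v = "\<lambda>t. var (P t f)" and ?d = "\<lambda>t. dir (P t f) (P t f)" and ?l = "\<lambda>t. E (\<lambda>x. (L (P t f) x)\<^sup>2)"
  have pos: "0 < ?v t" for t by (rule var_P_pos[OF assms(1)])
  have cs: "(?d t)\<^sup>2 \<le> ?v t * ?l t" for t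
  proof -
    let ?u = "P t f"
    define c where "c = ?d t / ?v t"
    have EL: "E (L ?u) = 0" using E_L[of "\<lambda>_. 1" ?u] by (simp add: dir_def)
    have "0 \<le> E (\<lambda>x. (L ?u x + c * (?u x - E ?u))\<^sup>2)" by (intro E_nonneg) simp
    also have "\<dots> = E (\<lambda>x. ((L ?u x)\<^sup>2 + (2 * c) * (?u x * L ?u x) - (2 * c * E ?u) * L ?u x) + c\<^sup>2 * (?u x - E ?u)\<^sup>2)"
      by (intro E_cong) (simp add: power2_eq_square algebra_simps)
    also have "\<dots> = ?l t - 2 * c * ?d t + c\<^sup>2 * ?v t"
      by (simp only: E_add E_diff E_cmult E_L EL var_eq[symmetric])
    also have "\<dots> = ?l t - (?d t)\<^sup>2 / ?v t"
      using pos[of t] by (simp add: c_def power2_eq_square field_simps)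
    finally show ?thesis using pos[of t] by (simp add: field_simps)
  qed
  have conv: "convex_on {0..T} (\<lambda>t. ln (?v t))"
  proof (rule f''_ge0_imp_convex)
    show "((\<lambda>t. ln (?v t)) has_real_derivative - 2 * (?d t / ?v t)) (at t)" for t
      using DERIV_chain2[OF DERIV_ln_divide[OF pos] DERIV_var_P, of t] by simp
    show "((\<lambda>t. - 2 * (?d t / ?v t)) has_real_derivative
        - 2 * ((- 2 * ?l t * ?v t - ?d t * (- 2 * ?d t)) / (?v t * ?v t))) (at t)" for t
      by (intro DERIV_cmult DERIV_divide DERIV_dir_P DERIV_var_P) (use pos[of t] in simp)
    show "0 \<le> - 2 * ((- 2 * ?l t * ?v t - ?d t * (- 2 * ?d t)) / (?v t * ?v t))" for t
    proof -
      have "- 2 * ((- 2 * ?l t * ?v t - ?d t * (- 2 * ?d t)) / (?v t * ?v t)) = 4 * (?v t * ?l t - (?d t)\<^sup>2) / (?v t * ?v t)"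
        by (simp add: power2_eq_square algebra_simps)
      also have "0 \<le> \<dots>" using cs[of t] pos[of t] by (intro divide_nonneg_nonneg) auto
      finally show ?thesis .
    qed
  qed simp
  have "ln (?v ((1 - t / T) *\<^sub>R 0 + (t / T) *\<^sub>R T)) \<le> (1 - t / T) * ln (?v 0) + (t / T) * ln (?v T)"
    by (rule convex_onD[OF conv]) (use assms in auto)
  hence "ln (?v t) \<le> (1 - t / T) * ln (var f) + (t / T) * ln (?v T)" using assms by (simp add: P_0)
  also have "\<dots> = ln (var f powr (1 - t / T) * ?v T powr (t / T))"
    using assms(1) pos[of T] by (subst ln_mult_pos) (auto simp: ln_powr)
  finally show ?thesis using assms(1) pos[of t] pos[of T] by (subst (asm) ln_le_cancel_iff) auto
qed

end

text \<open>
  Now the shifts are grouped into \<open>n\<close> coordinates, with the same finite set of shifts for each. The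
  matrix \<open>\<beta>\<close> bounds the commutator blockwise and its quadratic form is bounded by \<open>\<kappa>\<close>. The
  logarithmic Sobolev and the Poincare inequality share the constant \<open>\<alpha>\<close>. All constants derived
  below depend on \<open>b\<close>, \<open>\<kappa>\<close>, \<open>\<alpha>\<close> and the number of shifts only, not on \<open>n\<close>.
\<close>

locale coupled_flow = flow S "{..<n} \<times> KS" \<tau> \<iota> \<mu> b
  for S :: "'a set" and n :: nat and KS :: "nat set" and \<tau> :: "nat \<times> nat \<Rightarrow> 'a \<Rightarrow> 'a" and \<iota> \<mu> b +
  fixes \<beta> :: "nat \<Rightarrow> nat \<Rightarrow> real" and \<kappa> \<alpha> :: real
  assumes KS: "finite KS" "KS \<noteq> {}" and \<kappa>: "0 < \<kappa>" and \<alpha>: "0 < \<alpha>"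
    and \<beta>_nonneg: "i < n \<Longrightarrow> j < n \<Longrightarrow> 0 \<le> \<beta> i j"
    and \<beta>_Bc: "i < n \<Longrightarrow> j < n \<Longrightarrow> k \<in> KS \<Longrightarrow> l \<in> KS \<Longrightarrow> x \<in> S \<Longrightarrow> \<bar>Bc (i, k) (j, l) x\<bar> \<le> \<beta> i j"
    and \<beta>_form: "(\<Sum>i<n. \<Sum>j<n. v i * \<beta> i j * v j) \<le> \<kappa> * (\<Sum>i<n. (v i)\<^sup>2)"
    and lsi: "(\<And>x. x \<in> S \<Longrightarrow> 0 \<le> g x) \<Longrightarrow>
      E (\<lambda>x. (g x)\<^sup>2 * ln ((g x)\<^sup>2)) - E (\<lambda>x. (g x)\<^sup>2) * ln (E (\<lambda>x. (g x)\<^sup>2)) \<le> \<alpha> * dir g g"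
    and poincare: "var g \<le> \<alpha> * dir g g"
begin

abbreviation A where "A \<equiv> {..<n} \<times> KS"
definition N :: real where "N = real (card KS)"
definition K :: real where "K = \<kappa> * N"

lemma N: "1 \<le> N" using KS by (simp add: N_def Suc_le_eq card_gt_0_iff)
lemma K_pos: "0 < K" using \<kappa> N by (simp add: K_def)
lemma card_shifts: "real (card KS) = N" by (simp add: N_def)

lemma sum_square_le: "(\<Sum>k\<in>KS. (w k :: real))\<^sup>2 \<le> N * (\<Sum>k\<in>KS. (w k)\<^sup>2)"
  using Cauchy_Schwarz_ineq_sum[of "\<lambda>_. 1" w "KS"] card_shifts by simp

lemma curved_K: "curved K"
  unfolding curved_def
proof (intro ballI allI)
  fix x and w :: "nat \<times> nat \<Rightarrow> real" assume x: "x \<in> S"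
  define s where "s i = (\<Sum>k\<in>KS. \<bar>w (i, k)\<bar>)" for i :: nat
  have "(\<Sum>a\<in>A. \<Sum>c\<in>A. w a * Bc a c x * w c) \<le> (\<Sum>a\<in>A. \<Sum>c\<in>A. \<bar>w a\<bar> * \<beta> (fst a) (fst c) * \<bar>w c\<bar>)"
  proof (intro sum_mono)
    fix a c assume "a \<in> A" "c \<in> A"
    hence "\<bar>Bc a c x\<bar> \<le> \<beta> (fst a) (fst c)" using x by (cases a; cases c) (auto intro: \<beta>_Bc)
    hence "\<bar>w a * Bc a c x * w c\<bar> \<le> \<bar>w a\<bar> * \<beta> (fst a) (fst c) * \<bar>w c\<bar>"
      unfolding abs_mult by (intro mult_right_mono mult_left_mono) auto
    thus "w a * Bc a c x * w c \<le> \<bar>w a\<bar> * \<beta> (fst a) (fst c) * \<bar>w c\<bar>" by linarith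
  qed
  also have "\<dots> = (\<Sum>i<n. \<Sum>k\<in>KS. \<Sum>j<n. \<Sum>l\<in>KS. \<bar>w (i, k)\<bar> * \<beta> i j * \<bar>w (j, l)\<bar>)"
    by (simp add: sum.cartesian_product' )
  also have "\<dots> = (\<Sum>i<n. \<Sum>j<n. s i * \<beta> i j * s j)"
  proof (rule sum.cong[OF refl])
    fix i
    show "(\<Sum>k\<in>KS. \<Sum>j<n. \<Sum>l\<in>KS. \<bar>w (i, k)\<bar> * \<beta> i j * \<bar>w (j, l)\<bar>) = (\<Sum>j<n. s i * \<beta> i j * s j)"
      by (subst sum.swap[where A=KS and B="{..<n}"]) (simp only: s_def sum_distrib_right[of "\<lambda>k. \<bar>w (i, k)\<bar>"] sum_product)
  qed
  also have "\<dots> \<le> \<kappa> * (\<Sum>i<n. (s i)\<^sup>2)" by (rule \<beta>_form)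
  also have "\<dots> \<le> \<kappa> * (\<Sum>i<n. N * (\<Sum>k\<in>KS. (w (i, k))\<^sup>2))"
    using sum_square_le[of "\<lambda>k. \<bar>w (_, k)\<bar>"] \<kappa> unfolding s_def by (intro mult_left_mono sum_mono) auto
  also have "\<dots> = K * (\<Sum>a\<in>A. (w a)\<^sup>2)"
    by (simp add: K_def sum.cartesian_product' mult.assoc flip: sum_distrib_left)
  finally show "(\<Sum>a\<in>A. \<Sum>c\<in>A. w a * Bc a c x * w c) \<le> K * (\<Sum>a\<in>A. (w a)\<^sup>2)" .
qed

text \<open>
  The factor \<open>N\<close> accounts for the \<open>N\<close> shifts of a coordinate, which share the same bound.
\<close>

definition Mop :: "(nat \<Rightarrow> real) \<Rightarrow> nat \<Rightarrow> real" where "Mop v i = (\<Sum>j<n. N * \<beta> i j * v j)"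

sublocale M: kernel_op "{..<n}" Mop "\<lambda>i j. N * \<beta> i j"
  by unfold_locales (auto simp: Mop_def)

text \<open>
  The exponential \<open>e\<^sup>s\<^sup>M\<close> has norm at most \<open>e\<^sup>K\<^sup>s\<close>, as the quadratic form of \<open>M\<close> is at most \<open>K\<close>.
\<close>

lemma expo_Mop_norm:
  assumes "0 \<le> s"
  shows "(\<Sum>i<n. (expo Mop s v i)\<^sup>2) \<le> exp (2 * K * s) * (\<Sum>i<n. (v i)\<^sup>2)"
proof -
  let ?F = "\<lambda>s. exp (- (2 * K * s)) * (\<Sum>i<n. (expo Mop s v i)\<^sup>2)"
  have "?F s \<le> ?F 0"
  proof (rule DERIV_nonpos_imp_nonincreasing[OF assms])
    fix r
    let ?u = "expo Mop r v"
    have du: "((\<lambda>s. expo Mop s v i) has_real_derivative Mop ?u i) (at r)" if "i < n" for i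
      using M.DERIV_expo[of i v r] that by (simp add: M.expo_op)
    have dsq: "((\<lambda>s. \<Sum>i<n. (expo Mop s v i)\<^sup>2) has_real_derivative (\<Sum>i<n. 2 * (?u i * Mop ?u i))) (at r)"
      by (rule DERIV_sum) (auto intro!: derivative_eq_intros du)
    have dexp: "((\<lambda>s. exp (- (2 * K * s))) has_real_derivative exp (- (2 * K * r)) * (- (2 * K))) (at r)"
      by (auto intro!: derivative_eq_intros)
    have "(\<Sum>i<n. ?u i * Mop ?u i) = N * (\<Sum>i<n. \<Sum>j<n. ?u i * \<beta> i j * ?u j)"
      by (simp add: Mop_def sum_distrib_left mult_ac)
    also have "\<dots> \<le> N * (\<kappa> * (\<Sum>i<n. (?u i)\<^sup>2))" using N by (intro mult_left_mono \<beta>_form) auto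
    finally have "(\<Sum>i<n. 2 * (?u i * Mop ?u i)) \<le> 2 * K * (\<Sum>i<n. (?u i)\<^sup>2)"
      by (simp add: K_def mult_ac flip: sum_distrib_left)
    hence "exp (- (2 * K * r)) * ((\<Sum>i<n. 2 * (?u i * Mop ?u i)) - 2 * K * (\<Sum>i<n. (?u i)\<^sup>2)) \<le> 0"
      by (simp add: mult_nonneg_nonpos)
    moreover have "exp (- (2 * K * r)) * ((\<Sum>i<n. 2 * (?u i * Mop ?u i)) - 2 * K * (\<Sum>i<n. (?u i)\<^sup>2))
      = exp (- (2 * K * r)) * (- (2 * K)) * (\<Sum>i<n. (?u i)\<^sup>2) + (\<Sum>i<n. 2 * (?u i * Mop ?u i)) * exp (- (2 * K * r))"
      by (simp add: algebra_simps)
    ultimately show "\<exists>y. DERIV ?F r :> y \<and> y \<le> 0"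
      using DERIV_mult[OF dexp dsq] by (intro exI[of _ "exp (- (2 * K * r)) * (- (2 * K)) * (\<Sum>i<n. (?u i)\<^sup>2) + (\<Sum>i<n. 2 * (?u i * Mop ?u i)) * exp (- (2 * K * r))"]) simp
  qed
  hence "exp (2 * K * s) * ?F s \<le> exp (2 * K * s) * (\<Sum>i<n. (v i)\<^sup>2)" by (intro mult_left_mono) simp_all
  thus ?thesis by (simp add: mult.assoc[symmetric] flip: exp_add)
qed

text \<open>
  By the commutator formula the vector of all \<open>D\<^sub>a P\<^sub>s f\<close> solves the linear equation with generator
  \<open>L + B(x)\<close> on the product of the index set with \<open>S\<close>. This generator is dominated entrywise by
  \<open>L + \<beta>\<close>, in which \<open>\<beta>\<close> is constant in space, commutes with \<open>L\<close> and therefore splits off as the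
  factor \<open>e\<^sup>s\<^sup>M\<close>.
\<close>

lemma gradient_comparison:
  assumes U: "\<And>j l x. j < n \<Longrightarrow> l \<in> KS \<Longrightarrow> x \<in> S \<Longrightarrow> \<bar>D (j, l) f x\<bar> \<le> U j x"
    and s: "0 \<le> s" and ik: "i < n" "k \<in> KS" and x: "x \<in> S"
  shows "\<bar>D (i, k) (P s f) x\<bar> \<le> expo Mop s (\<lambda>j. P s (U j) x) i"
proof -
  define T1 where "T1 w p = L (\<lambda>y. w (fst p, y)) (snd p) + (\<Sum>c\<in>A. Bc (fst p) c (snd p) * w (c, snd p))"
    for w :: "(nat \<times> nat) \<times> 'a \<Rightarrow> real" and p
  define T2 where "T2 w p = L (\<lambda>y. w (fst p, y)) (snd p) + (\<Sum>c\<in>A. \<beta> (fst (fst p)) (fst c) * w (c, snd p))"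
    for w :: "(nat \<times> nat) \<times> 'a \<Rightarrow> real" and p
  have ker: "kernel_op (A \<times> S) (\<lambda>w p. L (\<lambda>y. w (fst p, y)) (snd p) + (\<Sum>c\<in>A. B (fst p) c (snd p) * w (c, snd p)))
      (\<lambda>p r. (if fst p = fst r then Lker (snd p) (snd r) else 0) + (if snd p = snd r then B (fst p) (fst r) (snd p) else 0))" for B
  proof
    fix w :: "(nat \<times> nat) \<times> 'a \<Rightarrow> real" and p assume p: "p \<in> A \<times> S"
    have "(\<Sum>r\<in>A \<times> S. ((if fst p = fst r then Lker (snd p) (snd r) else 0) + (if snd p = snd r then B (fst p) (fst r) (snd p) else 0)) * w r)
      = (\<Sum>c\<in>A. \<Sum>y\<in>S. (if fst p = c then Lker (snd p) y * w (c, y) else 0)) + (\<Sum>c\<in>A. \<Sum>y\<in>S. (if snd p = y then B (fst p) c (snd p) * w (c, y) else 0))"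
      unfolding sum.distrib[symmetric] sum.cartesian_product
      by (intro sum.cong refl) (auto simp: algebra_simps)
    also have "(\<Sum>c\<in>A. \<Sum>y\<in>S. (if fst p = c then Lker (snd p) y * w (c, y) else 0)) = (\<Sum>y\<in>S. Lker (snd p) y * w (fst p, y))"
      using p by (subst sum.swap) (auto intro!: sum.cong simp: finite_A)
    also have "\<dots> = L (\<lambda>y. w (fst p, y)) (snd p)" using p by (intro heat.kernel[symmetric]) auto
    also have "(\<Sum>c\<in>A. \<Sum>y\<in>S. (if snd p = y then B (fst p) c (snd p) * w (c, y) else 0)) = (\<Sum>c\<in>A. B (fst p) c (snd p) * w (c, snd p))"
      using p finite_S by (intro sum.cong refl) auto
    finally show "L (\<lambda>y. w (fst p, y)) (snd p) + (\<Sum>c\<in>A. B (fst p) c (snd p) * w (c, snd p)) =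
      (\<Sum>r\<in>A \<times> S. ((if fst p = fst r then Lker (snd p) (snd r) else 0) + (if snd p = snd r then B (fst p) (fst r) (snd p) else 0)) * w r)" by simp
  qed (intro finite_cartesian_product finite_A finite_S)
  have k1: "kernel_op (A \<times> S) T1 (\<lambda>p r. (if fst p = fst r then Lker (snd p) (snd r) else 0) + (if snd p = snd r then Bc (fst p) (fst r) (snd p) else 0))"
    unfolding T1_def[abs_def] by (rule ker)
  have k2: "kernel_op (A \<times> S) T2 (\<lambda>p r. (if fst p = fst r then Lker (snd p) (snd r) else 0) + (if snd p = snd r then \<beta> (fst (fst p)) (fst (fst r)) else 0))"
    unfolding T2_def[abs_def] by (rule ker[of "\<lambda>a c y. \<beta> (fst a) (fst c)"])
  interpret k1: kernel_op "A \<times> S" T1 "\<lambda>p r. (if fst p = fst r then Lker (snd p) (snd r) else 0) + (if snd p = snd r then Bc (fst p) (fst r) (snd p) else 0)"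
    by (rule k1)
  interpret k2: kernel_op "A \<times> S" T2 "\<lambda>p r. (if fst p = fst r then Lker (snd p) (snd r) else 0) + (if snd p = snd r then \<beta> (fst (fst p)) (fst (fst r)) else 0)"
    by (rule k2)
  have D1: "D (i, k) (P s f) x = expo T1 s (\<lambda>p. D (fst p) f (snd p)) ((i, k), x)"
  proof -
    have "(\<lambda>s p. D (fst p) (P s f) (snd p)) s ((i, k), x) = expo T1 s (\<lambda>p. D (fst p) f (snd p)) ((i, k), x)"
    proof (rule k1.expo_unique)
      fix s p assume p: "p \<in> A \<times> S"
      have "((\<lambda>s. D (fst p) (P s f) (snd p)) has_real_derivative D (fst p) (L (P s f)) (snd p)) (at s)"
        unfolding D_def by (intro DERIV_cmult DERIV_diff DERIV_P) (use p \<tau>_S in auto)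
      also have "D (fst p) (L (P s f)) (snd p) = T1 (\<lambda>p. D (fst p) (P s f) (snd p)) p"
        using p D_L_commutator[of "fst p" "snd p" "P s f"] by (simp only: T1_def mem_Times_iff fst_conv snd_conv simp_thms)
      finally show "((\<lambda>s. D (fst p) (P s f) (snd p)) has_real_derivative T1 (\<lambda>p. D (fst p) (P s f) (snd p)) p) (at s)" .
    qed (use ik x in \<open>auto simp: P_0\<close>)
    thus ?thesis by simp
  qed
  have D2: "expo Mop s (\<lambda>j. P s (U j) x) i = expo T2 s (\<lambda>p. U (fst (fst p)) (snd p)) ((i, k), x)"
  proof -
    have "(\<lambda>s p. expo Mop s (\<lambda>j. P s (U j) (snd p)) (fst (fst p))) s ((i, k), x) = expo T2 s (\<lambda>p. U (fst (fst p)) (snd p)) ((i, k), x)"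
    proof (rule k2.expo_unique)
      fix s p assume p: "p \<in> A \<times> S"
      let ?i = "fst (fst p)" and ?x = "snd p"
      have px: "?i < n" "?x \<in> S" using p by auto
      have "((\<lambda>s. expo Mop s (\<lambda>j. P s (U j) ?x) ?i) has_real_derivative
          expo Mop s (\<lambda>j. 1 * Mop (\<lambda>j. P s (U j) ?x) j + L (P s (U j)) ?x) ?i) (at s)"
        by (rule M.DERIV_expo_compose) (use px in \<open>auto intro!: DERIV_P derivative_eq_intros\<close>)
      also have "expo Mop s (\<lambda>j. 1 * Mop (\<lambda>j. P s (U j) ?x) j + L (P s (U j)) ?x) ?i
          = Mop (expo Mop s (\<lambda>j. P s (U j) ?x)) ?i + expo Mop s (\<lambda>j. L (P s (U j)) ?x) ?i"
        using M.expo_linear[of ?i s 1 "Mop (\<lambda>j. P s (U j) ?x)" 1 "\<lambda>j. L (P s (U j)) ?x"] px by (simp add: M.expo_op)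
      also have "expo Mop s (\<lambda>j. L (P s (U j)) ?x) ?i = L (\<lambda>y. expo Mop s (\<lambda>j. P s (U j) y) ?i) ?x"
        using px by (simp add: M.expo_hk heat.kernel sum_distrib_left mult_ac) (rule sum.swap)
      also have "Mop (expo Mop s (\<lambda>j. P s (U j) ?x)) ?i = (\<Sum>c\<in>A. \<beta> ?i (fst c) * expo Mop s (\<lambda>j. P s (U j) ?x) (fst c))"
        by (simp add: Mop_def sum.cartesian_product' card_shifts mult_ac)
      finally show "((\<lambda>s. expo Mop s (\<lambda>j. P s (U j) ?x) ?i) has_real_derivative
         T2 (\<lambda>p. expo Mop s (\<lambda>j. P s (U j) (snd p)) (fst (fst p))) p) (at s)"
        by (simp add: T2_def add.commute)
    qed (use ik x in \<open>auto simp: P_0\<close>)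
    thus ?thesis by simp
  qed
  show ?thesis unfolding D1 D2
  proof (rule expo_comparison[OF k1 k2 _ _ _ s])
    fix p r assume "p \<in> A \<times> S" "r \<in> A \<times> S" "p \<noteq> r"
    thus "\<bar>(if fst p = fst r then Lker (snd p) (snd r) else 0) + (if snd p = snd r then Bc (fst p) (fst r) (snd p) else 0)\<bar>
      \<le> (if fst p = fst r then Lker (snd p) (snd r) else 0) + (if snd p = snd r then \<beta> (fst (fst p)) (fst (fst r)) else 0)"
      using Lker_offdiag[of "snd p" "snd r"] \<beta>_Bc[of "fst (fst p)" "fst (fst r)" "snd (fst p)" "snd (fst r)" "snd p"]
      by (auto simp: prod_eq_iff)
  next
    fix p assume "p \<in> A \<times> S"
    thus "(if fst p = fst p then Lker (snd p) (snd p) else 0) + (if snd p = snd p then Bc (fst p) (fst p) (snd p) else 0)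
      \<le> (if fst p = fst p then Lker (snd p) (snd p) else 0) + (if snd p = snd p then \<beta> (fst (fst p)) (fst (fst p)) else 0)"
      using \<beta>_Bc[of "fst (fst p)" "fst (fst p)" "snd (fst p)" "snd (fst p)" "snd p"] by auto
  qed (use U ik x in auto)
qed

lemma dir_P_le:
  assumes U: "\<And>j l x. j < n \<Longrightarrow> l \<in> KS \<Longrightarrow> x \<in> S \<Longrightarrow> \<bar>D (j, l) f x\<bar> \<le> U j x" and s: "0 \<le> s"
  shows "dir (P s f) (P s f) \<le> N / b * exp (2 * K * s) * (\<Sum>j<n. E (\<lambda>x. (P s (U j) x)\<^sup>2))"
proof -
  let ?Z = "\<lambda>i x. expo Mop s (\<lambda>j. P s (U j) x) i"
  have "dir (P s f) (P s f) \<le> 1 / b * (\<Sum>a\<in>A. E (\<lambda>x. (D a (P s f) x)\<^sup>2))" by (rule dir_gradient_bounds)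
  also have "\<dots> \<le> 1 / b * (\<Sum>a\<in>A. E (\<lambda>x. (?Z (fst a) x)\<^sup>2))"
  proof (intro mult_left_mono sum_mono E_mono)
    fix a x assume "a \<in> A" "x \<in> S"
    hence "\<bar>D a (P s f) x\<bar> \<le> ?Z (fst a) x"
      using gradient_comparison[OF U s, of "fst a" "snd a" x] by (cases a) auto
    thus "(D a (P s f) x)\<^sup>2 \<le> (?Z (fst a) x)\<^sup>2" by (metis abs_ge_zero power2_abs power_mono)
  qed (use b in auto)
  also have "\<dots> = N / b * E (\<lambda>x. \<Sum>i<n. (?Z i x)\<^sup>2)"
    by (simp add: sum.cartesian_product' card_shifts E_sum flip: sum_distrib_left)
  also have "\<dots> \<le> N / b * E (\<lambda>x. exp (2 * K * s) * (\<Sum>j<n. (P s (U j) x)\<^sup>2))"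
    using N b by (intro mult_left_mono E_mono expo_Mop_norm s) auto
  finally show ?thesis by (simp add: E_cmult E_sum)
qed

lemma E_gradient_comparison:
  assumes U: "\<And>j l x. j < n \<Longrightarrow> l \<in> KS \<Longrightarrow> x \<in> S \<Longrightarrow> \<bar>D (j, l) f x\<bar> \<le> U j x" and s: "0 \<le> s"
    and ik: "i < n" "k \<in> KS"
  shows "E (\<lambda>x. \<bar>D (i, k) (P s f) x\<bar>) \<le> expo Mop s (\<lambda>j. E (U j)) i"
proof -
  have "E (\<lambda>x. \<bar>D (i, k) (P s f) x\<bar>) \<le> E (\<lambda>x. expo Mop s (\<lambda>j. P s (U j) x) i)"
    by (intro E_mono gradient_comparison[OF U s ik])
  also have "\<dots> = expo Mop s (\<lambda>j. E (U j)) i"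
    using ik by (simp add: M.expo_hk E_sum E_cmult E_P)
  finally show ?thesis .
qed


text \<open>
  Tangent lines turn the entropy of \<open>g\<^sup>2\<close> into a ratio of norms: \<open>log\<close> lies above its tangent, taken in
  the form \<open>log (g/c) \<ge> 1 - c/g\<close> at \<open>c = E(g\<^sup>2) / E(g)\<close>.
\<close>

lemma nash:
  assumes g: "\<And>x. x \<in> S \<Longrightarrow> 0 \<le> g x" and pos: "0 < E g"
  shows "E (\<lambda>x. (g x)\<^sup>2) * ln (E (\<lambda>x. (g x)\<^sup>2) / (E g)\<^sup>2) \<le> \<alpha> * dir g g"
proof -
  let ?s = "E (\<lambda>x. (g x)\<^sup>2)"
  have s: "0 < ?s" using E_square_le[of g] pos by (smt (verit) zero_less_power)
  define c where "c = ?s / E g"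
  have c: "0 < c" using s pos by (simp add: c_def)
  have "(2 * ln c + 2) * (g x)\<^sup>2 - 2 * c * g x \<le> (g x)\<^sup>2 * ln ((g x)\<^sup>2)" if x: "x \<in> S" for x
  proof (cases "g x = 0")
    case False
    hence gx: "0 < g x" using g[OF x] by simp
    have "ln (c / g x) \<le> c / g x - 1" using c gx by (intro ln_le_minus_one) simp
    hence "ln c + 1 - c / g x \<le> ln (g x)" using c gx by (simp add: ln_div)
    hence "2 * (g x)\<^sup>2 * (ln c + 1 - c / g x) \<le> 2 * (g x)\<^sup>2 * ln (g x)" by (intro mult_left_mono) auto
    moreover have "2 * (g x)\<^sup>2 * (ln c + 1 - c / g x) = (2 * ln c + 2) * (g x)\<^sup>2 - 2 * c * g x"
      using gx by (simp add: field_simps power2_eq_square)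
    moreover have "ln ((g x)\<^sup>2) = 2 * ln (g x)" using gx by (simp add: ln_realpow)
    ultimately show ?thesis by (simp add: mult_ac)
  qed simp
  hence "E (\<lambda>x. (2 * ln c + 2) * (g x)\<^sup>2 - 2 * c * g x) \<le> E (\<lambda>x. (g x)\<^sup>2 * ln ((g x)\<^sup>2))"
    by (rule E_mono)
  moreover have "E (\<lambda>x. (2 * ln c + 2) * (g x)\<^sup>2 - 2 * c * g x) = 2 * ln c * ?s"
  proof -
    have "2 * c * E g = 2 * ?s" using pos by (simp add: c_def)
    thus ?thesis by (simp only: E_diff E_cmult) (simp add: algebra_simps)
  qed
  ultimately have "2 * ln c * ?s - ?s * ln ?s \<le> \<alpha> * dir g g" using lsi[of g, OF g] by linarith
  moreover have ln: "ln (?s / (E g)\<^sup>2) = 2 * ln c - ln ?s"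
    using s pos by (simp add: c_def ln_div ln_realpow)
  have "?s * ln (?s / (E g)\<^sup>2) = 2 * ln c * ?s - ?s * ln ?s" unfolding ln by (simp add: algebra_simps)
  ultimately show ?thesis by linarith
qed

text \<open>
  The exponent gained by smoothing up to time \<open>t\<close>.
\<close>

definition \<theta> :: "real \<Rightarrow> real" where "\<theta> t = 1 - exp (- (2 * t / \<alpha>))"

lemma \<theta>_bounds: "0 < t \<Longrightarrow> 0 < \<theta> t" "\<theta> t < 1"
  using \<alpha> by (auto simp: \<theta>_def)

lemma E_zero: "(\<And>x. x \<in> S \<Longrightarrow> 0 \<le> h x) \<Longrightarrow> E h = 0 \<Longrightarrow> x \<in> S \<Longrightarrow> h x = 0"
  using E_pos[of h x] by force

text \<open>
  The mean of \<open>P\<^sub>t h\<close> is conserved. By the Nash inequality the quantity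
  \<open>log (E((P\<^sub>t h)\<^sup>2) / (E h)\<^sup>2)\<close> therefore decays at the rate \<open>2 / \<alpha>\<close>.
\<close>

lemma hypercontractive:
  assumes h: "\<And>x. x \<in> S \<Longrightarrow> 0 \<le> h x" and t: "0 \<le> t"
  shows "E (\<lambda>x. (P t h x)\<^sup>2) \<le> ((E h)\<^sup>2) powr \<theta> t * E (\<lambda>x. (h x)\<^sup>2) powr (1 - \<theta> t)"
proof (cases "E h = 0")
  case True
  have "P t h x = 0" if "x \<in> S" for x
    using heat.expo_cong[of h "\<lambda>_. 0" x t] E_zero[OF h True] that by (simp add: P_const)
  hence "E (\<lambda>x. (P t h x)\<^sup>2) = E (\<lambda>_. 0)" by (intro E_cong) simp
  thus ?thesis by simp
next
  case False
  hence pos: "0 < E h" using E_nonneg[of h, OF h] by simp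
  let ?e = "(E h)\<^sup>2" and ?s = "\<lambda>t. E (\<lambda>x. (P t h x)\<^sup>2)" and ?d = "\<lambda>t. dir (P t h) (P t h)"
  have e: "0 < ?e" using pos by simp
  have s: "0 < ?s t" for t using E_square_le[of "P t h"] e unfolding E_P by linarith
  let ?Y = "\<lambda>t. exp (2 * t / \<alpha>) * ln (?s t / ?e)"
  have "?Y t \<le> ?Y 0"
  proof (rule DERIV_nonpos_imp_nonincreasing[OF t])
    fix r assume r: "0 \<le> r" "r \<le> t"
    have "((\<lambda>t. ln (?s t / ?e)) has_real_derivative 1 / (?s r / ?e) * ((- 2 * ?d r) / ?e)) (at r)"
      by (rule DERIV_chain2[OF DERIV_ln_divide DERIV_cdivide[OF DERIV_E_P_square]]) (use s[of r] e in simp)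
    hence dl: "((\<lambda>t. ln (?s t / ?e)) has_real_derivative - (2 * ?d r / ?s r)) (at r)" using e by simp
    have de: "((\<lambda>t. exp (2 * t / \<alpha>)) has_real_derivative exp (2 * r / \<alpha>) * (2 / \<alpha>)) (at r)"
      using \<alpha> by (auto intro!: derivative_eq_intros)
    have "?s r * ln (?s r / ?e) \<le> \<alpha> * ?d r"
      using nash[of "P r h"] P_nonneg[OF r(1) _ h] pos by (simp add: E_P)
    hence "2 / \<alpha> * ln (?s r / ?e) \<le> 2 * ?d r / ?s r" using s[of r] \<alpha> by (simp add: field_simps)
    hence "exp (2 * r / \<alpha>) * (2 / \<alpha> * ln (?s r / ?e) - 2 * ?d r / ?s r) \<le> 0" by (intro mult_nonneg_nonpos) auto
    hence "exp (2 * r / \<alpha>) * (2 / \<alpha>) * ln (?s r / ?e) + - (2 * ?d r / ?s r) * exp (2 * r / \<alpha>) \<le> 0"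
      by (simp add: algebra_simps)
    thus "\<exists>y. DERIV ?Y r :> y \<and> y \<le> 0" using DERIV_mult[OF de dl] by blast
  qed
  hence "exp (- (2 * t / \<alpha>)) * ?Y t \<le> exp (- (2 * t / \<alpha>)) * ?Y 0" by (intro mult_left_mono) auto
  hence "ln (?s t / ?e) \<le> exp (- (2 * t / \<alpha>)) * ln (?s 0 / ?e)"
    by (simp add: mult.assoc[symmetric] flip: exp_add)
  also have "exp (- (2 * t / \<alpha>)) = 1 - \<theta> t" by (simp add: \<theta>_def)
  finally have "ln (?s t) \<le> \<theta> t * ln ?e + (1 - \<theta> t) * ln (?s 0)"
    using s[of t] s[of 0] e by (simp add: ln_div algebra_simps)
  also have "\<dots> = ln (?e powr \<theta> t * ?s 0 powr (1 - \<theta> t))"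
    using e s[of 0] by (subst ln_mult_pos) (auto simp: ln_powr)
  finally show ?thesis using s[of t] s[of 0] e by (subst (asm) ln_le_cancel_iff) (auto simp: P_0)
qed

lemma var_P_decay:
  assumes "0 \<le> t"
  shows "var (P t f) \<le> exp (- (2 * t / \<alpha>)) * var f"
proof -
  let ?Y = "\<lambda>t. exp (2 * t / \<alpha>) * var (P t f)"
  have "?Y t \<le> ?Y 0"
  proof (rule DERIV_nonpos_imp_nonincreasing[OF assms])
    fix r
    have de: "((\<lambda>t. exp (2 * t / \<alpha>)) has_real_derivative exp (2 * r / \<alpha>) * (2 / \<alpha>)) (at r)"
      using \<alpha> by (auto intro!: derivative_eq_intros)
    have "2 / \<alpha> * var (P r f) \<le> 2 * dir (P r f) (P r f)" using poincare[of "P r f"] \<alpha> by (simp add: field_simps)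
    hence "exp (2 * r / \<alpha>) * (2 / \<alpha> * var (P r f) - 2 * dir (P r f) (P r f)) \<le> 0" by (intro mult_nonneg_nonpos) auto
    hence "exp (2 * r / \<alpha>) * (2 / \<alpha>) * var (P r f) + (- 2 * dir (P r f) (P r f)) * exp (2 * r / \<alpha>) \<le> 0"
      by (simp add: algebra_simps)
    thus "\<exists>y. DERIV ?Y r :> y \<and> y \<le> 0" using DERIV_mult[OF de DERIV_var_P] by blast
  qed
  hence "exp (- (2 * t / \<alpha>)) * ?Y t \<le> exp (- (2 * t / \<alpha>)) * ?Y 0" by (intro mult_left_mono) auto
  thus ?thesis by (simp add: mult.assoc[symmetric] P_0 flip: exp_add)
qed

lemma \<theta>_lower:
  assumes "0 \<le> s" "s \<le> 1"
  shows "2 * s / (2 + \<alpha>) \<le> \<theta> s"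
proof -
  define y where "y = 2 * s / \<alpha>"
  have y: "0 \<le> y" using assms \<alpha> by (simp add: y_def)
  have "1 + y \<le> exp y" by (rule exp_ge_add_one_self)
  hence "exp (- y) \<le> 1 / (1 + y)" using y by (simp add: exp_minus field_simps)
  hence "1 - 1 / (1 + y) \<le> \<theta> s" by (simp add: \<theta>_def y_def)
  moreover have "1 - 1 / (1 + y) = 2 * s / (2 * s + \<alpha>)" using \<alpha> assms by (simp add: y_def field_simps)
  moreover have "2 * s / (2 + \<alpha>) \<le> 2 * s / (2 * s + \<alpha>)"
    using assms \<alpha> by (intro divide_left_mono) (auto intro!: mult_pos_pos add_nonneg_pos)
  ultimately show ?thesis by linarith
qed

definition \<nu> :: real where "\<nu> = 4 / (2 + \<alpha>)"

text \<open>
  The variance lost up to time \<open>1\<close> is the integral of twice the energy of \<open>P\<^sub>s f\<close>, and by the Poincare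
  inequality it is a fixed part of the variance. The gradient comparison and the smoothing estimate
  bound the energy at time \<open>s\<close> by a sum of \<open>a\<^sub>j e\<^sup>-\<^sup>k\<^sup>s\<close> with \<open>k\<close> proportional to \<open>1 + log r\<^sub>j\<close>, which
  integrates to \<open>a\<^sub>j / k\<close>. Instead of integrating, the proof adds the primitive to the variance and
  shows that the sum increases.
\<close>

lemma L1_L2_inequality:
  assumes U: "\<And>j l x. j < n \<Longrightarrow> l \<in> KS \<Longrightarrow> x \<in> S \<Longrightarrow> \<bar>D (j, l) f x\<bar> \<le> U j x"
  shows "(1 - exp (- (2 / \<alpha>))) * var f \<le> 2 * N / b * exp (2 * K + \<nu>) / \<nu> *
    (\<Sum>j<n. if \<forall>x\<in>S. U j x = 0 then 0
       else E (\<lambda>x. (U j x)\<^sup>2) / (1 + ln (sqrt (E (\<lambda>x. (U j x)\<^sup>2)) / E (U j))))"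
proof -
  have U0: "0 \<le> U j x" if "j < n" "x \<in> S" for j x
  proof -
    obtain l where "l \<in> KS" using KS by blast
    thus ?thesis using U[OF that(1) _ that(2)] abs_ge_zero order_trans by blast
  qed
  let ?J = "{j. j < n \<and> \<not> (\<forall>x\<in>S. U j x = 0)}"
  define a where "a j = E (\<lambda>x. (U j x)\<^sup>2)" for j
  define r where "r j = sqrt (a j) / E (U j)" for j
  define k where "k j = \<nu> * (1 + ln (r j))" for j
  define c where "c = N / b * exp (2 * K + \<nu>)"
  have \<nu>: "0 < \<nu>" using \<alpha> by (simp add: \<nu>_def)
  have c0: "0 < c" using N b by (simp add: c_def)
  have EU: "0 < E (U j)" if j: "j \<in> ?J" for j
  proof -
    obtain x where "x \<in> S" "U j x \<noteq> 0" using j by auto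
    thus ?thesis using U0[of j] j by (intro E_pos[of "U j" x]) (auto simp: less_le)
  qed
  have a: "(E (U j))\<^sup>2 \<le> a j" for j unfolding a_def by (rule E_square_le)
  have apos: "0 < a j" if "j \<in> ?J" for j
    using a[of j] EU[OF that] by (smt (verit) zero_less_power)
  have r: "1 \<le> r j" if "j \<in> ?J" for j
    using a[of j] EU[OF that] apos[OF that] unfolding r_def by (simp add: real_le_rsqrt)
  have k: "0 < k j" if "j \<in> ?J" for j
    using r[OF that] \<nu> unfolding k_def by (intro mult_pos_pos add_pos_nonneg) auto
  have small: "E (\<lambda>x. (P s (U j) x)\<^sup>2) \<le> (if j \<in> ?J then exp \<nu> * (a j * exp (- k j * s)) else 0)"
    if s: "0 \<le> s" "s \<le> 1" and j: "j < n" for s j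
  proof (cases "j \<in> ?J")
    case True
    have rp: "0 < r j" using r[OF True] by simp
    have "E (\<lambda>x. (P s (U j) x)\<^sup>2) \<le> ((E (U j))\<^sup>2) powr \<theta> s * a j powr (1 - \<theta> s)"
      unfolding a_def by (rule hypercontractive[OF U0[OF j] s(1)])
    also have "\<dots> = a j * exp (- (2 * \<theta> s * ln (r j)))"
    proof -
      have "ln (r j) = ln (a j) / 2 - ln (E (U j))"
        using apos[OF True] EU[OF True] by (simp add: r_def ln_div ln_sqrt)
      hence "ln (a j) = 2 * ln (r j) + 2 * ln (E (U j))" by simp
      hence e: "- (2 * \<theta> s * ln (r j)) = \<theta> s * (2 * ln (E (U j))) - \<theta> s * ln (a j)" by (simp only: algebra_simps)
      have "((E (U j))\<^sup>2) powr \<theta> s * a j powr (1 - \<theta> s) = exp (\<theta> s * (2 * ln (E (U j)))) * exp ((1 - \<theta> s) * ln (a j))"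
        using apos[OF True] EU[OF True] by (simp add: powr_def ln_realpow)
      also have "\<dots> = exp (ln (a j)) * exp (- (2 * \<theta> s * ln (r j)))"
        unfolding e by (simp add: algebra_simps flip: exp_add)
      finally show ?thesis using apos[OF True] by simp
    qed
    also have "\<dots> \<le> a j * exp (\<nu> + - k j * s)"
    proof -
      have "2 * (2 * s / (2 + \<alpha>)) * ln (r j) \<le> 2 * \<theta> s * ln (r j)"
        using \<theta>_lower[OF s] r[OF True] by (intro mult_right_mono) auto
      hence "\<nu> * s * ln (r j) \<le> 2 * \<theta> s * ln (r j)" by (simp add: \<nu>_def)
      moreover have "\<nu> * s \<le> \<nu> * 1" using s \<nu> by (intro mult_left_mono) auto
      moreover have "k j * s = \<nu> * s + \<nu> * s * ln (r j)" by (simp add: k_def algebra_simps)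
      ultimately have "- (2 * \<theta> s * ln (r j)) \<le> \<nu> + - k j * s" by simp
      thus ?thesis using apos[OF True] by simp
    qed
    finally have "E (\<lambda>x. (P s (U j) x)\<^sup>2) \<le> exp \<nu> * (a j * exp (- k j * s))"
      unfolding exp_add by (simp only: mult_ac)
    thus ?thesis using True by simp
  next
    case False
    hence "P s (U j) x = 0" if "x \<in> S" for x
      using heat.expo_cong[of "U j" "\<lambda>_. 0" x s] that j by (simp add: P_const)
    hence "E (\<lambda>x. (P s (U j) x)\<^sup>2) = E (\<lambda>_. 0)" by (intro E_cong) simp
    thus ?thesis using False by auto
  qed
  let ?G = "\<lambda>s. var (P s f) + 2 * c * (\<Sum>j\<in>?J. a j * ((1 - exp (- k j * s)) / k j))"
  have "?G 0 \<le> ?G 1"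
  proof (rule DERIV_nonneg_imp_nondecreasing[of 0 1 ?G])
    fix s :: real assume s: "0 \<le> s" "s \<le> 1"
    have dk: "((\<lambda>s. (1 - exp (- k j * s)) / k j) has_real_derivative exp (- k j * s)) (at s)" if "j \<in> ?J" for j
      using k[OF that] by (auto intro!: derivative_eq_intros)
    have d: "(?G has_real_derivative - 2 * dir (P s f) (P s f) + 2 * c * (\<Sum>j\<in>?J. a j * exp (- k j * s))) (at s)"
      by (intro DERIV_add DERIV_var_P DERIV_cmult DERIV_sum dk)
    have "dir (P s f) (P s f) \<le> N / b * exp (2 * K * s) * (\<Sum>j<n. E (\<lambda>x. (P s (U j) x)\<^sup>2))"
      by (rule dir_P_le[OF U s(1)])
    also have "\<dots> \<le> N / b * exp (2 * K) * (\<Sum>j<n. if j \<in> ?J then exp \<nu> * (a j * exp (- k j * s)) else 0)"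
    proof (intro mult_mono sum_mono small s)
      show "exp (2 * K * s) \<le> exp (2 * K)" using K_pos s by simp
    qed (use N b in \<open>auto intro!: sum_nonneg E_nonneg\<close>)
    also have "(\<Sum>j<n. if j \<in> ?J then exp \<nu> * (a j * exp (- k j * s)) else 0) = (\<Sum>j\<in>?J. exp \<nu> * (a j * exp (- k j * s)))"
      by (subst sum.inter_restrict[symmetric]) (auto intro!: sum.cong)
    also have "N / b * exp (2 * K) * \<dots> = c * (\<Sum>j\<in>?J. a j * exp (- k j * s))"
      by (simp add: c_def exp_add flip: sum_distrib_left)
    finally have "0 \<le> - 2 * dir (P s f) (P s f) + 2 * c * (\<Sum>j\<in>?J. a j * exp (- k j * s))" by simp
    thus "\<exists>y. DERIV ?G s :> y \<and> 0 \<le> y" using d by blast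
  qed simp
  hence "var f \<le> var (P 1 f) + 2 * c * (\<Sum>j\<in>?J. a j * ((1 - exp (- k j)) / k j))" by (simp add: P_0)
  also have "\<dots> \<le> exp (- (2 / \<alpha>)) * var f + 2 * c * (\<Sum>j\<in>?J. a j * (1 / k j))"
    using var_P_decay[of 1 f] c0 apos k
    by (intro add_mono mult_left_mono sum_mono divide_right_mono) (auto intro: less_imp_le)
  finally have "(1 - exp (- (2 / \<alpha>))) * var f \<le> 2 * c * (\<Sum>j\<in>?J. a j * (1 / k j))" by (simp add: algebra_simps)
  also have "\<dots> = 2 * c / \<nu> * (\<Sum>j\<in>?J. a j / (1 + ln (r j)))"
    unfolding sum_distrib_left k_def by (intro sum.cong refl) (simp add: \<nu>[THEN less_imp_neq, symmetric])
  also have "(\<Sum>j\<in>?J. a j / (1 + ln (r j))) = (\<Sum>j<n. if j \<in> ?J then a j / (1 + ln (r j)) else 0)"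
    by (subst sum.inter_restrict[symmetric]) (auto intro!: sum.cong)
  also have "\<dots> = (\<Sum>j<n. if \<forall>x\<in>S. U j x = 0 then 0 else a j / (1 + ln (r j)))"
    by (intro sum.cong) auto
  finally show ?thesis unfolding c_def a_def r_def by (simp only: times_divide_eq_right times_divide_eq_left mult.assoc)
qed

end

section \<open>Surface area inequalities for boolean functions\<close>

context coupled_flow
begin

abbreviation gam :: "real \<Rightarrow> real" where "gam \<equiv> bobkov_gamma b (- K)"

lemma gam_eq: "gam t = 2 * (exp (2 * K * t) - 1) / (b * K)"
  using K_pos b(1) by (simp add: bobkov_gamma_def divide_simps)

lemma gam_0: "gam 0 = 0" by (simp add: gam_eq)

lemma gam_nonneg: "0 \<le> t \<Longrightarrow> 0 \<le> gam t"
  unfolding gam_eq using K_pos b by simp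

lemma gam_DERIV: "(gam has_real_derivative 4 / b + 2 * K * gam s) (at s)"
proof -
  have "((\<lambda>t. 2 * (exp (2 * K * t) - 1) / (b * K)) has_real_derivative 2 * (exp (2 * K * s) * (2 * K)) / (b * K)) (at s)"
    using K_pos b(1) by (auto intro!: derivative_eq_intros)
  also have "2 * (exp (2 * K * s) * (2 * K)) / (b * K) = 4 / b + 2 * K * gam s"
    using K_pos b by (simp add: gam_eq field_simps)
  finally show ?thesis by (simp add: gam_eq[abs_def])
qed

text \<open>
  The linear bound near \<open>0\<close> gives the logarithmic gain in the Eldan-Gross inequality.
\<close>

lemma gam_upper:
  assumes "0 \<le> t" "t \<le> 2"
  shows "gam t \<le> 4 / b * exp (4 * K) * t"
proof -
  have "exp (2 * K * t) - 1 \<le> 2 * K * t * exp (2 * K * t)"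
    using exp_ge_add_one_self[of "- (2 * K * t)"] by (simp add: exp_minus field_simps)
  also have "\<dots> \<le> 2 * K * t * exp (4 * K)"
    using assms K_pos by (intro mult_left_mono) auto
  finally have "2 * (exp (2 * K * t) - 1) / (b * K) \<le> 2 * (2 * K * t * exp (4 * K)) / (b * K)"
    using K_pos b by (intro divide_right_mono mult_left_mono) auto
  thus ?thesis using K_pos by (simp add: gam_eq mult_ac)
qed

theorem local_bobkov_gam:
  assumes "0 \<le> t" "x \<in> S" "\<And>y. y \<in> S \<Longrightarrow> 0 \<le> f y \<and> f y \<le> 1"
  shows "gauss_profile (P t f x) \<le> P t (\<lambda>y. sqrt ((gauss_profile (f y))\<^sup>2 + gam t * Gstar f y)) x"
  by (rule local_bobkov[OF curved_K assms(1,2) gam_0 gam_nonneg gam_DERIV assms(3)])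

definition sens :: "('a \<Rightarrow> real) \<Rightarrow> 'a \<Rightarrow> nat" where "sens f x = card {a \<in> A. f (\<tau> a x) \<noteq> f x}"
definition SA :: "('a \<Rightarrow> real) \<Rightarrow> real" where "SA f = E (\<lambda>x. sqrt (real (sens f x)))"
definition csens :: "('a \<Rightarrow> real) \<Rightarrow> nat \<Rightarrow> 'a \<Rightarrow> nat" where "csens f i x = card {k \<in> KS. f (\<tau> (i, k) x) \<noteq> f x}"
definition SI :: "('a \<Rightarrow> real) \<Rightarrow> real" where "SI f = (\<Sum>i<n. (E (\<lambda>x. sqrt (real (csens f i x))))\<^sup>2)"

abbreviation \<theta>1 where "\<theta>1 \<equiv> \<theta> 1"

lemma \<theta>1: "0 < \<theta>1" "\<theta>1 < 1" using \<theta>_bounds by auto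

definition C_surf :: real where "C_surf = sqrt (gam 1) / b * (6 / \<theta>1 * sqrt (1 + 2 / \<theta>1) + 24 / sqrt \<theta>1)"

context
  fixes f :: "'a \<Rightarrow> real"
  assumes bool: "\<And>x. x \<in> S \<Longrightarrow> f x = - 1 \<or> f x = 1"
begin

definition g where "g x = (1 / 2) * f x + (1 / 2) * 1"

lemma g_01: "x \<in> S \<Longrightarrow> g x = 0 \<or> g x = 1"
  using bool[of x] by (auto simp: g_def)

lemma f_square: "E (\<lambda>x. (f x)\<^sup>2) = 1"
proof -
  have "E (\<lambda>x. (f x)\<^sup>2) = E (\<lambda>x. 1)" by (intro E_cong) (use bool in \<open>auto simp: power2_eq_1_iff\<close>)
  thus ?thesis by simp
qed

lemma var_le_1: "var f \<le> 1"
  by (simp add: var_def f_square)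

lemma Gstar_le_sens: "x \<in> S \<Longrightarrow> Gstar g x \<le> (1 / (2 * b))\<^sup>2 * real (sens f x)"
proof -
  assume x: "x \<in> S"
  have "Gstar g x \<le> (\<Sum>a\<in>A. if f (\<tau> a x) \<noteq> f x then (1 / (2 * b))\<^sup>2 else 0)"
    unfolding Gstar_def
  proof (rule sum_mono)
    fix a assume a: "a \<in> A"
    have "(q a x)\<^sup>2 \<le> (1 / (2 * b))\<^sup>2" using q_bounds[OF a x] by (intro power_mono) auto
    moreover have "(g (\<tau> a x) - g x)\<^sup>2 = (if f (\<tau> a x) \<noteq> f x then 1 else 0)"
      using bool[OF x] bool[OF \<tau>_S[OF a x]] by (auto simp: g_def)
    ultimately show "(D a g x)\<^sup>2 \<le> (if f (\<tau> a x) \<noteq> f x then (1 / (2 * b))\<^sup>2 else 0)"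
      by (simp add: D_def power_mult_distrib)
  qed
  also have "\<dots> = (1 / (2 * b))\<^sup>2 * real (sens f x)"
    by (subst sum.inter_filter[symmetric]) (simp_all add: sens_def finite_A)
  finally show ?thesis .
qed

lemma P_g_range:
  assumes "0 \<le> t" "x \<in> S"
  shows "0 \<le> P t g x" "P t g x \<le> 1"
  using P_range[of t x 0 g 1] g_01 assms by (metis less_eq_real_def zero_less_one)+

text \<open>
  For an indicator \<open>g\<close> the profile \<open>I(g)\<close> vanishes, so the Bobkov inequality bounds \<open>I(P\<^sub>t g)\<close> by the gradient
  alone. The weight is invariant under \<open>P\<^sub>t\<close>.
\<close>

lemma isoperimetry:
  assumes "0 \<le> t"
  shows "E (\<lambda>x. gauss_profile (P t g x)) \<le> sqrt (gam t) / (2 * b) * SA f"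
proof -
  have "E (\<lambda>x. gauss_profile (P t g x)) \<le> E (P t (\<lambda>x. sqrt (gam t) / (2 * b) * sqrt (real (sens f x))))"
  proof (rule E_mono)
    fix x assume x: "x \<in> S"
    have "gauss_profile (P t g x) \<le> P t (\<lambda>y. sqrt ((gauss_profile (g y))\<^sup>2 + gam t * Gstar g y)) x"
      by (rule local_bobkov_gam[OF assms x]) (use g_01 in force)
    also have "\<dots> \<le> P t (\<lambda>x. sqrt (gam t) / (2 * b) * sqrt (real (sens f x))) x"
    proof (rule P_mono[OF assms x])
      fix y assume y: "y \<in> S"
      have "gauss_profile (g y) = 0" using g_01[OF y] by (auto simp: gauss_profile_def)
      hence "sqrt ((gauss_profile (g y))\<^sup>2 + gam t * Gstar g y) = sqrt (gam t * Gstar g y)" by simp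
      also have "\<dots> \<le> sqrt (gam t * ((1 / (2 * b))\<^sup>2 * real (sens f y)))"
        by (intro real_sqrt_le_mono mult_left_mono Gstar_le_sens y gam_nonneg assms)
      also have "\<dots> = sqrt (gam t) / (2 * b) * sqrt (real (sens f y))"
        using b by (simp add: real_sqrt_mult real_sqrt_divide power2_eq_square)
      finally show "sqrt ((gauss_profile (g y))\<^sup>2 + gam t * Gstar g y) \<le> sqrt (gam t) / (2 * b) * sqrt (real (sens f y))" .
    qed
    finally show "gauss_profile (P t g x) \<le> P t (\<lambda>x. sqrt (gam t) / (2 * b) * sqrt (real (sens f x))) x" .
  qed
  thus ?thesis unfolding E_P E_cmult SA_def .
qed

lemma P_g: "x \<in> S \<Longrightarrow> P t g x = (1 / 2) * P t f x + (1 / 2) * 1"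
  unfolding g_def[abs_def] by (subst heat.expo_linear) (simp_all add: P_const)

lemma E_g: "E g = (1 + E f) / 2"
  unfolding g_def[abs_def] by (simp only: E_add E_cmult E_const) simp

lemma E_g_square: "E (\<lambda>x. (g x)\<^sup>2) = E g"
  by (intro E_cong) (use g_01 in force)

text \<open>
  The profile dominates \<open>u (1 - u) / 3\<close>, and the mean of \<open>P\<^sub>t g - (P\<^sub>t g)\<^sup>2\<close> is the variance that
  \<open>g\<close> has lost.
\<close>

lemma variance_drop:
  assumes "0 \<le> t"
  shows "var f - var (P t f) \<le> 6 / b * sqrt (gam t) * SA f"
proof -
  have "E (\<lambda>x. P t g x - (P t g x)\<^sup>2) = (var f - var (P t f)) / 4"
  proof -
    have 1: "E (\<lambda>x. P t g x - (P t g x)\<^sup>2) = E (\<lambda>x. 1 / 4 - 1 / 4 * (P t f x)\<^sup>2)"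
      by (intro E_cong) (simp add: P_g power2_eq_square algebra_simps)
    show ?thesis unfolding 1
      by (simp only: E_diff E_cmult E_const var_def E_P f_square) (simp add: field_simps)
  qed
  moreover have "E (\<lambda>x. P t g x - (P t g x)\<^sup>2) \<le> E (\<lambda>x. 3 * gauss_profile (P t g x))"
  proof (rule E_mono)
    fix x assume "x \<in> S"
    from gauss_profile_ge_variance[OF P_g_range[OF assms this]]
    show "P t g x - (P t g x)\<^sup>2 \<le> 3 * gauss_profile (P t g x)" by (simp add: power2_eq_square algebra_simps)
  qed
  ultimately show ?thesis using isoperimetry[OF assms] by (simp add: E_cmult field_simps)
qed

lemma SA_nonneg: "0 \<le> SA f" unfolding SA_def by (intro E_nonneg) simp

lemma surface_area_ge_variance: "var f \<le> 6 / (b * \<theta>1) * sqrt (gam 1) * SA f"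
proof -
  have "\<theta>1 * var f \<le> var f - var (P 1 f)"
    using var_P_decay[of 1 f] by (simp add: \<theta>_def algebra_simps)
  also have "\<dots> \<le> 6 / b * sqrt (gam 1) * SA f" by (rule variance_drop) simp
  finally show ?thesis using \<theta>1(1) b(1) by (simp add: divide_simps) (simp add: algebra_simps)
qed

text \<open>
  With \<open>p = E g\<close>, smoothing gives \<open>E((P\<^sub>1 g)\<^sup>2) \<le> p\<^sup>1\<^sup>+\<^sup>\<theta>\<close>. So at least half of the mass of \<open>P\<^sub>1 g\<close> sits
  where \<open>P\<^sub>1 g\<close> is at most \<open>\<eta> = 2 p\<^sup>\<theta>\<close>; there the profile exceeds \<open>u sqrt (log (1/\<eta>)) / 3\<close>. The
  proof encodes the truncation by the pointwise factor \<open>u - u\<^sup>2 / \<eta>\<close>, which is negative for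
  \<open>u > \<eta>\<close>.
\<close>

lemma small_set_isoperimetry:
  assumes p: "0 < E g" "E g powr \<theta>1 \<le> 1 / 4"
  shows "E g * sqrt (\<theta>1 / 2 * ln (1 / E g)) \<le> 3 / b * sqrt (gam 1) * SA f"
proof -
  define p where "p = E g"
  define \<eta> where "\<eta> = 2 * p powr \<theta>1"
  have p0: "0 < p" using p by (simp add: p_def)
  have eta: "0 < \<eta>" "\<eta> \<le> 1 / 2" using p by (auto simp: \<eta>_def p_def)
  have lneta: "ln (1 / \<eta>) = \<theta>1 * ln (1 / p) - ln 2"
    using p0 by (simp add: \<eta>_def ln_div ln_mult ln_powr)
  have "ln (p powr \<theta>1) \<le> ln (1 / 4)" using p p0 by (subst ln_le_cancel_iff) (auto simp: p_def)
  hence "2 * ln 2 \<le> \<theta>1 * ln (1 / p)"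
    using p0 ln_realpow[of 2 2] by (simp add: ln_powr ln_div)
  hence l: "\<theta>1 / 2 * ln (1 / p) \<le> ln (1 / \<eta>)" unfolding lneta by simp
  have I: "sqrt (ln (1 / \<eta>)) / 3 * (u - 1 / \<eta> * u\<^sup>2) \<le> gauss_profile u" if u: "0 \<le> u" "u \<le> 1" for u
  proof (cases "0 < u \<and> u \<le> \<eta>")
    case True
    have le: "1 / \<eta> \<le> 1 / u" using True by (intro divide_left_mono) auto
    have "sqrt (ln (1 / \<eta>)) / 3 * (u - 1 / \<eta> * u\<^sup>2) \<le> sqrt (ln (1 / u)) / 3 * u"
    proof (rule mult_mono)
      show "sqrt (ln (1 / \<eta>)) / 3 \<le> sqrt (ln (1 / u)) / 3"
        using le True eta by (simp add: ln_div) 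
      show "0 \<le> u - 1 / \<eta> * u\<^sup>2" using True eta by (simp add: power2_eq_square field_simps)
    qed (use True eta in auto)
    also have "\<dots> \<le> gauss_profile u" using gauss_profile_ge_log(1)[of u] True eta by (simp add: mult.commute)
    finally show ?thesis .
  next
    case False
    have "u - 1 / \<eta> * u\<^sup>2 \<le> 0"
    proof (cases "u = 0")
      case False
      hence "\<eta> \<le> u" using \<open>\<not> (0 < u \<and> u \<le> \<eta>)\<close> u by auto
      hence "\<eta> * u \<le> u * u" using u by (intro mult_right_mono) auto
      thus ?thesis using eta by (simp add: field_simps power2_eq_square)
    qed simp
    moreover have "0 \<le> sqrt (ln (1 / \<eta>)) / 3" using eta by simp
    ultimately have "sqrt (ln (1 / \<eta>)) / 3 * (u - 1 / \<eta> * u\<^sup>2) \<le> 0" by (rule mult_nonneg_nonpos[rotated])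
    thus ?thesis using gauss_profile_nonneg[of u] by linarith
  qed
  have sq: "E (\<lambda>x. (P 1 g x)\<^sup>2) \<le> p * p powr \<theta>1"
  proof -
    have "E (\<lambda>x. (P 1 g x)\<^sup>2) \<le> ((E g)\<^sup>2) powr \<theta>1 * E (\<lambda>x. (g x)\<^sup>2) powr (1 - \<theta>1)"
      by (rule hypercontractive) (use g_01 in force)+
    also have "\<dots> = p * p powr \<theta>1"
      using p0 unfolding E_g_square p_def[symmetric]
      by (simp add: power2_eq_square powr_mult powr_diff)
    finally show ?thesis .
  qed
  have "p / 2 \<le> E (P 1 g) - 1 / \<eta> * E (\<lambda>x. (P 1 g x)\<^sup>2)"
  proof -
    have "1 / \<eta> * E (\<lambda>x. (P 1 g x)\<^sup>2) \<le> 1 / \<eta> * (p * p powr \<theta>1)"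
      using eta by (intro mult_left_mono sq) auto
    also have "\<dots> = p / 2" using p0 by (simp add: \<eta>_def)
    finally show ?thesis by (simp add: E_P flip: p_def)
  qed
  hence "sqrt (\<theta>1 / 2 * ln (1 / p)) / 3 * (p / 2) \<le> sqrt (ln (1 / \<eta>)) / 3 * (E (P 1 g) - 1 / \<eta> * E (\<lambda>x. (P 1 g x)\<^sup>2))"
    using l p0 eta by (intro mult_mono divide_right_mono real_sqrt_le_mono) auto
  also have "\<dots> = E (\<lambda>x. sqrt (ln (1 / \<eta>)) / 3 * (P 1 g x - 1 / \<eta> * (P 1 g x)\<^sup>2))"
    by (simp only: E_cmult E_diff)
  also have "\<dots> \<le> E (\<lambda>x. gauss_profile (P 1 g x))"
    by (intro E_mono I P_g_range) auto
  also have "\<dots> \<le> sqrt (gam 1) / (2 * b) * SA f" by (rule isoperimetry) simp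
  finally show ?thesis unfolding p_def[symmetric] using b by (simp add: field_simps)
qed

text \<open>
  If \<open>p\<^sup>\<theta> \<le> 1/4\<close> this is the isoperimetric inequality for small sets. Otherwise \<open>log (1/p)\<close> is
  bounded, and the linear bound \<open>surface_area_ge_variance\<close> suffices.
\<close>

lemma surface_area_negative_mean:
  assumes v: "0 < var f" and half: "E f \<le> 0"
  shows "var f * sqrt (ln (exp 1 / var f)) \<le> C_surf * SA f"
proof -
  define p where "p = E g"
  have vp: "var f = 4 * p * (1 - p)"
    unfolding var_def f_square by (simp add: p_def E_g power2_eq_square field_simps)
  have p12: "p \<le> 1 / 2" using half by (simp add: p_def E_g)
  have p0: "0 < p" using v p12 unfolding vp by (simp add: zero_less_mult_iff)
  have v4: "var f \<le> 4 * p" unfolding vp using p0 by (simp add: algebra_simps)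
  have pv: "p \<le> var f"
  proof -
    have "p * 1 \<le> p * (4 * (1 - p))" using p0 p12 by (intro mult_left_mono) auto
    thus ?thesis by (simp add: vp algebra_simps)
  qed
  have lnv: "ln (exp 1 / var f) \<le> 1 + ln (1 / p)"
    using pv p0 v by (simp add: ln_div)
  have ln0: "0 \<le> ln (exp 1 / var f)" 
  proof -
    have "ln (var f) \<le> 0" using v var_le_1 by simp
    moreover have "ln (exp 1 / var f) = 1 - ln (var f)" using v by (simp add: ln_div)
    ultimately show ?thesis by linarith
  qed
  have g0: "0 \<le> sqrt (gam 1)" using gam_nonneg[of 1] by simp
  have sa: "0 \<le> sqrt (gam 1) / b * SA f" using SA_nonneg g0 b by simp
  show ?thesis
  proof (cases "p powr \<theta>1 \<le> 1 / 4")
    case True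
    have "ln (p powr \<theta>1) \<le> ln (1 / 4)" using True p0 by (subst ln_le_cancel_iff) auto
    hence "2 * ln 2 \<le> \<theta>1 * ln (1 / p)"
      using p0 ln_realpow[of 2 2] by (simp add: ln_powr ln_div)
    also have "\<dots> \<le> 1 * ln (1 / p)" using \<theta>1 p0 p12 by (intro mult_right_mono) auto
    finally have "1 \<le> ln (1 / p)" using ln2_ge_two_thirds by simp
    hence l2: "ln (exp 1 / var f) \<le> 4 / \<theta>1 * (\<theta>1 / 2 * ln (1 / p))" using lnv \<theta>1 by simp
    have "var f * sqrt (ln (exp 1 / var f)) \<le> 4 * p * sqrt (4 / \<theta>1 * (\<theta>1 / 2 * ln (1 / p)))"
      using v4 p0 l2 v ln0 by (intro mult_mono real_sqrt_le_mono) auto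
    also have "\<dots> = 8 / sqrt \<theta>1 * (p * sqrt (\<theta>1 / 2 * ln (1 / p)))"
      by (simp only: real_sqrt_mult real_sqrt_divide) simp
    also have "\<dots> \<le> 8 / sqrt \<theta>1 * (3 / b * sqrt (gam 1) * SA f)"
      using small_set_isoperimetry p0 True \<theta>1 unfolding p_def[symmetric] by (intro mult_left_mono) auto
    also have "\<dots> = 24 / sqrt \<theta>1 * (sqrt (gam 1) / b * SA f)" by simp
    also have "\<dots> \<le> (6 / \<theta>1 * sqrt (1 + 2 / \<theta>1) + 24 / sqrt \<theta>1) * (sqrt (gam 1) / b * SA f)"
      using sa \<theta>1 by (intro mult_right_mono) auto
    finally show ?thesis by (simp add: C_surf_def mult_ac)
  next
    case False
    have "ln (1 / 4) \<le> ln (p powr \<theta>1)" using False p0 by (subst ln_le_cancel_iff) auto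
    hence "\<theta>1 * ln (1 / p) \<le> 2 * ln 2" using p0 ln_realpow[of 2 2] by (simp add: ln_powr ln_div)
    also have "\<dots> \<le> 2" using ln_2_less_1 by simp
    finally have "ln (1 / p) \<le> 2 / \<theta>1" using \<theta>1 by (simp add: field_simps)
    hence "ln (exp 1 / var f) \<le> 1 + 2 / \<theta>1" using lnv by simp
    hence "var f * sqrt (ln (exp 1 / var f)) \<le> (6 / (b * \<theta>1) * sqrt (gam 1) * SA f) * sqrt (1 + 2 / \<theta>1)"
      using surface_area_ge_variance v ln0 by (intro mult_mono real_sqrt_le_mono) auto
    also have "\<dots> = (6 / \<theta>1 * sqrt (1 + 2 / \<theta>1)) * (sqrt (gam 1) / b * SA f)" by (simp add: mult_ac)
    also have "\<dots> \<le> (6 / \<theta>1 * sqrt (1 + 2 / \<theta>1) + 24 / sqrt \<theta>1) * (sqrt (gam 1) / b * SA f)"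
      using sa \<theta>1 by (intro mult_right_mono) auto
    finally show ?thesis by (simp add: C_surf_def mult_ac)
  qed
qed

end

theorem talagrand_surface_area:
  assumes bool: "\<And>x. x \<in> S \<Longrightarrow> f x = - 1 \<or> f x = 1" and v: "0 < var f"
  shows "var f * sqrt (ln (exp 1 / var f)) \<le> C_surf * SA f"
proof (cases "E f \<le> 0")
  case True
  thus ?thesis using surface_area_negative_mean[of f] bool v by blast
next
  case False
  have E: "E (\<lambda>x. - f x) = - E f" using E_cmult[of "-1" f] by simp
  hence vf: "var (\<lambda>x. - f x) = var f" by (simp add: var_def)
  have "SA (\<lambda>x. - f x) = SA f" by (simp add: SA_def sens_def)
  thus ?thesis using surface_area_negative_mean[of "\<lambda>x. - f x"] bool v False unfolding vf E by fastforce
qed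

definition C_noise :: real where "C_noise = \<alpha> * (N / b * exp (2 * K)) * ((N\<^sup>2 * exp (2 * K) * (N / b)\<^sup>2) * (N / b))"

lemma C_noise_pos: "0 < C_noise"
  using N b \<alpha> by (auto simp: C_noise_def intro!: mult_pos_pos)

text \<open>
  Run the semigroup twice for a unit of time. After the first unit the gradients have total energy at most
  one, no matter how large the influences of \<open>f\<close> are, while their \<open>L\<^sup>1\<close> norms are still
  controlled by the influences. The smoothing during the second unit interpolates between the two,
  and Hoelder's inequality sums the result over the coordinates.
\<close>

theorem noise_sensitivity:
  assumes bool: "\<And>x. x \<in> S \<Longrightarrow> f x = - 1 \<or> f x = 1"
  shows "var (P 2 f) \<le> C_noise * SI f powr \<theta> 1"
proof -
  have \<theta>1: "0 < \<theta> 1" "\<theta> 1 < 1" using \<theta>_bounds by auto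
  define h where "h = P 1 f"
  define V where "V j x = N / b * sqrt (real (csens f j x))" for j x
  define U where "U j x = (\<Sum>l\<in>KS. \<bar>D (j, l) h x\<bar>)" for j x
  have V: "\<bar>D (j, l) f x\<bar> \<le> V j x" if "j < n" "l \<in> KS" "x \<in> S" for j l x
  proof (cases "f (\<tau> (j, l) x) = f x")
    case True
    thus ?thesis using N b by (simp add: D_def V_def)
  next
    case False
    have a: "(j, l) \<in> A" using that by simp
    have "card {k \<in> KS. f (\<tau> (j, k) x) \<noteq> f x} \<noteq> 0" using KS False that by auto
    hence c: "1 \<le> sqrt (real (csens f j x))" by (simp add: csens_def)
    have "\<bar>f (\<tau> (j, l) x) - f x\<bar> \<le> 2"
      using bool[OF that(3)] bool[OF \<tau>_S[OF a that(3)]] by auto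
    hence "\<bar>D (j, l) f x\<bar> \<le> 1 / (2 * b) * 2"
      using q_bounds[OF a that(3)] b unfolding D_def abs_mult by (intro mult_mono) auto
    also have "\<dots> \<le> N / b * 1" using N b by (simp add: divide_right_mono)
    also have "\<dots> \<le> N / b * sqrt (real (csens f j x))" using c N b by (intro mult_left_mono) auto
    finally show ?thesis by (simp add: V_def)
  qed
  have U: "\<bar>D (j, l) h x\<bar> \<le> U j x" if "j < n" "l \<in> KS" "x \<in> S" for j l x
    unfolding U_def using that KS by (intro member_le_sum) auto
  have U0: "0 \<le> U j x" for j x unfolding U_def by (intro sum_nonneg) auto
  have EU1: "(\<Sum>j<n. (E (U j))\<^sup>2) \<le> N\<^sup>2 * exp (2 * K) * (N / b)\<^sup>2 * SI f"
  proof -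
    have "E (U j) \<le> N * expo Mop 1 (\<lambda>j. E (V j)) j" if j: "j < n" for j
    proof -
      have "E (U j) = (\<Sum>l\<in>KS. E (\<lambda>x. \<bar>D (j, l) h x\<bar>))" unfolding U_def[abs_def] by (rule E_sum)
      also have "\<dots> \<le> (\<Sum>l\<in>KS. expo Mop 1 (\<lambda>j. E (V j)) j)"
        unfolding h_def by (intro sum_mono E_gradient_comparison V j) auto
      finally show ?thesis by (simp add: N_def)
    qed
    hence "(\<Sum>j<n. (E (U j))\<^sup>2) \<le> (\<Sum>j<n. (N * expo Mop 1 (\<lambda>j. E (V j)) j)\<^sup>2)"
      by (intro sum_mono power_mono E_nonneg U0) auto
    also have "\<dots> = N\<^sup>2 * (\<Sum>j<n. (expo Mop 1 (\<lambda>j. E (V j)) j)\<^sup>2)"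
      by (simp add: power_mult_distrib sum_distrib_left)
    also have "\<dots> \<le> N\<^sup>2 * (exp (2 * K * 1) * (\<Sum>j<n. (E (V j))\<^sup>2))"
      by (intro mult_left_mono expo_Mop_norm) auto
    also have "(\<Sum>j<n. (E (V j))\<^sup>2) = (N / b)\<^sup>2 * SI f"
      unfolding V_def[abs_def] E_cmult SI_def power_mult_distrib sum_distrib_left ..
    finally show ?thesis by (simp add: mult_ac)
  qed
  have dir1: "dir h h \<le> 1"
  proof -
    have mono: "dir (P t f) (P t f) \<le> dir (P s f) (P s f)" if "s \<le> t" for s t
    proof (rule DERIV_nonpos_imp_nonincreasing[OF that])
      fix r show "\<exists>y. DERIV (\<lambda>t. dir (P t f) (P t f)) r :> y \<and> y \<le> 0"
        using DERIV_dir_P[of f r] E_nonneg[of "\<lambda>x. (L (P r f) x)\<^sup>2"] by (intro exI conjI) auto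
    qed
    have "var (P 1 f) + 2 * dir h h * 1 \<le> var (P 0 f) + 2 * dir h h * 0"
    proof (rule DERIV_nonpos_imp_nonincreasing[of 0 1 "\<lambda>t. var (P t f) + 2 * dir h h * t"])
      fix r :: real assume r: "0 \<le> r" "r \<le> 1"
      have "((\<lambda>t. var (P t f) + 2 * dir h h * t) has_real_derivative - 2 * dir (P r f) (P r f) + 2 * dir h h) (at r)"
        by (auto intro!: derivative_eq_intros DERIV_var_P)
      thus "\<exists>y. DERIV (\<lambda>t. var (P t f) + 2 * dir h h * t) r :> y \<and> y \<le> 0"
        using mono[OF r(2)] unfolding h_def by (intro exI conjI) auto
    qed simp
    thus ?thesis using var_nonneg[of "P 1 f"] var_le_1[of f, OF bool] by (simp add: P_0)
  qed
  have EU2: "(\<Sum>j<n. E (\<lambda>x. (U j x)\<^sup>2)) \<le> N / b"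
  proof -
    have "(\<Sum>j<n. E (\<lambda>x. (U j x)\<^sup>2)) \<le> (\<Sum>j<n. E (\<lambda>x. N * (\<Sum>l\<in>KS. \<bar>D (j, l) h x\<bar>\<^sup>2)))"
      unfolding U_def by (intro sum_mono E_mono sum_square_le)
    also have "\<dots> = N * (\<Sum>a\<in>A. E (\<lambda>x. (D a h x)\<^sup>2))"
      by (simp add: E_cmult E_sum sum.cartesian_product' sum_distrib_left)
    also have "\<dots> \<le> N * (1 / b * dir h h)" using N by (intro mult_left_mono dir_gradient_bounds) auto
    also have "\<dots> \<le> N * (1 / b * 1)" using N b dir1 by (intro mult_left_mono) auto
    finally show ?thesis by (simp only: mult_1_right times_divide_eq_right)
  qed
  have "(\<Sum>j<n. E (\<lambda>x. (P 1 (U j) x)\<^sup>2)) \<le> (\<Sum>j<n. ((E (U j))\<^sup>2) powr \<theta> 1 * E (\<lambda>x. (U j x)\<^sup>2) powr (1 - \<theta> 1))"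
    by (intro sum_mono hypercontractive U0) auto
  also have "\<dots> \<le> (\<Sum>j<n. (E (U j))\<^sup>2) powr \<theta> 1 * (\<Sum>j<n. E (\<lambda>x. (U j x)\<^sup>2)) powr (1 - \<theta> 1)"
    by (rule sum_powr_Holder) (use \<theta>1 in \<open>auto intro: E_nonneg\<close>)
  also have "\<dots> \<le> (N\<^sup>2 * exp (2 * K) * (N / b)\<^sup>2 * SI f) powr \<theta> 1 * (N / b) powr (1 - \<theta> 1)"
    using EU1 EU2 \<theta>1 by (intro mult_mono powr_mono2) (auto intro!: sum_nonneg E_nonneg)
  also have "\<dots> \<le> ((N\<^sup>2 * exp (2 * K) * (N / b)\<^sup>2) * SI f powr \<theta> 1) * (N / b)"
  proof -
    have Nb: "1 \<le> N / b" using N b by (simp add: field_simps)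
    have "1 * 1 * 1 \<le> N\<^sup>2 * exp (2 * K) * (N / b)\<^sup>2"
      using N Nb K_pos by (intro mult_mono) (auto intro: one_le_power)
    hence big: "1 \<le> N\<^sup>2 * exp (2 * K) * (N / b)\<^sup>2" by simp
    have SI0: "0 \<le> SI f" unfolding SI_def by (intro sum_nonneg) auto
    have le: "z powr u \<le> z" if "1 \<le> z" "u \<le> 1" for z u :: real
      using powr_mono[of u 1 z] that by simp
    have "(N\<^sup>2 * exp (2 * K) * (N / b)\<^sup>2 * SI f) powr \<theta> 1 = (N\<^sup>2 * exp (2 * K) * (N / b)\<^sup>2) powr \<theta> 1 * SI f powr \<theta> 1"
      by (rule powr_mult)
    also have "\<dots> \<le> (N\<^sup>2 * exp (2 * K) * (N / b)\<^sup>2) * SI f powr \<theta> 1"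
      using big \<theta>1 by (intro mult_right_mono le) auto
    finally show ?thesis
      using Nb \<theta>1 big by (intro mult_mono le) auto
  qed
  finally have S: "(\<Sum>j<n. E (\<lambda>x. (P 1 (U j) x)\<^sup>2)) \<le> (N\<^sup>2 * exp (2 * K) * (N / b)\<^sup>2) * SI f powr \<theta> 1 * (N / b)" .
  have "var (P 2 f) \<le> \<alpha> * dir (P 2 f) (P 2 f)" by (rule poincare)
  also have "dir (P 2 f) (P 2 f) = dir (P 1 h) (P 1 h)"
    unfolding h_def using heat.expo_add[of _ 1 1 f] by (intro dir_cong) simp
  also have "\<alpha> * dir (P 1 h) (P 1 h) \<le> \<alpha> * (N / b * exp (2 * K * 1) * (\<Sum>j<n. E (\<lambda>x. (P 1 (U j) x)\<^sup>2)))"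
    using \<alpha> by (intro mult_left_mono dir_P_le U) auto
  also have "\<dots> \<le> \<alpha> * (N / b * exp (2 * K * 1) * ((N\<^sup>2 * exp (2 * K) * (N / b)\<^sup>2) * SI f powr \<theta> 1 * (N / b)))"
    using \<alpha> N b by (intro mult_left_mono S) auto
  finally show ?thesis by (simp add: C_noise_def mult_ac)
qed

definition L0 :: real where "L0 = 4 / \<theta> 1 * max 1 (ln C_noise)"
definition C_eg :: real where
  "C_eg = 6 / (b * \<theta> 1) * sqrt (gam 1) * sqrt (2 + L0) + sqrt (2 / \<theta> 1) * C_surf
     + 12 / b * sqrt (96 * exp (4 * K) / (b * \<theta> 1))"

text \<open>
  Let \<open>l = log (1/W)\<close>. If \<open>l\<close> is bounded, the linear bound suffices. If the variance is at most
  \<open>W\<^sup>\<theta>\<^sup>/\<^sup>2\<close>, its own logarithm is comparable to \<open>l\<close> and Talagrand's inequality applies. In the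
  remaining case the noise sensitivity and the log-convexity show that the variance at time
  \<open>t = 8 / (\<theta> l)\<close> is at most half of the original one, and \<open>sqrt (\<gamma>(t))\<close> is of order \<open>1 / sqrt l\<close>.
\<close>

theorem eldan_gross:
  assumes bool: "\<And>x. x \<in> S \<Longrightarrow> f x = - 1 \<or> f x = 1" and v: "0 < var f"
  shows "var f * sqrt (ln (1 + exp 1 / SI f)) \<le> C_eg * SA f"
proof -
  have \<theta>1: "0 < \<theta> 1" "\<theta> 1 < 1" using \<theta>_bounds by auto
  define W where "W = SI f"
  have W0: "0 \<le> W" unfolding W_def SI_def by (intro sum_nonneg) auto
  have noise: "var (P 2 f) \<le> C_noise * W powr \<theta> 1" unfolding W_def by (rule noise_sensitivity[OF bool])
  have "W \<noteq> 0"
  proof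
    assume "W = 0"
    thus False using noise var_P_pos[OF v, of 2] by simp
  qed
  hence W: "0 < W" using W0 by simp
  define l where "l = ln (1 / W)"
  have lnW: "ln W = - l" using W by (simp add: l_def ln_div)
  have g0: "0 \<le> sqrt (gam 1)" using gam_nonneg[of 1] by simp
  have L0: "4 \<le> L0"
  proof -
    have "4 * 1 \<le> 4 / \<theta> 1 * max 1 (ln C_noise)" using \<theta>1 by (intro mult_mono) (auto simp: field_simps)
    thus ?thesis by (simp add: L0_def)
  qed
  have C_surf: "0 \<le> C_surf"
    unfolding C_surf_def using \<theta>1 g0 b by (intro mult_nonneg_nonneg add_nonneg_nonneg divide_nonneg_nonneg) auto
  have SA0: "0 \<le> SA f" by (rule SA_nonneg[OF bool])
  have v1: "var f \<le> 1" by (rule var_le_1[OF bool])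
  have lnle: "ln (1 + exp 1 / W) \<le> 2 + max 0 l"
  proof -
    have "1 + exp 1 / W \<le> exp 2 * max 1 (1 / W)"
    proof -
      have "1 + exp 1 / W \<le> (1 + exp 1) * max 1 (1 / W)"
        using W by (simp add: max_def field_simps)
      also have "1 + exp 1 \<le> exp (2::real)"
      proof -
        have "2 * exp 1 \<le> exp 1 * exp (1::real)" using exp_ge_add_one_self[of "1::real"] by (intro mult_right_mono) auto
        also have "exp 1 * exp 1 = exp (2::real)" by (simp flip: exp_add)
        finally show ?thesis using exp_ge_add_one_self[of "1::real"] by linarith
      qed
      finally show ?thesis by (simp add: mult_right_mono)
    qed
    hence "ln (1 + exp 1 / W) \<le> ln (exp 2 * max 1 (1 / W))"
      using W by (subst ln_le_cancel_iff) (auto intro!: add_pos_pos simp: less_max_iff_disj)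
    also have "\<dots> = 2 + ln (max 1 (1 / W))" using W by (subst ln_mult_pos) (auto simp: less_max_iff_disj)
    also have "ln (max 1 (1 / W)) \<le> max 0 l" using W by (auto simp: max_def l_def)
    finally show ?thesis by simp
  qed
  have ln0: "0 \<le> ln (1 + exp 1 / W)" using W by simp
  consider "l \<le> L0" | "L0 < l" "var f \<le> exp (- (\<theta> 1 * l / 2))" | "L0 < l" "exp (- (\<theta> 1 * l / 2)) < var f"
    by linarith
  hence "var f * sqrt (ln (1 + exp 1 / W)) \<le> C_eg * SA f"
  proof cases
    case 1
    have "ln (1 + exp 1 / W) \<le> 2 + L0" using lnle 1 L0 by simp
    hence "var f * sqrt (ln (1 + exp 1 / W)) \<le> (6 / (b * \<theta> 1) * sqrt (gam 1) * SA f) * sqrt (2 + L0)"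
      using surface_area_ge_variance[of f, OF bool] v ln0 by (intro mult_mono real_sqrt_le_mono) auto
    also have "\<dots> = (6 / (b * \<theta> 1) * sqrt (gam 1) * sqrt (2 + L0)) * SA f" by simp
    also have "\<dots> \<le> C_eg * SA f"
      unfolding C_eg_def using C_surf \<theta>1 b SA0 by (intro mult_right_mono) auto
    finally show ?thesis .
  next
    case 2
    have l4: "4 \<le> l" using 2 L0 by simp
    have "\<theta> 1 * 1 \<le> 1" using \<theta>1 by simp
    hence "\<theta> 1 / 2 * (2 + l) \<le> 1 + \<theta> 1 * l / 2" by (simp add: algebra_simps)
    also have "\<dots> \<le> ln (exp 1 / var f)"
    proof -
      have "ln (var f) \<le> - (\<theta> 1 * l / 2)" using 2(2) v by (metis ln_exp ln_le_cancel_iff exp_gt_zero)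
      thus ?thesis using v by (simp add: ln_div)
    qed
    finally have "2 + l \<le> 2 / \<theta> 1 * ln (exp 1 / var f)" using \<theta>1 by (simp add: field_simps)
    hence "ln (1 + exp 1 / W) \<le> 2 / \<theta> 1 * ln (exp 1 / var f)" using lnle l4 by simp
    hence "var f * sqrt (ln (1 + exp 1 / W)) \<le> var f * sqrt (2 / \<theta> 1 * ln (exp 1 / var f))"
      using v by (intro mult_left_mono real_sqrt_le_mono) auto
    also have "\<dots> = sqrt (2 / \<theta> 1) * (var f * sqrt (ln (exp 1 / var f)))" by (simp only: real_sqrt_mult mult_ac)
    also have "\<dots> \<le> sqrt (2 / \<theta> 1) * (C_surf * SA f)"
      using \<theta>1 by (intro mult_left_mono talagrand_surface_area bool v) auto
    also have "\<dots> \<le> C_eg * SA f"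
      unfolding C_eg_def mult.assoc[symmetric] using C_surf \<theta>1 b SA0 g0 L0 by (intro mult_right_mono) auto
    finally show ?thesis .
  next
    case 3
    have l4: "4 \<le> l" using 3 L0 by simp
    have big: "1 \<le> \<theta> 1 * l / 4" "ln C_noise \<le> \<theta> 1 * l / 4"
    proof -
      have "max 1 (ln C_noise) \<le> \<theta> 1 * l / 4" using 3(1) \<theta>1 by (simp add: L0_def field_simps)
      thus "1 \<le> \<theta> 1 * l / 4" "ln C_noise \<le> \<theta> 1 * l / 4" by auto
    qed
    define t where "t = 8 / (\<theta> 1 * l)"
    have t: "0 < t" "t \<le> 2" using big \<theta>1 l4 by (auto simp: t_def field_simps)
    have "C_noise \<le> exp (\<theta> 1 * l / 4)" using big(2) C_noise_pos by (metis exp_le_cancel_iff exp_ln)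
    hence "C_noise * W powr \<theta> 1 \<le> exp (\<theta> 1 * l / 4) * exp (- (\<theta> 1 * l))"
      using W by (simp add: powr_def lnW)
    also have "\<dots> = exp (- (\<theta> 1 * l / 4)) * exp (- (\<theta> 1 * l / 2))" by (simp flip: exp_add)
    also have "\<dots> \<le> exp (- (\<theta> 1 * l / 4)) * var f" using 3(2) by (intro mult_left_mono) auto
    finally have v2: "var (P 2 f) \<le> exp (- (\<theta> 1 * l / 4)) * var f" using noise by linarith
    have "var (P t f) \<le> var f powr (1 - t / 2) * var (P 2 f) powr (t / 2)"
      using var_P_log_convex[OF v, of 2 t] t by simp
    also have "\<dots> \<le> var f powr (1 - t / 2) * (exp (- (\<theta> 1 * l / 4)) * var f) powr (t / 2)"
      using v2 t var_nonneg[of "P 2 f"] by (intro mult_left_mono powr_mono2) auto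
    also have "\<dots> = exp (- (\<theta> 1 * l / 4) * (t / 2)) * (var f powr (1 - t / 2) * var f powr (t / 2))"
      using v by (simp add: powr_mult exp_powr_real)
    also have "var f powr (1 - t / 2) * var f powr (t / 2) = var f" using v by (simp flip: powr_add)
    also have "- (\<theta> 1 * l / 4) * (t / 2) = - 1" using \<theta>1 l4 by (simp add: t_def)
    also have "exp (- 1) * var f \<le> 1 / 2 * var f"
    proof (rule mult_right_mono)
      have "2 \<le> exp (1::real)" using exp_ge_add_one_self[of "1::real"] by simp
      thus "exp (- 1 :: real) \<le> 1 / 2" by (simp add: exp_minus field_simps)
    qed (use v in simp)
    finally have "var f \<le> 2 * (var f - var (P t f))" by simp
    also have "\<dots> \<le> 2 * (6 / b * sqrt (gam t) * SA f)"
      using variance_drop[of f t, OF bool] t by simp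
    also have "\<dots> \<le> 2 * (6 / b * sqrt (4 / b * exp (4 * K) * t) * SA f)"
      using t b SA0 gam_upper[of t] by (intro mult_left_mono mult_right_mono real_sqrt_le_mono) auto
    finally have vle: "var f \<le> 12 / b * sqrt (4 / b * exp (4 * K) * t) * SA f" by simp
    have "ln (1 + exp 1 / W) \<le> 3 * l" using lnle l4 by simp
    hence "var f * sqrt (ln (1 + exp 1 / W)) \<le> (12 / b * sqrt (4 / b * exp (4 * K) * t) * SA f) * sqrt (3 * l)"
      using vle v ln0 by (intro mult_mono real_sqrt_le_mono) auto
    also have "\<dots> = 12 / b * sqrt ((4 / b * exp (4 * K) * t) * (3 * l)) * SA f"
      unfolding real_sqrt_mult[of "4 / b * exp (4 * K) * t"] by simp
    also have "(4 / b * exp (4 * K) * t) * (3 * l) = 96 * exp (4 * K) / (b * \<theta> 1)"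
      using \<theta>1 l4 b by (simp add: t_def field_simps)
    also have "12 / b * sqrt (96 * exp (4 * K) / (b * \<theta> 1)) * SA f \<le> C_eg * SA f"
      unfolding C_eg_def using C_surf \<theta>1 b SA0 g0 L0 by (intro mult_right_mono) auto
    finally show ?thesis .
  qed
  thus ?thesis by (simp add: W_def)
qed

end

section \<open>Influences of boolean functions\<close>

context coupled_flow
begin

definition Lc :: "nat \<Rightarrow> ('a \<Rightarrow> real) \<Rightarrow> 'a \<Rightarrow> real" where "Lc i f x = (\<Sum>k\<in>KS. D (i, k) f x)"

definition C_infl :: real where "C_infl = 2 * N / b * exp (2 * K + \<nu>) / \<nu> / (1 - exp (- (2 / \<alpha>)))"

lemma C_infl_pos: "0 < C_infl"
  using N b \<alpha> by (auto simp: C_infl_def \<nu>_def intro!: divide_pos_pos mult_pos_pos)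

text \<open>
  No cancellation: this is why, for boolean functions, the single function \<open>L\<^sub>i f\<close> can replace the
  vector of the gradients of coordinate \<open>i\<close>.
\<close>

lemma abs_Lc_boolean:
  assumes bool: "\<And>x. x \<in> S \<Longrightarrow> f x = - 1 \<or> f x = 1" and i: "i < n" and x: "x \<in> S"
  shows "\<bar>Lc i f x\<bar> = (\<Sum>k\<in>KS. \<bar>D (i, k) f x\<bar>)"
proof -
  (* for a fixed point x all the differences have the sign of - f x *)
  have sgn: "\<bar>D (i, k) f x\<bar> = - f x * D (i, k) f x" if k: "k \<in> KS" for k
  proof -
    have a: "(i, k) \<in> A" using i k by simp
    show ?thesis using bool[OF x] bool[OF \<tau>_S[OF a x]] q_bounds(3)[OF a x]
      by (auto simp: D_def abs_mult)
  qed
  have "(\<Sum>k\<in>KS. \<bar>D (i, k) f x\<bar>) = - f x * Lc i f x"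
    unfolding Lc_def sum_distrib_left by (intro sum.cong refl sgn)
  moreover have "0 \<le> (\<Sum>k\<in>KS. \<bar>D (i, k) f x\<bar>)" by (rule sum_nonneg) simp
  ultimately show ?thesis using bool[OF x] by auto
qed

lemma D_le_Lc:
  assumes bool: "\<And>x. x \<in> S \<Longrightarrow> f x = - 1 \<or> f x = 1" and "i < n" "k \<in> KS" "x \<in> S"
  shows "\<bar>D (i, k) f x\<bar> \<le> \<bar>Lc i f x\<bar>"
proof -
  have "\<bar>D (i, k) f x\<bar> \<le> (\<Sum>k\<in>KS. \<bar>D (i, k) f x\<bar>)"
    using assms KS by (intro member_le_sum[of k KS "\<lambda>k. \<bar>D (i, k) f x\<bar>"]) auto
  also have "\<dots> = \<bar>Lc i f x\<bar>" by (rule abs_Lc_boolean[symmetric]) (use assms in auto)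
  finally show ?thesis .
qed

lemma Lc_le_csens:
  assumes bool: "\<And>x. x \<in> S \<Longrightarrow> f x = - 1 \<or> f x = 1" and i: "i < n" and x: "x \<in> S"
  shows "\<bar>Lc i f x\<bar> \<le> 1 / b * real (csens f i x)"
proof -
  have "\<bar>Lc i f x\<bar> = (\<Sum>k\<in>KS. \<bar>D (i, k) f x\<bar>)" by (rule abs_Lc_boolean) (use assms in auto)
  also have "\<dots> \<le> (\<Sum>k\<in>KS. if f (\<tau> (i, k) x) \<noteq> f x then 1 / b else 0)"
  proof (rule sum_mono)
    fix k assume k: "k \<in> KS"
    have a: "(i, k) \<in> A" using i k by simp
    have "\<bar>D (i, k) f x\<bar> \<le> 1 / (2 * b) * (if f (\<tau> (i, k) x) \<noteq> f x then 2 else 0)"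
      unfolding D_def abs_mult using q_bounds[OF a x] bool[OF x] bool[OF \<tau>_S[OF a x]] b(1)
      by (intro mult_mono) auto
    thus "\<bar>D (i, k) f x\<bar> \<le> (if f (\<tau> (i, k) x) \<noteq> f x then 1 / b else 0)" by (auto split: if_splits)
  qed
  also have "\<dots> = 1 / b * real (csens f i x)"
    by (subst sum.inter_filter[symmetric]) (simp_all add: csens_def KS)
  finally show ?thesis .
qed

lemma E_abs_le_L2: "E (\<lambda>x. \<bar>h x\<bar>) \<le> sqrt (E (\<lambda>x. (h x)\<^sup>2))"
  using E_square_le[of "\<lambda>x. \<bar>h x\<bar>"] by (intro real_le_rsqrt) simp

definition influence_term :: "('a \<Rightarrow> real) \<Rightarrow> nat \<Rightarrow> real" where
  "influence_term f i = (if \<forall>x\<in>S. Lc i f x = 0 then 0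
     else E (\<lambda>x. (Lc i f x)\<^sup>2) / (1 + ln (sqrt (E (\<lambda>x. (Lc i f x)\<^sup>2)) / E (\<lambda>x. \<bar>Lc i f x\<bar>))))"

theorem influence_inequality:
  assumes bool: "\<And>x. x \<in> S \<Longrightarrow> f x = - 1 \<or> f x = 1"
  shows "var f \<le> C_infl * (\<Sum>i<n. influence_term f i)"
proof -
  have e: "0 < 1 - exp (- (2 / \<alpha>))" using \<alpha> by simp
  have "(1 - exp (- (2 / \<alpha>))) * var f \<le> 2 * N / b * exp (2 * K + \<nu>) / \<nu> * (\<Sum>j<n. if \<forall>x\<in>S. \<bar>Lc j f x\<bar> = 0 then 0
       else E (\<lambda>x. \<bar>Lc j f x\<bar>\<^sup>2) / (1 + ln (sqrt (E (\<lambda>x. \<bar>Lc j f x\<bar>\<^sup>2)) / E (\<lambda>x. \<bar>Lc j f x\<bar>))))"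
    by (rule L1_L2_inequality) (rule D_le_Lc[OF bool])
  also have "(\<Sum>j<n. if \<forall>x\<in>S. \<bar>Lc j f x\<bar> = 0 then 0
       else E (\<lambda>x. \<bar>Lc j f x\<bar>\<^sup>2) / (1 + ln (sqrt (E (\<lambda>x. \<bar>Lc j f x\<bar>\<^sup>2)) / E (\<lambda>x. \<bar>Lc j f x\<bar>)))) = (\<Sum>i<n. influence_term f i)"
    by (simp only: influence_term_def power2_abs abs_eq_0)
  finally have "var f \<le> 2 * N / b * exp (2 * K + \<nu>) / \<nu> * (\<Sum>i<n. influence_term f i) / (1 - exp (- (2 / \<alpha>)))"
    using e by (simp only: pos_le_divide_eq mult.commute)
  thus ?thesis by (simp add: C_infl_def)
qed

lemma E_Lc_pos:
  assumes "\<not> (\<forall>x\<in>S. Lc i f x = 0)"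
  shows "0 < E (\<lambda>x. \<bar>Lc i f x\<bar>)" "0 < E (\<lambda>x. (Lc i f x)\<^sup>2)"
proof -
  obtain x where "x \<in> S" "Lc i f x \<noteq> 0" using assms by blast
  thus "0 < E (\<lambda>x. \<bar>Lc i f x\<bar>)" "0 < E (\<lambda>x. (Lc i f x)\<^sup>2)" by (auto intro!: E_pos[of _ x])
qed

lemma influence_term_nonneg: "0 \<le> influence_term f i"
proof (cases "\<forall>x\<in>S. Lc i f x = 0")
  case False
  have "1 \<le> sqrt (E (\<lambda>x. (Lc i f x)\<^sup>2)) / E (\<lambda>x. \<bar>Lc i f x\<bar>)"
    using E_abs_le_L2[of "Lc i f"] E_Lc_pos[OF False] by simp
  thus ?thesis unfolding influence_term_def if_not_P[OF False]
    using E_Lc_pos[OF False] by (intro divide_nonneg_nonneg add_nonneg_nonneg) auto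
qed (simp add: influence_term_def)

text \<open>
  The function \<open>L\<^sub>i f\<close> lives on a set of measure at most \<open>p\<close>, so the ratio of its \<open>L\<^sup>2\<close> and \<open>L\<^sup>1\<close> norms is at
  least \<open>1 / sqrt p\<close>.
\<close>

lemma influence_term_le:
  assumes bool: "\<And>x. x \<in> S \<Longrightarrow> f x = - 1 \<or> f x = 1" and i: "i < n"
    and p: "E (\<lambda>x. real (csens f i x)) \<le> p" and s: "0 < s" "p \<le> 1 / sqrt s" "1 < s"
  shows "influence_term f i \<le> 4 * N / b\<^sup>2 * p / ln s"
proof (cases "\<forall>x\<in>S. Lc i f x = 0")
  case True
  have "0 \<le> E (\<lambda>x. real (csens f i x))" by (rule E_nonneg) simp
  thus ?thesis using True p N s by (auto simp: influence_term_def intro!: divide_nonneg_nonneg mult_nonneg_nonneg)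
next
  case False
  define a where "a = E (\<lambda>x. (Lc i f x)\<^sup>2)"
  define e where "e = E (\<lambda>x. \<bar>Lc i f x\<bar>)"
  have pos: "0 < e" "0 < a" using E_Lc_pos[OF False] by (auto simp: a_def e_def)
  have ale: "a \<le> N / b\<^sup>2 * p"
  proof -
    have "a \<le> E (\<lambda>x. N / b\<^sup>2 * real (csens f i x))"
      unfolding a_def
    proof (rule E_mono)
      fix x assume x: "x \<in> S"
      have c: "real (csens f i x) \<le> N" unfolding csens_def N_def using KS by (simp add: card_mono)
      have "(Lc i f x)\<^sup>2 \<le> (1 / b * real (csens f i x))\<^sup>2"
        using power_mono[OF Lc_le_csens[of f i x, OF bool i x], of 2] by simp
      also have "\<dots> = 1 / b\<^sup>2 * (real (csens f i x) * real (csens f i x))" by (simp add: power2_eq_square)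
      also have "\<dots> \<le> 1 / b\<^sup>2 * (N * real (csens f i x))" using c by (intro mult_left_mono mult_right_mono) auto
      finally show "(Lc i f x)\<^sup>2 \<le> N / b\<^sup>2 * real (csens f i x)" by simp
    qed
    also have "\<dots> = N / b\<^sup>2 * E (\<lambda>x. real (csens f i x))" by (rule E_cmult)
    also have "\<dots> \<le> N / b\<^sup>2 * p" using p N by (intro mult_left_mono) auto
    finally show ?thesis .
  qed
  have "e\<^sup>2 \<le> a * p"
  proof -
    define u v where "u x = sqrt (\<mu> x) * \<bar>Lc i f x\<bar>" and "v x = sqrt (\<mu> x) * (if Lc i f x = 0 then 0 else 1)" for x
    have "e = (\<Sum>x\<in>S. u x * v x)"
      unfolding e_def E_def u_def v_def
    proof (rule sum.cong[OF refl])
      fix x assume "x \<in> S"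
      hence "0 < \<mu> x" by (rule \<mu>_pos)
      thus "\<mu> x * \<bar>Lc i f x\<bar> = sqrt (\<mu> x) * \<bar>Lc i f x\<bar> * (sqrt (\<mu> x) * (if Lc i f x = 0 then 0 else 1))" by simp
    qed
    hence "e\<^sup>2 \<le> (\<Sum>x\<in>S. (u x)\<^sup>2) * (\<Sum>x\<in>S. (v x)\<^sup>2)" using Cauchy_Schwarz_ineq_sum[of u v S] by simp
    also have "(\<Sum>x\<in>S. (u x)\<^sup>2) = a"
      unfolding a_def E_def u_def
    proof (rule sum.cong[OF refl])
      fix x assume "x \<in> S"
      hence "0 < \<mu> x" by (rule \<mu>_pos)
      thus "(sqrt (\<mu> x) * \<bar>Lc i f x\<bar>)\<^sup>2 = \<mu> x * (Lc i f x)\<^sup>2" by (simp add: power_mult_distrib)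
    qed
    finally have 1: "e\<^sup>2 \<le> a * (\<Sum>x\<in>S. (v x)\<^sup>2)" .
    have "(\<Sum>x\<in>S. (v x)\<^sup>2) = E (\<lambda>x. if Lc i f x = 0 then 0 else 1)"
      unfolding E_def v_def
    proof (rule sum.cong[OF refl])
      fix x assume "x \<in> S"
      hence "0 < \<mu> x" by (rule \<mu>_pos)
      thus "(sqrt (\<mu> x) * (if Lc i f x = 0 then 0 else 1))\<^sup>2 = \<mu> x * (if Lc i f x = 0 then 0 else 1)" by simp
    qed
    also have "\<dots> \<le> E (\<lambda>x. real (csens f i x))"
    proof (rule E_mono)
      fix x assume x: "x \<in> S"
      have "Lc i f x = 0" if "csens f i x = 0" using Lc_le_csens[of f i x, OF bool i x] that by simp
      thus "(if Lc i f x = 0 then 0 else 1) \<le> real (csens f i x)" by (cases "csens f i x") auto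
    qed
    finally have "(\<Sum>x\<in>S. (v x)\<^sup>2) \<le> p" using p by simp
    hence "a * (\<Sum>x\<in>S. (v x)\<^sup>2) \<le> a * p" using pos by (intro mult_left_mono) auto
    with 1 show ?thesis by linarith
  qed
  also have "\<dots> \<le> a * (1 / sqrt s)" using s pos by (intro mult_left_mono) auto
  finally have "sqrt s \<le> a / e\<^sup>2" using pos s by (simp add: field_simps)
  hence "ln (sqrt s) \<le> ln (a / e\<^sup>2)" using s pos by (subst ln_le_cancel_iff) auto
  hence "ln s / 2 \<le> 2 * ln (sqrt a / e)" using s pos by (simp add: ln_sqrt ln_div ln_realpow)
  hence l: "ln s / 4 \<le> 1 + ln (sqrt a / e)" by linarith
  have "influence_term f i = a / (1 + ln (sqrt a / e))"
    unfolding influence_term_def if_not_P[OF False] a_def e_def ..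
  also have "\<dots> \<le> a / (ln s / 4)"
  proof -
    have "0 < ln s" using s by simp
    moreover from this l have "0 < 1 + ln (sqrt a / e)" by linarith
    ultimately show ?thesis using l pos by (intro divide_left_mono mult_pos_pos) auto
  qed
  also have "\<dots> \<le> (N / b\<^sup>2 * p) / (ln s / 4)" using ale s by (intro divide_right_mono) auto
  finally show ?thesis by (simp add: mult_ac)
qed

lemma ln_le_sqrt: "1 \<le> x \<Longrightarrow> ln x \<le> sqrt x" for x :: real
proof -
  assume x: "1 \<le> x"
  have "ln (sqrt x / exp 1) \<le> sqrt x / exp 1 - 1" using x by (intro ln_le_minus_one) simp
  hence "ln (sqrt x) \<le> sqrt x / exp 1" using x by (simp add: ln_div)
  also have "\<dots> \<le> sqrt x / 2"
    using x exp_ge_add_one_self[of "1::real"] by (intro divide_left_mono) auto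
  finally show ?thesis using x by (simp add: ln_sqrt)
qed

definition C_kkl :: real where "C_kkl = 1 + C_infl * (4 * N / b\<^sup>2)"

text \<open>
  If some influence exceeds \<open>1 / sqrt n\<close> there is nothing to prove. Otherwise all the
  logarithms in the influence inequality are of order \<open>log n\<close>.
\<close>

theorem kkl:
  assumes bool: "\<And>x. x \<in> S \<Longrightarrow> f x = - 1 \<or> f x = 1" and n1: "1 \<le> n"
    and M: "\<And>i. i < n \<Longrightarrow> E (\<lambda>x. real (csens f i x)) \<le> M"
  shows "ln (real n) / real n * var f \<le> C_kkl * M"
proof -
  have M0: "0 \<le> M"
    using M[of 0] n1 E_nonneg[of "\<lambda>x. real (csens f 0 x)"] by (simp add: order_trans)
  have c0: "0 \<le> C_infl * (4 * N / b\<^sup>2)" using C_infl_pos N by (auto intro!: mult_nonneg_nonneg)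
  show ?thesis
  proof (cases "n = 1 \<or> 1 / sqrt (real n) \<le> M")
    case True
    have "ln (real n) / real n * var f \<le> M"
    proof (cases "n = 1")
      case False
      have "ln (real n) / real n * var f \<le> (sqrt (real n) / real n) * 1"
        using n1 ln_le_sqrt[of "real n"] var_le_1[of f, OF bool] var_nonneg[of f]
        by (intro mult_mono divide_right_mono) auto
      also have "\<dots> = 1 / sqrt (real n)" using n1 by (simp add: real_div_sqrt field_simps)
      also have "\<dots> \<le> M" using True False by simp
      finally show ?thesis .
    qed (use M0 in simp)
    moreover have "M \<le> C_kkl * M" using mult_nonneg_nonneg[OF c0 M0] by (simp add: C_kkl_def distrib_right)
    ultimately show ?thesis by linarith
  next
    case False
    hence n2: "1 < real n" and Ml: "M \<le> 1 / sqrt (real n)" using n1 by auto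
    have "var f \<le> C_infl * (\<Sum>i<n. influence_term f i)" by (rule influence_inequality[OF bool])
    also have "\<dots> \<le> C_infl * (\<Sum>i<n. 4 * N / b\<^sup>2 * M / ln (real n))"
      using C_infl_pos n2 by (intro mult_left_mono sum_mono influence_term_le[OF bool _ M _ Ml]) auto
    also have "\<dots> = C_infl * (4 * N / b\<^sup>2) * M * (real n / ln (real n))" by simp
    finally have "ln (real n) / real n * var f \<le> ln (real n) / real n * (C_infl * (4 * N / b\<^sup>2) * M * (real n / ln (real n)))"
      using n2 by (intro mult_left_mono) auto
    also have "\<dots> = C_infl * (4 * N / b\<^sup>2) * M" using n2 by simp
    also have "\<dots> \<le> C_kkl * M" using M0 by (simp add: C_kkl_def algebra_simps)
    finally show ?thesis .
  qed
qed

end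

section \<open>Variance and entropy tensorization under the Dobrushin condition\<close>

text \<open>
  Conditioning on the coordinates outside a set \<open>I\<close> is expressed by averaging over the fibre of all
  points that agree with \<open>x\<close> outside \<open>I\<close>. The weight is positive but not
  a probability: on a fibre only ratios of sums of it occur.
\<close>

locale cube_weight =
  fixes m n :: nat and \<mu> :: "(nat \<Rightarrow> nat) \<Rightarrow> real"
  assumes \<mu>_pos: "x \<in> cube m n \<Longrightarrow> 0 < \<mu> x"
begin

definition fib :: "nat set \<Rightarrow> (nat \<Rightarrow> nat) \<Rightarrow> (nat \<Rightarrow> nat) set" where
  "fib I x = {z \<in> cube m n. \<forall>l<n. l \<notin> I \<longrightarrow> z l = x l}"

definition mass :: "nat set \<Rightarrow> (nat \<Rightarrow> nat) \<Rightarrow> real" where "mass I x = sum \<mu> (fib I x)"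

definition ce :: "nat set \<Rightarrow> ((nat \<Rightarrow> nat) \<Rightarrow> real) \<Rightarrow> (nat \<Rightarrow> nat) \<Rightarrow> real" where
  "ce I h x = (\<Sum>z\<in>fib I x. \<mu> z * h z) / mass I x"

lemma finite_cube: "finite (cube m n)"
  unfolding cube_def by (intro finite_PiE) auto

lemma finite_fib: "finite (fib I x)"
  unfolding fib_def using finite_cube by simp

lemma fib_refl: "x \<in> cube m n \<Longrightarrow> x \<in> fib I x"
  by (simp add: fib_def)

lemma fib_cube: "z \<in> fib I x \<Longrightarrow> z \<in> cube m n"
  by (simp add: fib_def)

lemma fib_sym: "x \<in> cube m n \<Longrightarrow> z \<in> fib I x \<Longrightarrow> x \<in> fib I z"
  by (auto simp: fib_def)

lemma fib_eq: "z \<in> fib I x \<Longrightarrow> fib I z = fib I x"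
  by (auto simp: fib_def)

lemma fib_mono: "J \<subseteq> I \<Longrightarrow> fib J x \<subseteq> fib I x"
  by (auto simp: fib_def)

lemma fib_trans: "J \<subseteq> I \<Longrightarrow> z \<in> fib I x \<Longrightarrow> w \<in> fib J z \<Longrightarrow> w \<in> fib I x"
  using fib_mono[of J I z] fib_eq[of z I x] by auto

lemma update_cube: "x \<in> cube m n \<Longrightarrow> i < n \<Longrightarrow> a < m \<Longrightarrow> x(i := a) \<in> cube m n"
  by (auto simp: cube_def PiE_iff extensional_def)

lemma update_fib: "z \<in> fib I x \<Longrightarrow> i \<in> I \<Longrightarrow> i < n \<Longrightarrow> a < m \<Longrightarrow> z(i := a) \<in> fib I x"
  by (auto simp: fib_def update_cube)

lemma mass_pos: "x \<in> cube m n \<Longrightarrow> 0 < mass I x"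
  unfolding mass_def by (rule sum_pos2[OF finite_fib fib_refl]) (auto intro: less_imp_le \<mu>_pos fib_cube)

lemma ce_eq: "z \<in> fib I x \<Longrightarrow> ce I h z = ce I h x"
  by (simp add: ce_def mass_def fib_eq)

lemma ce_cong: "(\<And>z. z \<in> fib I x \<Longrightarrow> f z = g z) \<Longrightarrow> ce I f x = ce I g x"
  by (simp add: ce_def cong: sum.cong)

lemma ce_mono:
  assumes "x \<in> cube m n" "\<And>z. z \<in> fib I x \<Longrightarrow> f z \<le> g z"
  shows "ce I f x \<le> ce I g x"
  unfolding ce_def using mass_pos[OF assms(1)]
  by (intro divide_right_mono sum_mono mult_left_mono assms(2)) (auto intro: less_imp_le \<mu>_pos fib_cube)

lemma ce_const: "x \<in> cube m n \<Longrightarrow> ce I (\<lambda>_. c) x = c"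
  using mass_pos[of x I] by (simp add: ce_def mass_def flip: sum_distrib_right)

lemma ce_nonneg: "x \<in> cube m n \<Longrightarrow> (\<And>z. z \<in> fib I x \<Longrightarrow> 0 \<le> f z) \<Longrightarrow> 0 \<le> ce I f x"
  using ce_mono[of x I "\<lambda>_. 0" f] by (simp add: ce_const)

lemma ce_zero:
  assumes "x \<in> cube m n" "\<And>z. z \<in> fib I x \<Longrightarrow> 0 \<le> f z" "ce I f x = 0" "z \<in> fib I x"
  shows "f z = 0"
proof -
  have "(\<Sum>z\<in>fib I x. \<mu> z * f z) = 0" using assms(3) mass_pos[OF assms(1), of I] by (simp add: ce_def)
  moreover have "0 \<le> \<mu> z * f z" if "z \<in> fib I x" for z
    using \<mu>_pos[OF fib_cube[OF that]] assms(2)[OF that] by simp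
  ultimately have "\<mu> z * f z = 0" by (intro sum_nonneg_0[OF finite_fib _ _ assms(4), of "\<lambda>z. \<mu> z * f z"])
  thus ?thesis using \<mu>_pos[OF fib_cube[OF assms(4)]] by simp
qed

lemma ce_add: "ce I (\<lambda>z. f z + g z) x = ce I f x + ce I g x"
  by (simp add: ce_def distrib_left sum.distrib add_divide_distrib)
lemma ce_diff: "ce I (\<lambda>z. f z - g z) x = ce I f x - ce I g x"
  by (simp add: ce_def right_diff_distrib sum_subtractf diff_divide_distrib)
lemma ce_cmult: "ce I (\<lambda>z. c * f z) x = c * ce I f x"
  by (simp add: ce_def sum_distrib_left mult_ac)
lemma ce_sum: "ce I (\<lambda>z. \<Sum>j\<in>J. f j z) x = (\<Sum>j\<in>J. ce I (f j) x)"
  by (simp add: ce_def sum_distrib_left sum.swap[of _ _ J] flip: sum_divide_distrib)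

lemma ce_abs: "x \<in> cube m n \<Longrightarrow> \<bar>ce I f x\<bar> \<le> ce I (\<lambda>z. \<bar>f z\<bar>) x"
  using ce_mono[of x I f "\<lambda>z. \<bar>f z\<bar>"] ce_mono[of x I "\<lambda>z. (- 1) * f z" "\<lambda>z. \<bar>f z\<bar>"]
  by (simp only: ce_cmult) (simp add: abs_le_iff)

text \<open>
  The fibres of \<open>J\<close> partition a fibre of \<open>I\<close>; membership of \<open>w\<close> in the fibre of \<open>z\<close> is symmetric, which
  allows the double sum to be exchanged.
\<close>

lemma ce_tower:
  assumes "J \<subseteq> I" "x \<in> cube m n"
  shows "ce I (ce J h) x = ce I h x"
proof -
  let ?F = "fib I x"
  have "(\<Sum>z\<in>?F. \<mu> z * ce J h z) = (\<Sum>z\<in>?F. \<Sum>w\<in>?F. if w \<in> fib J z then \<mu> z * (\<mu> w * h w) / mass J w else 0)"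
  proof (rule sum.cong[OF refl])
    fix z assume z: "z \<in> ?F"
    have sub: "fib J z \<subseteq> ?F" using fib_trans[OF assms(1) z] by auto
    have "\<mu> z * ce J h z = (\<Sum>w\<in>fib J z. \<mu> z * (\<mu> w * h w) / mass J z)"
      by (simp add: ce_def sum_distrib_left sum_divide_distrib)
    also have "\<dots> = (\<Sum>w\<in>fib J z. \<mu> z * (\<mu> w * h w) / mass J w)"
      by (intro sum.cong refl) (simp add: mass_def fib_eq)
    also have "\<dots> = (\<Sum>w\<in>?F \<inter> fib J z. \<mu> z * (\<mu> w * h w) / mass J w)"
      using sub by (simp add: Int_absorb1)
    finally show "\<mu> z * ce J h z = (\<Sum>w\<in>?F. if w \<in> fib J z then \<mu> z * (\<mu> w * h w) / mass J w else 0)"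
      by (simp add: sum.inter_restrict finite_fib)
  qed
  also have "\<dots> = (\<Sum>w\<in>?F. \<Sum>z\<in>?F. if z \<in> fib J w then \<mu> z * (\<mu> w * h w) / mass J w else 0)"
    by (subst sum.swap) (intro sum.cong refl, metis fib_sym fib_cube)
  also have "\<dots> = (\<Sum>w\<in>?F. \<mu> w * h w)"
  proof (rule sum.cong[OF refl])
    fix w assume w: "w \<in> ?F"
    have sub: "fib J w \<subseteq> ?F" using fib_trans[OF assms(1) w] by auto
    have "(\<Sum>z\<in>?F. if z \<in> fib J w then \<mu> z * (\<mu> w * h w) / mass J w else 0) = (\<Sum>z\<in>fib J w. \<mu> z * (\<mu> w * h w) / mass J w)"
      using sub by (subst sum.inter_restrict[symmetric]) (auto simp: finite_fib Int_absorb1)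
    also have "\<dots> = mass J w * (\<mu> w * h w / mass J w)"
      by (simp add: mass_def sum_distrib_right sum_divide_distrib)
    also have "\<dots> = \<mu> w * h w" using mass_pos[OF fib_cube[OF w], of J] by simp
    finally show "(\<Sum>z\<in>?F. if z \<in> fib J w then \<mu> z * (\<mu> w * h w) / mass J w else 0) = \<mu> w * h w" .
  qed
  finally show ?thesis by (simp add: ce_def)
qed

lemma ce_pull_out:
  assumes "\<And>z. z \<in> fib J x \<Longrightarrow> g z = g x"
  shows "ce J (\<lambda>z. g z * h z) x = g x * ce J h x"
proof -
  have "ce J (\<lambda>z. g z * h z) x = ce J (\<lambda>z. g x * h z) x" by (rule ce_cong) (simp add: assms)
  thus ?thesis by (simp add: ce_cmult)
qed

text \<open>
  Single-site averaging is an orthogonal projection.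
\<close>

lemma ce_orthogonal:
  assumes "i \<in> I" "x \<in> cube m n"
  shows "ce I (\<lambda>z. ce {i} f z * (g z - ce {i} g z)) x = 0"
proof -
  have "ce I (\<lambda>z. ce {i} f z * (g z - ce {i} g z)) x = ce I (ce {i} (\<lambda>z. ce {i} f z * (g z - ce {i} g z))) x"
    using ce_tower[of "{i}" I x] assms by simp
  also have "\<dots> = ce I (\<lambda>_. 0) x"
  proof (rule ce_cong)
    fix z assume z: "z \<in> fib I x"
    have "ce {i} (\<lambda>z. ce {i} f z * (g z - ce {i} g z)) z = ce {i} f z * ce {i} (\<lambda>z. g z - ce {i} g z) z"
      by (rule ce_pull_out) (rule ce_eq)
    also have "ce {i} (\<lambda>z. g z - ce {i} g z) z = 0"
      using ce_tower[of "{i}" "{i}" z g] fib_cube[OF z] by (simp add: ce_diff)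
    finally show "ce {i} (\<lambda>z. ce {i} f z * (g z - ce {i} g z)) z = 0" by simp
  qed
  finally show ?thesis using assms by (simp add: ce_const)
qed

lemma ce_cauchy_schwarz:
  assumes x: "x \<in> cube m n"
  shows "(ce I (\<lambda>z. f z * g z) x)\<^sup>2 \<le> ce I (\<lambda>z. (f z)\<^sup>2) x * ce I (\<lambda>z. (g z)\<^sup>2) x"
proof -
  define u v where "u z = sqrt (\<mu> z) * f z" and "v z = sqrt (\<mu> z) * g z" for z
  have s: "sqrt (\<mu> z) * sqrt (\<mu> z) = \<mu> z" if "z \<in> fib I x" for z
    using \<mu>_pos[OF fib_cube[OF that]] by simp
  have 1: "(\<Sum>z\<in>fib I x. \<mu> z * (f z * g z)) = (\<Sum>z\<in>fib I x. u z * v z)"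
  proof (rule sum.cong[OF refl])
    fix z assume z: "z \<in> fib I x"
    have "u z * v z = (sqrt (\<mu> z) * sqrt (\<mu> z)) * (f z * g z)" by (simp only: u_def v_def mult_ac)
    thus "\<mu> z * (f z * g z) = u z * v z" by (simp only: s[OF z])
  qed
  have 2: "(\<Sum>z\<in>fib I x. \<mu> z * (f z)\<^sup>2) = (\<Sum>z\<in>fib I x. (u z)\<^sup>2)" "(\<Sum>z\<in>fib I x. \<mu> z * (g z)\<^sup>2) = (\<Sum>z\<in>fib I x. (v z)\<^sup>2)"
    unfolding u_def v_def power_mult_distrib by (intro sum.cong refl; simp only: power2_eq_square s)+
  have "(\<Sum>z\<in>fib I x. u z * v z)\<^sup>2 \<le> (\<Sum>z\<in>fib I x. (u z)\<^sup>2) * (\<Sum>z\<in>fib I x. (v z)\<^sup>2)"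
    by (rule Cauchy_Schwarz_ineq_sum)
  thus ?thesis unfolding ce_def 1 2 by (simp add: power_divide power2_eq_square[of "mass I x"] divide_right_mono)
qed

lemma ce_empty: "x \<in> cube m n \<Longrightarrow> ce {} h x = h x"
proof -
  assume x: "x \<in> cube m n"
  have "fib {} x = {x}"
  proof
    show "fib {} x \<subseteq> {x}"
    proof
      fix z assume "z \<in> fib {} x"
      hence "z l = x l" for l
        using x by (cases "l < n") (auto simp: fib_def cube_def PiE_iff extensional_def)
      thus "z \<in> {x}" by auto
    qed
  qed (use x fib_refl in auto)
  thus ?thesis using \<mu>_pos[OF x] by (simp add: ce_def mass_def)
qed

definition cp :: "nat \<Rightarrow> (nat \<Rightarrow> nat) \<Rightarrow> nat \<Rightarrow> real" where
  "cp i x a = \<mu> (x(i := a)) / (\<Sum>c<m. \<mu> (x(i := c)))"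

lemma fib_single:
  assumes "x \<in> cube m n" "i < n"
  shows "bij_betw (\<lambda>a. x(i := a)) {..<m} (fib {i} x)"
proof (rule bij_betwI')
  fix a c assume "a \<in> {..<m}" "c \<in> {..<m}"
  show "(x(i := a) = x(i := c)) = (a = c)" by (auto dest: fun_cong[of _ _ i])
next
  fix a assume "a \<in> {..<m}"
  thus "x(i := a) \<in> fib {i} x" using assms by (auto simp: fib_def update_cube)
next
  fix z assume z: "z \<in> fib {i} x"
  have "z = x(i := z i)"
  proof
    fix l show "z l = (x(i := z i)) l"
      using z assms by (cases "l < n") (auto simp: fib_def cube_def PiE_iff extensional_def)
  qed
  moreover have "z i \<in> {..<m}" using fib_cube[OF z] assms by (auto simp: cube_def)
  ultimately show "\<exists>a\<in>{..<m}. z = x(i := a)" by blast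
qed

lemma ce_single:
  assumes "x \<in> cube m n" "i < n"
  shows "ce {i} h x = (\<Sum>a<m. cp i x a * h (x(i := a)))"
  unfolding ce_def mass_def cp_def
  by (simp add: sum.reindex_bij_betw[OF fib_single[OF assms], symmetric] sum_divide_distrib)

lemma cp_nonneg: "x \<in> cube m n \<Longrightarrow> i < n \<Longrightarrow> a < m \<Longrightarrow> 0 \<le> cp i x a"
  unfolding cp_def by (intro divide_nonneg_nonneg sum_nonneg) (auto intro!: less_imp_le \<mu>_pos update_cube)

lemma cp_sum: "x \<in> cube m n \<Longrightarrow> i < n \<Longrightarrow> (\<Sum>a<m. cp i x a) = 1"
  using ce_single[of x i "\<lambda>_. 1"] by (simp add: ce_const)

end

text \<open>
  The matrix \<open>R\<close> is required to act on oscillations: moving coordinate \<open>j\<close> changes the conditional mean of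
  a function of coordinate \<open>i\<close> by at most \<open>R i j\<close> times its oscillation. This is how a
  bound in total variation is used.
\<close>

locale dobrushin_weight = cube_weight +
  fixes R :: "nat \<Rightarrow> nat \<Rightarrow> real" and \<beta>0 \<delta> :: real
  assumes \<beta>0: "0 < \<beta>0" and cp_lower: "x \<in> cube m n \<Longrightarrow> i < n \<Longrightarrow> a < m \<Longrightarrow> \<beta>0 \<le> cp i x a"
    and \<delta>: "0 < \<delta>" "\<delta> \<le> 1"
    and R_nonneg: "i < n \<Longrightarrow> j < n \<Longrightarrow> 0 \<le> R i j"
    and R_influence: "\<lbrakk>i < n; j < n; x \<in> cube m n; y \<in> cube m n; \<And>l. l < n \<Longrightarrow> l \<noteq> j \<Longrightarrow> x l = y l;
        \<And>a c. a < m \<Longrightarrow> c < m \<Longrightarrow> \<bar>\<psi> a - \<psi> c\<bar> \<le> d\<rbrakk>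
        \<Longrightarrow> \<bar>(\<Sum>a<m. cp i x a * \<psi> a) - (\<Sum>a<m. cp i y a * \<psi> a)\<bar> \<le> R i j * d"
    and R_norm: "L2_set (\<lambda>i. \<Sum>j<n. R i j * v j) {..<n} \<le> (1 - \<delta>) * L2_set v {..<n}"
begin

lemma R_transpose_norm:
  assumes I: "I \<subseteq> {..<n}"
  shows "L2_set (\<lambda>j. \<Sum>i\<in>I. R i j * d i) I \<le> (1 - \<delta>) * L2_set d I"
proof -
  define w where "w j = (\<Sum>i\<in>I. R i j * d i)" for j
  define w0 where "w0 j = (if j \<in> I then w j else 0)" for j
  have fin: "finite I" using I finite_subset by blast
  have L2: "L2_set w0 {..<n} = L2_set w I"
    unfolding L2_set_def w0_def using I
    by (intro arg_cong[where f=sqrt]) (auto intro!: sum.mono_neutral_cong_right)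
  have "(L2_set w I)\<^sup>2 = (\<Sum>j\<in>I. w j * (\<Sum>i\<in>I. R i j * d i))"
    by (simp add: L2_set_def sum_nonneg w_def power2_eq_square)
  also have "\<dots> = (\<Sum>i\<in>I. d i * (\<Sum>j\<in>I. R i j * w j))"
    unfolding sum_distrib_left by (subst sum.swap) (simp add: mult_ac)
  also have "\<dots> = (\<Sum>i\<in>I. d i * (\<Sum>j<n. R i j * w0 j))"
    unfolding w0_def using I
    by (intro sum.cong refl arg_cong2[where f="(*)"] sum.mono_neutral_cong_left) auto
  also have "\<dots> \<le> (\<Sum>i\<in>I. \<bar>d i\<bar> * \<bar>\<Sum>j<n. R i j * w0 j\<bar>)"
    by (intro sum_mono) (simp flip: abs_mult)
  also have "\<dots> \<le> L2_set d I * L2_set (\<lambda>i. \<Sum>j<n. R i j * w0 j) I" by (rule L2_set_mult_ineq)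
  also have "\<dots> \<le> L2_set d I * L2_set (\<lambda>i. \<Sum>j<n. R i j * w0 j) {..<n}"
    using I unfolding L2_set_def by (intro mult_left_mono real_sqrt_le_mono sum_mono2) (auto intro: sum_nonneg)
  also have "\<dots> \<le> L2_set d I * ((1 - \<delta>) * L2_set w I)"
    using R_norm[of w0] by (intro mult_left_mono) (auto simp: L2)
  finally have "L2_set w I * L2_set w I \<le> ((1 - \<delta>) * L2_set d I) * L2_set w I"
    by (simp add: power2_eq_square mult_ac)
  hence "L2_set w I \<le> (1 - \<delta>) * L2_set d I"
    using \<delta> by (cases "L2_set w I = 0") (auto simp: mult_le_cancel_right less_le)
  thus ?thesis by (simp add: w_def[abs_def])
qed

text \<open>
  The vector \<open>d\<close> bounds the oscillations of \<open>F\<close> in the free directions, on a single fibre only.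
\<close>

definition osc_bound :: "nat set \<Rightarrow> (nat \<Rightarrow> nat) \<Rightarrow> ((nat \<Rightarrow> nat) \<Rightarrow> real) \<Rightarrow> (nat \<Rightarrow> real) \<Rightarrow> bool" where
  "osc_bound I x F d \<longleftrightarrow> (\<forall>z\<in>fib I x. \<forall>j\<in>I. \<forall>a<m. \<bar>F (z(j := a)) - F z\<bar> \<le> d j)"

definition glauber :: "nat set \<Rightarrow> ((nat \<Rightarrow> nat) \<Rightarrow> real) \<Rightarrow> (nat \<Rightarrow> nat) \<Rightarrow> real" where
  "glauber I F z = 1 / real (card I) * (\<Sum>i\<in>I. ce {i} F z)"

text \<open>
  How a bound for the oscillations evolves under one step of the Glauber dynamics.
\<close>

definition osc_step :: "nat set \<Rightarrow> (nat \<Rightarrow> real) \<Rightarrow> nat \<Rightarrow> real" where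
  "osc_step I d j = (1 - 1 / real (card I)) * d j + 1 / real (card I) * (\<Sum>i\<in>I. R i j * d i)"

lemma osc_bound_ce:
  assumes I: "I \<subseteq> {..<n}" and x: "x \<in> cube m n" and o: "osc_bound I x F d" and i: "i \<in> I"
    and z: "z \<in> fib I x"
  shows "\<bar>F z - ce {i} F z\<bar> \<le> d i"
proof -
  have zc: "z \<in> cube m n" by (rule fib_cube[OF z])
  have "\<bar>F z - ce {i} F z\<bar> = \<bar>ce {i} (\<lambda>w. F z - F w) z\<bar>" by (simp add: ce_diff ce_const zc)
  also have "\<dots> \<le> ce {i} (\<lambda>w. \<bar>F z - F w\<bar>) z" by (rule ce_abs[OF zc])
  also have "\<dots> \<le> ce {i} (\<lambda>_. d i) z"
  proof (rule ce_mono[OF zc])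
    fix w assume "w \<in> fib {i} z"
    then obtain a where "a < m" "w = z(i := a)"
      using fib_single[of z i] zc i I by (auto simp: bij_betw_def)
    thus "\<bar>F z - F w\<bar> \<le> d i" using o z i by (auto simp: osc_bound_def abs_minus_commute)
  qed
  finally show ?thesis by (simp add: ce_const zc)
qed

text \<open>
  Averaging over coordinate \<open>i\<close> removes the dependence on \<open>i\<close>. For \<open>j \<noteq> i\<close>, moving \<open>j\<close> acts on the argument,
  at cost \<open>d j\<close>, and on the conditional law, at cost \<open>R i j * d i\<close>.
\<close>

lemma osc_bound_glauber:
  assumes I: "I \<subseteq> {..<n}" and x: "x \<in> cube m n" and o: "osc_bound I x F d"
  shows "osc_bound I x (glauber I F) (osc_step I d)"
  unfolding osc_bound_def
proof (intro ballI allI impI)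
  fix z j a assume z: "z \<in> fib I x" and j: "j \<in> I" and a: "a < m"
  have fin: "finite I" using I finite_subset by blast
  have zc: "z \<in> cube m n" by (rule fib_cube[OF z])
  have jn: "j < n" using j I by auto
  define z' where "z' = z(j := a)"
  have z': "z' \<in> fib I x" unfolding z'_def by (rule update_fib[OF z j jn a])
  have z'c: "z' \<in> cube m n" by (rule fib_cube[OF z'])
  have each: "\<bar>ce {i} F z' - ce {i} F z\<bar> \<le> (if i = j then 0 else d j) + R i j * d i" if i: "i \<in> I" for i
  proof (cases "i = j")
    case True
    have "z' \<in> fib {i} z" unfolding z'_def True by (rule update_fib[OF fib_refl[OF zc]]) (use jn a in auto)
    hence "ce {i} F z' = ce {i} F z" by (rule ce_eq)
    moreover have "0 \<le> d j" using o z j a unfolding osc_bound_def by fastforce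
    ultimately show ?thesis using True R_nonneg[of j j] jn by simp
  next
    case False
    have "i < n" using i I by auto
    define \<psi> where "\<psi> c = F (z(i := c))" for c
    have "\<bar>(\<Sum>c<m. cp i z' c * F (z'(i := c))) - (\<Sum>c<m. cp i z' c * \<psi> c)\<bar> \<le> d j"
    proof -
      have "\<bar>(\<Sum>c<m. cp i z' c * F (z'(i := c))) - (\<Sum>c<m. cp i z' c * \<psi> c)\<bar> \<le> (\<Sum>c<m. \<bar>cp i z' c * (F (z'(i := c)) - \<psi> c)\<bar>)"
        unfolding sum_subtractf[symmetric] right_diff_distrib[symmetric] by (rule sum_abs)
      also have "\<dots> \<le> (\<Sum>c<m. cp i z' c * d j)"
      proof (rule sum_mono)
        fix c assume "c \<in> {..<m}"
        hence c: "c < m" by simp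
        have "z'(i := c) = (z(i := c))(j := a)" using False by (auto simp: z'_def)
        moreover have "z(i := c) \<in> fib I x" by (rule update_fib[OF z i \<open>i < n\<close> c])
        ultimately have "\<bar>F (z'(i := c)) - \<psi> c\<bar> \<le> d j"
          using o j a unfolding osc_bound_def \<psi>_def by auto
        thus "\<bar>cp i z' c * (F (z'(i := c)) - \<psi> c)\<bar> \<le> cp i z' c * d j"
          using cp_nonneg[OF z'c \<open>i < n\<close> c] by (simp add: abs_mult mult_left_mono)
      qed
      also have "\<dots> = d j" by (simp add: cp_sum[OF z'c \<open>i < n\<close>] flip: sum_distrib_right)
      finally show ?thesis .
    qed
    moreover have "\<bar>(\<Sum>c<m. cp i z' c * \<psi> c) - (\<Sum>c<m. cp i z c * \<psi> c)\<bar> \<le> R i j * d i"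
    proof (rule R_influence[OF \<open>i < n\<close> jn z'c zc])
      fix c e assume ce: "c < m" "e < m"
      have "z(i := e) \<in> fib I x" by (rule update_fib[OF z i \<open>i < n\<close> ce(2)])
      hence "\<bar>F ((z(i := e))(i := c)) - F (z(i := e))\<bar> \<le> d i" using o i ce unfolding osc_bound_def by blast
      thus "\<bar>\<psi> c - \<psi> e\<bar> \<le> d i" by (simp add: \<psi>_def)
    qed (simp add: z'_def)
    ultimately show ?thesis
      using False by (simp add: ce_single[OF z'c \<open>i < n\<close>] ce_single[OF zc \<open>i < n\<close>] \<psi>_def)
  qed
  have N: "0 < real (card I)" using fin j by (auto simp: card_gt_0_iff)
  have "\<bar>glauber I F z' - glauber I F z\<bar> = 1 / real (card I) * \<bar>\<Sum>i\<in>I. ce {i} F z' - ce {i} F z\<bar>"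
    using N by (simp add: glauber_def sum_subtractf abs_mult flip: diff_divide_distrib)
  also have "\<dots> \<le> 1 / real (card I) * (\<Sum>i\<in>I. (if i = j then 0 else d j) + R i j * d i)"
    by (intro mult_left_mono order_trans[OF sum_abs] sum_mono each) auto
  also have "(\<Sum>i\<in>I. (if i = j then 0 else d j) + R i j * d i) = (real (card I) - 1) * d j + (\<Sum>i\<in>I. R i j * d i)"
  proof -
    have "(\<Sum>i\<in>I. if i = j then 0 else d j) = (\<Sum>i\<in>I. d j - (if i = j then d j else 0))" by (rule sum.cong) auto
    thus ?thesis using fin j by (simp add: sum.distrib sum_subtractf algebra_simps)
  qed
  also have "1 / real (card I) * \<dots> = osc_step I d j" using N by (simp add: osc_step_def field_simps)
  finally show "\<bar>glauber I F (z(j := a)) - glauber I F z\<bar> \<le> osc_step I d j" unfolding z'_def .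
qed

lemma osc_step_norm:
  assumes I: "I \<subseteq> {..<n}" "I \<noteq> {}"
  shows "L2_set (osc_step I d) I \<le> (1 - \<delta> / real (card I)) * L2_set d I"
proof -
  have fin: "finite I" using I finite_subset by blast
  define N where "N = real (card I)"
  have N: "1 \<le> N" using fin I by (simp add: N_def Suc_le_eq card_gt_0_iff)
  have "L2_set (osc_step I d) I \<le> L2_set (\<lambda>j. (1 - 1 / N) * d j) I + L2_set (\<lambda>j. 1 / N * (\<Sum>i\<in>I. R i j * d i)) I"
    unfolding osc_step_def N_def by (rule L2_set_triangle_ineq)
  also have "\<dots> = (1 - 1 / N) * L2_set d I + 1 / N * L2_set (\<lambda>j. \<Sum>i\<in>I. R i j * d i) I"
    using N by (intro arg_cong2[where f="(+)"] L2_set_right_distrib[symmetric]) auto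
  also have "\<dots> \<le> (1 - 1 / N) * L2_set d I + 1 / N * ((1 - \<delta>) * L2_set d I)"
    using N by (intro add_left_mono mult_left_mono R_transpose_norm I) auto
  also have "\<dots> = (1 - \<delta> / N) * L2_set d I" by (simp add: algebra_simps diff_divide_distrib)
  finally show ?thesis by (simp add: N_def)
qed

text \<open>
  Change the coordinates in \<open>I\<close> one at a time.
\<close>

lemma osc_total:
  assumes I: "I \<subseteq> {..<n}" and x: "x \<in> cube m n" and o: "osc_bound I x F d"
    and z: "z \<in> fib I x" and w: "w \<in> fib I x"
  shows "\<bar>F w - F z\<bar> \<le> (\<Sum>j\<in>I. d j)"
proof -
  have fin: "finite I" using I finite_subset by blast
  have "(\<lambda>l. if l \<in> J then w l else z l) \<in> fib I x \<and> \<bar>F (\<lambda>l. if l \<in> J then w l else z l) - F z\<bar> \<le> (\<Sum>j\<in>J. d j)"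
    if "J \<subseteq> I" for J
    using finite_subset[OF that fin] that
  proof (induction J rule: finite_induct)
    case (insert j J)
    let ?u = "\<lambda>l. if l \<in> J then w l else z l"
    have e: "(\<lambda>l. if l \<in> insert j J then w l else z l) = ?u(j := w j)" by auto
    have j: "j \<in> I" "j < n" using insert I by auto
    have a: "w j < m" using fib_cube[OF w] j by (auto simp: cube_def)
    have u: "?u \<in> fib I x" "\<bar>F ?u - F z\<bar> \<le> (\<Sum>j\<in>J. d j)" using insert by auto
    have "?u(j := w j) \<in> fib I x" by (rule update_fib[OF u(1) j a])
    moreover have "\<bar>F (?u(j := w j)) - F ?u\<bar> \<le> d j" using o u(1) j a by (simp add: osc_bound_def)
    ultimately show ?case unfolding e using u(2) insert.hyps by simp
  qed (use z in simp)
  from this[of I] have "\<bar>F (\<lambda>l. if l \<in> I then w l else z l) - F z\<bar> \<le> (\<Sum>j\<in>I. d j)" by simp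
  moreover have "(\<lambda>l. if l \<in> I then w l else z l) = w"
  proof
    fix l show "(if l \<in> I then w l else z l) = w l"
      using z w I by (cases "l < n") (auto simp: fib_def cube_def PiE_iff extensional_def)
  qed
  ultimately show ?thesis by simp
qed

text \<open>
  Telescope \<open>F - E F\<close> along the iterates \<open>G\<^sup>k F\<close> of the Glauber dynamics. A single increment is an average of
  \<open>F - E\<^sub>i F\<close>, tested against \<open>h\<close>; by orthogonality \<open>h\<close> may be replaced by its fluctuation \<open>h - E\<^sub>i h\<close>. The
  oscillations of \<open>G\<^sup>k F\<close> decay geometrically, and the remainder tends to \<open>0\<close>.
\<close>

lemma covariance_bound:
  assumes I: "I \<subseteq> {..<n}" "I \<noteq> {}" and x: "x \<in> cube m n" and o: "osc_bound I x F v"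
  shows "ce I (\<lambda>z. h z * (F z - ce I F x)) x
     \<le> L2_set (\<lambda>i. ce I (\<lambda>z. \<bar>h z - ce {i} h z\<bar>) x) I * L2_set v I / \<delta>"
proof -
  have fin: "finite I" using I finite_subset by blast
  define N where "N = real (card I)"
  have N: "1 \<le> N" using fin I by (simp add: N_def Suc_le_eq card_gt_0_iff)
  define \<tau> where "\<tau> i = ce I (\<lambda>z. \<bar>h z - ce {i} h z\<bar>) x" for i
  have \<tau>0: "0 \<le> \<tau> i" for i unfolding \<tau>_def by (rule ce_nonneg[OF x]) simp
  define G where "G k = (glauber I ^^ k) F" for k
  define d where "d k = (osc_step I ^^ k) v" for k
  have od: "osc_bound I x (G k) (d k)" for k
    by (induction k) (auto simp: G_def d_def o intro!: osc_bound_glauber I x)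
  define r where "r = 1 - \<delta> / N"
  have r: "0 \<le> r" "r < 1"
  proof -
    have "\<delta> / N \<le> 1 / 1" using \<delta> N by (intro frac_le) auto
    thus "0 \<le> r" "r < 1" using \<delta> N by (auto simp: r_def)
  qed
  have dn: "L2_set (d k) I \<le> r ^ k * L2_set v I" for k
  proof (induction k)
    case (Suc k)
    have "L2_set (d (Suc k)) I \<le> r * L2_set (d k) I"
      using osc_step_norm[OF I, of "d k"] by (simp add: d_def r_def N_def)
    also have "\<dots> \<le> r * (r ^ k * L2_set v I)" using r Suc by (intro mult_left_mono) auto
    finally show ?case by simp
  qed (simp add: d_def)
  have mean: "ce I (G k) x = ce I F x" for k
  proof (induction k)
    case (Suc k)
    have GS: "G (Suc k) = (\<lambda>z. 1 / N * (\<Sum>i\<in>I. ce {i} (G k) z))"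
      by (simp add: G_def glauber_def[abs_def] N_def)
    have "ce I (G (Suc k)) x = 1 / N * (\<Sum>i\<in>I. ce I (ce {i} (G k)) x)"
      unfolding GS by (simp only: ce_cmult ce_sum)
    also have "(\<Sum>i\<in>I. ce I (ce {i} (G k)) x) = N * ce I (G k) x"
      by (simp add: ce_tower x N_def)
    finally show ?case using N Suc by simp
  qed (simp add: G_def)
  have step: "ce I (\<lambda>z. h z * (G k z - G (Suc k) z)) x \<le> 1 / N * (L2_set \<tau> I * (r ^ k * L2_set v I))" for k
  proof -
    have "ce I (\<lambda>z. h z * (G k z - G (Suc k) z)) x = ce I (\<lambda>z. 1 / N * (\<Sum>i\<in>I. h z * (G k z - ce {i} (G k) z))) x"
    proof (rule ce_cong)
      fix z
      have e1: "(\<Sum>i\<in>I. h z * (G k z - ce {i} (G k) z)) = N * (h z * G k z) - h z * (\<Sum>i\<in>I. ce {i} (G k) z)"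
        by (simp add: right_diff_distrib sum_subtractf sum_distrib_left N_def)
      have e2: "G (Suc k) z = 1 / N * (\<Sum>i\<in>I. ce {i} (G k) z)" by (simp add: G_def glauber_def N_def)
      show "h z * (G k z - G (Suc k) z) = 1 / N * (\<Sum>i\<in>I. h z * (G k z - ce {i} (G k) z))"
        unfolding e1 e2 using N by (simp add: field_simps)
    qed
    also have "\<dots> = 1 / N * (\<Sum>i\<in>I. ce I (\<lambda>z. h z * (G k z - ce {i} (G k) z)) x)"
      by (simp only: ce_cmult ce_sum)
    also have "\<dots> \<le> 1 / N * (\<Sum>i\<in>I. \<tau> i * d k i)"
    proof (intro mult_left_mono sum_mono)
      fix i assume i: "i \<in> I"
      have "ce I (\<lambda>z. h z * (G k z - ce {i} (G k) z)) x
          = ce I (\<lambda>z. (h z - ce {i} h z) * (G k z - ce {i} (G k) z) + ce {i} h z * (G k z - ce {i} (G k) z)) x"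
        by (rule ce_cong) (simp add: algebra_simps)
      also have "\<dots> = ce I (\<lambda>z. (h z - ce {i} h z) * (G k z - ce {i} (G k) z)) x"
        by (simp only: ce_add ce_orthogonal[OF i x] add_0_right)
      also have "\<dots> \<le> ce I (\<lambda>z. d k i * \<bar>h z - ce {i} h z\<bar>) x"
      proof (rule ce_mono[OF x])
        fix z assume z: "z \<in> fib I x"
        have "\<bar>h z - ce {i} h z\<bar> * \<bar>G k z - ce {i} (G k) z\<bar> \<le> \<bar>h z - ce {i} h z\<bar> * d k i"
          by (intro mult_left_mono osc_bound_ce[OF I(1) x od i z]) auto
        thus "(h z - ce {i} h z) * (G k z - ce {i} (G k) z) \<le> d k i * \<bar>h z - ce {i} h z\<bar>"
          by (simp add: mult.commute flip: abs_mult)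
      qed
      also have "\<dots> = \<tau> i * d k i" by (simp add: ce_cmult \<tau>_def)
      finally show "ce I (\<lambda>z. h z * (G k z - ce {i} (G k) z)) x \<le> \<tau> i * d k i" .
    qed (use N in simp)
    also have "\<dots> \<le> 1 / N * (L2_set \<tau> I * L2_set (d k) I)"
    proof (intro mult_left_mono order_trans[OF _ L2_set_mult_ineq] sum_mono)
      fix i show "\<tau> i * d k i \<le> \<bar>\<tau> i\<bar> * \<bar>d k i\<bar>" by (simp flip: abs_mult)
    qed (use N in simp)
    also have "\<dots> \<le> 1 / N * (L2_set \<tau> I * (r ^ k * L2_set v I))"
      using N by (intro mult_left_mono dn) auto
    finally show ?thesis .
  qed
  have tele: "ce I (\<lambda>z. h z * (F z - G M z)) x \<le> L2_set \<tau> I * L2_set v I / \<delta>" for M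
  proof -
    have "(\<Sum>k<M. G k z - G (Suc k) z) = F z - G M z" for z
      using sum_lessThan_telescope'[of "\<lambda>k. G k z" M] by (simp add: G_def)
    hence "ce I (\<lambda>z. h z * (F z - G M z)) x = ce I (\<lambda>z. \<Sum>k<M. h z * (G k z - G (Suc k) z)) x"
      by (simp flip: sum_distrib_left)
    also have "\<dots> = (\<Sum>k<M. ce I (\<lambda>z. h z * (G k z - G (Suc k) z)) x)" by (rule ce_sum)
    also have "\<dots> \<le> (\<Sum>k<M. 1 / N * (L2_set \<tau> I * (r ^ k * L2_set v I)))" by (intro sum_mono step)
    also have "\<dots> = 1 / N * (L2_set \<tau> I * L2_set v I) * (\<Sum>k<M. r ^ k)"
      unfolding sum_distrib_left by (simp add: mult_ac)
    also have "\<dots> \<le> 1 / N * (L2_set \<tau> I * L2_set v I) * (1 / (1 - r))"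
    proof (intro mult_left_mono)
      have "(\<Sum>k<M. r ^ k) = (1 - r ^ M) / (1 - r)" using r by (simp add: sum_gp_strict)
      also have "\<dots> \<le> 1 / (1 - r)" using r by (intro divide_right_mono) auto
      finally show "(\<Sum>k<M. r ^ k) \<le> 1 / (1 - r)" .
    qed (use N in simp)
    also have "\<dots> = L2_set \<tau> I * L2_set v I / \<delta>" using N \<delta> by (simp add: r_def)
    finally show ?thesis .
  qed
  have rem: "ce I (\<lambda>z. h z * (G M z - ce I F x)) x \<le> ce I (\<lambda>z. \<bar>h z\<bar>) x * (N * (r ^ M * L2_set v I))" for M
  proof -
    have b: "\<bar>G M z - ce I F x\<bar> \<le> N * (r ^ M * L2_set v I)" if z: "z \<in> fib I x" for z
    proof -
      have "\<bar>G M z - ce I (G M) x\<bar> = \<bar>ce I (\<lambda>w. G M z - G M w) x\<bar>" by (simp add: ce_diff ce_const x)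
      also have "\<dots> \<le> ce I (\<lambda>w. \<bar>G M z - G M w\<bar>) x" by (rule ce_abs[OF x])
      also have "\<dots> \<le> ce I (\<lambda>_. \<Sum>j\<in>I. d M j) x"
        by (rule ce_mono[OF x]) (rule osc_total[OF I(1) x od _ z])
      also have "\<dots> = (\<Sum>j\<in>I. d M j)" by (simp add: ce_const x)
      also have "\<dots> \<le> (\<Sum>j\<in>I. L2_set (d M) I)"
        by (intro sum_mono member_le_L2_set fin)
      also have "\<dots> \<le> N * (r ^ M * L2_set v I)"
        using dn[of M] by (simp add: N_def mult_left_mono)
      finally show ?thesis by (simp add: mean)
    qed
    have "ce I (\<lambda>z. h z * (G M z - ce I F x)) x \<le> ce I (\<lambda>z. (N * (r ^ M * L2_set v I)) * \<bar>h z\<bar>) x"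
    proof (rule ce_mono[OF x])
      fix z assume z: "z \<in> fib I x"
      have "h z * (G M z - ce I F x) \<le> \<bar>h z\<bar> * \<bar>G M z - ce I F x\<bar>" by (simp flip: abs_mult)
      also have "\<dots> \<le> \<bar>h z\<bar> * (N * (r ^ M * L2_set v I))" by (intro mult_left_mono b z) auto
      finally show "h z * (G M z - ce I F x) \<le> (N * (r ^ M * L2_set v I)) * \<bar>h z\<bar>" by (simp add: mult.commute)
    qed
    thus ?thesis unfolding ce_cmult by (simp only: mult.commute)
  qed
  have "ce I (\<lambda>z. h z * (F z - ce I F x)) x
      \<le> L2_set \<tau> I * L2_set v I / \<delta> + ce I (\<lambda>z. \<bar>h z\<bar>) x * (N * (r ^ M * L2_set v I))" for M
  proof -
    have "ce I (\<lambda>z. h z * (F z - ce I F x)) x = ce I (\<lambda>z. h z * (F z - G M z) + h z * (G M z - ce I F x)) x"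
      by (rule ce_cong) (simp add: algebra_simps)
    thus ?thesis using tele[of M] rem[of M] by (simp add: ce_add)
  qed
  moreover have "(\<lambda>M. L2_set \<tau> I * L2_set v I / \<delta> + ce I (\<lambda>z. \<bar>h z\<bar>) x * (N * (r ^ M * L2_set v I)))
     \<longlonglongrightarrow> L2_set \<tau> I * L2_set v I / \<delta> + ce I (\<lambda>z. \<bar>h z\<bar>) x * (N * (0 * L2_set v I))"
    using r by (intro tendsto_intros LIMSEQ_power_zero) simp
  ultimately have "ce I (\<lambda>z. h z * (F z - ce I F x)) x \<le> L2_set \<tau> I * L2_set v I / \<delta> + ce I (\<lambda>z. \<bar>h z\<bar>) x * (N * (0 * L2_set v I))"
    by (intro LIMSEQ_le_const) auto
  thus ?thesis by (simp add: \<tau>_def[abs_def])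
qed


text \<open>
  Let \<open>w\<^sub>i\<close> be the conditional expectation of \<open>h\<close> given coordinate \<open>i\<close> (and the frozen coordinates), and
  test \<open>h\<close> against \<open>F\<close>, the sum of the \<open>w\<^sub>i\<close>: the covariance is exactly the sum \<open>SV\<close> of their variances.
  Since \<open>w\<^sub>i\<close> depends on a single free coordinate whose values have probability at least \<open>\<beta>0\<close>, the
  oscillation of \<open>F\<close> in that direction is at most twice the square root of \<open>V\<^sub>i / \<beta>0\<close>. So the covariance
  bound is quadratic in \<open>sqrt SV\<close> on the left and linear on the right.
\<close>

lemma marginal_variance_bound:
  assumes I: "I \<subseteq> {..<n}" "I \<noteq> {}" and x: "x \<in> cube m n"
  shows "(\<Sum>i\<in>I. ce I (\<lambda>z. (ce (I - {i}) h z - ce I h x)\<^sup>2) x)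
     \<le> 4 / (\<beta>0 * \<delta>\<^sup>2) * (\<Sum>i\<in>I. (ce I (\<lambda>z. \<bar>h z - ce {i} h z\<bar>) x)\<^sup>2)"
proof -
  have fin: "finite I" using I finite_subset by blast
  define c where "c = ce I h x"
  define w where "w i = ce (I - {i}) h" for i
  define F where "F z = (\<Sum>i\<in>I. w i z)" for z
  define V where "V i = ce I (\<lambda>z. (w i z - c)\<^sup>2) x" for i
  define \<tau> where "\<tau> i = ce I (\<lambda>z. \<bar>h z - ce {i} h z\<bar>) x" for i
  define v where "v i = 2 * sqrt (V i / \<beta>0)" for i
  have V0: "0 \<le> V i" for i unfolding V_def by (rule ce_nonneg[OF x]) simp
  have sub: "I - {i} \<subseteq> I" for i by auto
  have w_near: "(w i z - c)\<^sup>2 \<le> V i / \<beta>0" if i: "i \<in> I" and z: "z \<in> fib I x" for i z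
  proof -
    define \<psi> where "\<psi> u = (w i u - c)\<^sup>2" for u
    have inn: "i < n" using i I by auto
    have zi: "z i < m" using fib_cube[OF z] inn by (auto simp: cube_def)
    have low: "\<beta>0 * \<psi> z \<le> ce {i} \<psi> u" if u: "u \<in> fib I x" for u
    proof -
      have uc: "u \<in> cube m n" by (rule fib_cube[OF u])
      have "u(i := z i) \<in> fib (I - {i}) z" using update_fib[OF u i inn zi] z by (auto simp: fib_def)
      hence e: "\<psi> (u(i := z i)) = \<psi> z" unfolding \<psi>_def w_def by (simp add: ce_eq)
      have "\<beta>0 * \<psi> z \<le> cp i u (z i) * \<psi> (u(i := z i))"
        unfolding e using cp_lower[OF uc inn zi] by (intro mult_right_mono) (auto simp: \<psi>_def)
      also have "\<dots> \<le> (\<Sum>a<m. cp i u a * \<psi> (u(i := a)))"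
        using zi cp_nonneg[OF uc inn]
        by (intro member_le_sum[of _ _ "\<lambda>a. cp i u a * \<psi> (u(i := a))"]) (auto simp: \<psi>_def)
      also have "\<dots> = ce {i} \<psi> u" by (simp add: ce_single uc inn)
      finally show ?thesis .
    qed
    have "\<beta>0 * \<psi> z = ce I (\<lambda>_. \<beta>0 * \<psi> z) x" by (simp add: ce_const x)
    also have "\<dots> \<le> ce I (ce {i} \<psi>) x" by (rule ce_mono[OF x low])
    also have "\<dots> = V i" using ce_tower[of "{i}" I x \<psi>] i x by (simp add: V_def \<psi>_def[abs_def])
    finally show ?thesis using \<beta>0 by (simp add: \<psi>_def field_simps)
  qed
  have o: "osc_bound I x F v"
    unfolding osc_bound_def
  proof (intro ballI allI impI)
    fix z j a assume z: "z \<in> fib I x" and j: "j \<in> I" and a: "a < m"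
    have jn: "j < n" using j I by auto
    have z': "z(j := a) \<in> fib I x" by (rule update_fib[OF z j jn a])
    have same: "w i (z(j := a)) = w i z" if "i \<in> I" "i \<noteq> j" for i
      unfolding w_def
      by (rule ce_eq, rule update_fib[OF fib_refl[OF fib_cube[OF z]]]) (use that j jn a in auto)
    have "F (z(j := a)) - F z = (\<Sum>i\<in>I. if i = j then w j (z(j := a)) - w j z else 0)"
      unfolding F_def sum_subtractf[symmetric] by (rule sum.cong) (auto simp: same)
    also have "\<dots> = (w j (z(j := a)) - c) - (w j z - c)" using fin j by simp
    finally have "\<bar>F (z(j := a)) - F z\<bar> \<le> \<bar>w j (z(j := a)) - c\<bar> + \<bar>w j z - c\<bar>" by linarith
    also have "\<dots> \<le> sqrt (V j / \<beta>0) + sqrt (V j / \<beta>0)"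
      using real_sqrt_le_mono[OF w_near[OF j z]] real_sqrt_le_mono[OF w_near[OF j z']] by simp
    finally show "\<bar>F (z(j := a)) - F z\<bar> \<le> v j" by (simp add: v_def)
  qed
  have wc: "ce I (w i) x = c" if "i \<in> I" for i
    unfolding w_def c_def by (rule ce_tower[OF sub x])
  have FI: "ce I F x = real (card I) * c"
    unfolding F_def[abs_def] ce_sum by (simp add: wc)
  have Vh: "V i = ce I (\<lambda>z. h z * (w i z - c)) x" if i: "i \<in> I" for i
  proof -
    have "ce I (\<lambda>z. h z * (w i z - c)) x = ce I (ce (I - {i}) (\<lambda>z. h z * (w i z - c))) x"
      by (rule ce_tower[OF sub x, symmetric])
    also have "\<dots> = ce I (\<lambda>z. (w i z - c) * w i z) x"
    proof (rule ce_cong)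
      fix z
      have "ce (I - {i}) (\<lambda>z. (w i z - c) * h z) z = (w i z - c) * ce (I - {i}) h z"
        by (rule ce_pull_out) (simp add: w_def ce_eq)
      thus "ce (I - {i}) (\<lambda>z. h z * (w i z - c)) z = (w i z - c) * w i z"
        by (simp add: w_def mult.commute)
    qed
    also have "\<dots> = ce I (\<lambda>z. (w i z - c)\<^sup>2 + c * (w i z - c)) x"
      by (rule ce_cong) (simp add: power2_eq_square algebra_simps)
    also have "\<dots> = V i"
      by (simp only: ce_add ce_cmult ce_diff wc[OF i] ce_const[OF x] V_def) simp
    finally show ?thesis by simp
  qed
  define T where "T = (\<Sum>i\<in>I. (\<tau> i)\<^sup>2)"
  define SV where "SV = (\<Sum>i\<in>I. V i)"
  have SV0: "0 \<le> SV" and T0: "0 \<le> T" unfolding SV_def T_def by (auto intro!: sum_nonneg V0)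
  have "SV = ce I (\<lambda>z. h z * (F z - ce I F x)) x"
  proof -
    have "SV = ce I (\<lambda>z. \<Sum>i\<in>I. h z * (w i z - c)) x"
      unfolding SV_def ce_sum by (intro sum.cong refl Vh)
    also have "\<dots> = ce I (\<lambda>z. h z * (F z - ce I F x)) x"
      unfolding FI F_def by (rule ce_cong) (simp add: sum_subtractf sum_distrib_left right_diff_distrib mult_ac)
    finally show ?thesis .
  qed
  also have "\<dots> \<le> L2_set \<tau> I * L2_set v I / \<delta>"
    unfolding \<tau>_def[abs_def] by (rule covariance_bound[OF I x o])
  also have "L2_set v I = 2 * sqrt (SV / \<beta>0)"
  proof -
    have "L2_set v I = 2 * L2_set (\<lambda>i. sqrt (V i / \<beta>0)) I"
      unfolding v_def by (rule L2_set_right_distrib[symmetric]) simp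
    also have "L2_set (\<lambda>i. sqrt (V i / \<beta>0)) I = sqrt (SV / \<beta>0)"
      unfolding L2_set_def SV_def using V0 \<beta>0 by (simp add: sum_divide_distrib)
    finally show ?thesis .
  qed
  also have "L2_set \<tau> I = sqrt T" by (simp add: L2_set_def T_def)
  finally have le: "SV \<le> sqrt T * (2 * sqrt (SV / \<beta>0)) / \<delta>" .
  have "SV \<le> 4 / (\<beta>0 * \<delta>\<^sup>2) * T"
  proof (cases "SV = 0")
    case False
    hence "0 < SV" using SV0 by simp
    have "SV\<^sup>2 \<le> (sqrt T * (2 * sqrt (SV / \<beta>0)) / \<delta>)\<^sup>2" using le SV0 by (rule power_mono)
    also have "\<dots> = 4 / (\<beta>0 * \<delta>\<^sup>2) * T * SV"
      using T0 SV0 \<beta>0 by (simp add: power_divide power_mult_distrib)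
    finally have "SV * SV \<le> 4 / (\<beta>0 * \<delta>\<^sup>2) * T * SV" by (simp only: power2_eq_square[of SV])
    thus ?thesis using \<open>0 < SV\<close> by (rule mult_right_le_imp_le)
  qed (use T0 \<beta>0 in simp)
  thus ?thesis by (simp add: SV_def T_def V_def \<tau>_def w_def c_def)
qed

text \<open>
  If the chain rule, averaged over the coordinate exposed first, costs \<open>C\<close> times the total of the
  single-site terms, then the induction closes with the same constant: the \<open>i\<close>-th hypothesis omits the
  \<open>i\<close>-th term, so that the average over \<open>i\<close> leaves room for exactly this cost.
\<close>

lemma tensorization_induction:
  assumes empty: "\<And>x. x \<in> cube m n \<Longrightarrow> \<Psi> {} x \<le> 0"
    and step: "\<And>I x. I \<subseteq> {..<n} \<Longrightarrow> I \<noteq> {} \<Longrightarrow> x \<in> cube m n \<Longrightarrow>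
      real (card I) * \<Psi> I x \<le> (\<Sum>i\<in>I. ce I (\<Psi> (I - {i})) x) + C * (\<Sum>i\<in>I. ce I (T i) x)"
    and "I \<subseteq> {..<n}" "x \<in> cube m n"
  shows "\<Psi> I x \<le> C * (\<Sum>i\<in>I. ce I (T i) x)"
  using assms(3,4)
proof (induction "card I" arbitrary: I x)
  case 0
  hence "I = {}" using finite_subset[of I "{..<n}"] by simp
  thus ?case using empty[OF 0(3)] by simp
next
  case (Suc N)
  have fin: "finite I" using Suc.prems finite_subset by blast
  have ne: "I \<noteq> {}" using Suc.hyps(2) by auto
  let ?t = "\<lambda>j. ce I (T j) x"
  have "ce I (\<Psi> (I - {i})) x \<le> C * (\<Sum>j\<in>I - {i}. ?t j)" if i: "i \<in> I" for i
  proof -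
    have "ce I (\<Psi> (I - {i})) x \<le> ce I (\<lambda>z. C * (\<Sum>j\<in>I - {i}. ce (I - {i}) (T j) z)) x"
    proof (rule ce_mono[OF Suc.prems(2)])
      fix z assume "z \<in> fib I x"
      thus "\<Psi> (I - {i}) z \<le> C * (\<Sum>j\<in>I - {i}. ce (I - {i}) (T j) z)"
        using Suc.hyps(2) Suc.prems i fin by (intro Suc.hyps(1)) (auto simp: fib_cube)
    qed
    also have "\<dots> = C * (\<Sum>j\<in>I - {i}. ce I (ce (I - {i}) (T j)) x)"
      by (simp only: ce_cmult ce_sum)
    also have "\<dots> = C * (\<Sum>j\<in>I - {i}. ?t j)"
      using ce_tower[of "I - {i}" I x] Suc.prems by simp
    finally show ?thesis .
  qed
  hence "(\<Sum>i\<in>I. ce I (\<Psi> (I - {i})) x) \<le> (\<Sum>i\<in>I. C * (\<Sum>j\<in>I - {i}. ?t j))" by (rule sum_mono)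
  also have "\<dots> = C * (\<Sum>i\<in>I. (\<Sum>j\<in>I. ?t j) - ?t i)"
    unfolding sum_distrib_left[symmetric] using fin by (simp add: sum_diff1)
  also have "\<dots> = C * ((real (card I) - 1) * (\<Sum>j\<in>I. ?t j))"
    by (simp add: sum_subtractf algebra_simps)
  finally have "real (card I) * \<Psi> I x \<le> real (card I) * (C * (\<Sum>j\<in>I. ?t j))"
    using step[OF Suc.prems(1) ne Suc.prems(2)] by (simp add: algebra_simps)
  thus ?case using fin ne by (simp add: mult_le_cancel_left card_gt_0_iff)
qed

definition Var1 :: "nat \<Rightarrow> ((nat \<Rightarrow> nat) \<Rightarrow> real) \<Rightarrow> (nat \<Rightarrow> nat) \<Rightarrow> real" where
  "Var1 i g z = (g z - ce {i} g z)\<^sup>2"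

lemma site_L1_le_variance:
  assumes "x \<in> cube m n"
  shows "(ce I (\<lambda>z. \<bar>h z - ce {i} h z\<bar>) x)\<^sup>2 \<le> ce I (Var1 i h) x"
  using ce_cauchy_schwarz[OF assms, of I "\<lambda>z. 1" "\<lambda>z. \<bar>h z - ce {i} h z\<bar>"]
  by (simp add: ce_const assms Var1_def[abs_def])

theorem variance_tensorization:
  assumes "I \<subseteq> {..<n}" "x \<in> cube m n"
  shows "ce I (\<lambda>z. (h z)\<^sup>2) x - (ce I h x)\<^sup>2 \<le> 4 / (\<beta>0 * \<delta>\<^sup>2) * (\<Sum>i\<in>I. ce I (Var1 i h) x)"
proof (rule tensorization_induction[where \<Psi>="\<lambda>I x. ce I (\<lambda>z. (h z)\<^sup>2) x - (ce I h x)\<^sup>2", OF _ _ assms])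
  fix I x assume I: "I \<subseteq> {..<n}" "I \<noteq> {}" and x: "x \<in> cube m n"
  let ?\<Psi> = "\<lambda>I x. ce I (\<lambda>z. (h z)\<^sup>2) x - (ce I h x)\<^sup>2"
  have chain: "?\<Psi> I x = ce I (?\<Psi> (I - {i})) x + ce I (\<lambda>z. (ce (I - {i}) h z - ce I h x)\<^sup>2) x" for i
  proof -
    let ?w = "ce (I - {i}) h"
    have w: "ce I ?w x = ce I h x" by (rule ce_tower[OF _ x]) auto
    have "ce I (\<lambda>z. (?w z - ce I h x)\<^sup>2) x = ce I (\<lambda>z. (?w z)\<^sup>2 - 2 * ce I h x * ?w z + (ce I h x)\<^sup>2) x"
      by (rule ce_cong) (simp add: power2_diff)
    also have "\<dots> = ce I (\<lambda>z. (?w z)\<^sup>2) x - (ce I h x)\<^sup>2"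
      by (simp only: ce_add ce_diff ce_cmult w ce_const[OF x]) (simp add: power2_eq_square)
    finally show ?thesis
      using ce_tower[of "I - {i}" I x "\<lambda>z. (h z)\<^sup>2"] x by (simp add: ce_diff)
  qed
  have "(\<Sum>i\<in>I. ce I (\<lambda>z. (ce (I - {i}) h z - ce I h x)\<^sup>2) x)
     \<le> 4 / (\<beta>0 * \<delta>\<^sup>2) * (\<Sum>i\<in>I. (ce I (\<lambda>z. \<bar>h z - ce {i} h z\<bar>) x)\<^sup>2)"
    by (rule marginal_variance_bound[OF I x])
  also have "\<dots> \<le> 4 / (\<beta>0 * \<delta>\<^sup>2) * (\<Sum>i\<in>I. ce I (Var1 i h) x)"
    by (intro mult_left_mono sum_mono site_L1_le_variance[OF x]) (use \<beta>0 in simp)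
  finally have V: "(\<Sum>i\<in>I. ce I (\<lambda>z. (ce (I - {i}) h z - ce I h x)\<^sup>2) x) \<le> 4 / (\<beta>0 * \<delta>\<^sup>2) * (\<Sum>i\<in>I. ce I (Var1 i h) x)" .
  have "real (card I) * ?\<Psi> I x = (\<Sum>i\<in>I. ce I (?\<Psi> (I - {i})) x) + (\<Sum>i\<in>I. ce I (\<lambda>z. (ce (I - {i}) h z - ce I h x)\<^sup>2) x)"
    unfolding sum.distrib[symmetric] chain[symmetric] by simp
  with V show "real (card I) * ?\<Psi> I x \<le> (\<Sum>i\<in>I. ce I (?\<Psi> (I - {i})) x) + 4 / (\<beta>0 * \<delta>\<^sup>2) * (\<Sum>i\<in>I. ce I (Var1 i h) x)"
    by linarith
qed (simp add: ce_empty)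

lemma ce_variance_le:
  assumes "z \<in> cube m n"
  shows "ce {i} (Var1 i g) z = ce {i} (\<lambda>w. (g w)\<^sup>2) z - (ce {i} g z)\<^sup>2"
proof -
  have "ce {i} (Var1 i g) z = ce {i} (\<lambda>w. (g w)\<^sup>2 - 2 * ce {i} g z * g w + (ce {i} g z)\<^sup>2) z"
    by (rule ce_cong) (simp add: Var1_def ce_eq power2_diff)
  thus ?thesis by (simp only: ce_add ce_diff ce_cmult ce_const[OF assms]) (simp add: power2_eq_square)
qed

text \<open>
  Factor \<open>g\<^sup>2 - (E\<^sub>i g)\<^sup>2 = (g - E\<^sub>i g) (g + E\<^sub>i g)\<close> and apply the Cauchy-Schwarz inequality; the
  difference between \<open>(E\<^sub>i g)\<^sup>2\<close> and \<open>E\<^sub>i (g\<^sup>2)\<close> is a conditional variance, which is absorbed.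
\<close>

lemma site_L1_of_square:
  assumes x: "x \<in> cube m n" and g: "\<And>z. z \<in> cube m n \<Longrightarrow> 0 \<le> g z" and i: "i \<in> I"
  shows "(ce I (\<lambda>z. \<bar>(g z)\<^sup>2 - ce {i} (\<lambda>z. (g z)\<^sup>2) z\<bar>) x)\<^sup>2 \<le> 9 * (ce I (\<lambda>z. (g z)\<^sup>2) x * ce I (Var1 i g) x)"
proof -
  let ?m = "ce {i} g" and ?h = "\<lambda>z. (g z)\<^sup>2"
  define c where "c = ce I ?h x"
  define V where "V = ce I (Var1 i g) x"
  have sub: "{i} \<subseteq> I" using i by simp
  have V0: "0 \<le> V" unfolding V_def by (rule ce_nonneg[OF x]) (simp add: Var1_def)
  have c0: "0 \<le> c" unfolding c_def by (rule ce_nonneg[OF x]) simp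
  have m_sq: "ce I (\<lambda>z. (?m z)\<^sup>2) x \<le> c" and Vc: "V \<le> c"
  proof -
    have V_eq: "V = ce I (\<lambda>z. ce {i} ?h z - (?m z)\<^sup>2) x"
      unfolding V_def ce_tower[OF sub x, of "Var1 i g", symmetric]
      by (rule ce_cong) (simp add: ce_variance_le fib_cube)
    have "V = c - ce I (\<lambda>z. (?m z)\<^sup>2) x"
      unfolding V_eq c_def by (simp only: ce_diff ce_tower[OF sub x])
    moreover have "0 \<le> ce I (\<lambda>z. (?m z)\<^sup>2) x" by (rule ce_nonneg[OF x]) simp
    ultimately show "ce I (\<lambda>z. (?m z)\<^sup>2) x \<le> c" "V \<le> c" using V0 by auto
  qed
  have "ce I (\<lambda>z. \<bar>?h z - ce {i} ?h z\<bar>) x \<le> ce I (\<lambda>z. \<bar>g z - ?m z\<bar> * (g z + ?m z) + ce {i} (Var1 i g) z) x"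
  proof (rule ce_mono[OF x])
    fix z assume z: "z \<in> fib I x"
    have zc: "z \<in> cube m n" by (rule fib_cube[OF z])
    have m0: "0 \<le> ?m z" by (rule ce_nonneg[OF zc]) (rule g, rule fib_cube)
    have v0: "0 \<le> ce {i} (Var1 i g) z" by (rule ce_nonneg[OF zc]) (simp add: Var1_def)
    have "?h z - ce {i} ?h z = (g z - ?m z) * (g z + ?m z) - ce {i} (Var1 i g) z"
      by (simp add: ce_variance_le[OF zc] power2_eq_square algebra_simps)
    hence "\<bar>?h z - ce {i} ?h z\<bar> \<le> \<bar>(g z - ?m z) * (g z + ?m z)\<bar> + ce {i} (Var1 i g) z" using v0 by linarith
    thus "\<bar>?h z - ce {i} ?h z\<bar> \<le> \<bar>g z - ?m z\<bar> * (g z + ?m z) + ce {i} (Var1 i g) z"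
      using m0 g[OF zc] by (simp add: abs_mult)
  qed
  also have "\<dots> = ce I (\<lambda>z. \<bar>g z - ?m z\<bar> * (g z + ?m z)) x + V"
    unfolding V_def by (simp only: ce_add ce_tower[OF sub x])
  also have "\<dots> \<le> 2 * sqrt (c * V) + sqrt (c * V)"
  proof (rule add_mono)
    have "(ce I (\<lambda>z. \<bar>g z - ?m z\<bar> * (g z + ?m z)) x)\<^sup>2 \<le> ce I (\<lambda>z. \<bar>g z - ?m z\<bar>\<^sup>2) x * ce I (\<lambda>z. (g z + ?m z)\<^sup>2) x"
      by (rule ce_cauchy_schwarz[OF x])
    also have "ce I (\<lambda>z. \<bar>g z - ?m z\<bar>\<^sup>2) x = V" by (simp add: V_def Var1_def[abs_def])
    also have "V * ce I (\<lambda>z. (g z + ?m z)\<^sup>2) x \<le> V * (4 * c)"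
    proof (rule mult_left_mono[OF _ V0])
      have "ce I (\<lambda>z. (g z + ?m z)\<^sup>2) x \<le> ce I (\<lambda>z. 2 * ?h z + 2 * (?m z)\<^sup>2) x"
      proof (rule ce_mono[OF x])
        fix z
        have "0 \<le> (g z - ?m z)\<^sup>2" by simp
        thus "(g z + ?m z)\<^sup>2 \<le> 2 * ?h z + 2 * (?m z)\<^sup>2" by (simp add: power2_eq_square algebra_simps)
      qed
      also have "\<dots> \<le> 4 * c" using m_sq by (simp add: ce_add ce_cmult c_def)
      finally show "ce I (\<lambda>z. (g z + ?m z)\<^sup>2) x \<le> 4 * c" .
    qed
    finally have "(ce I (\<lambda>z. \<bar>g z - ?m z\<bar> * (g z + ?m z)) x)\<^sup>2 \<le> V * (4 * c)" .
    hence "ce I (\<lambda>z. \<bar>g z - ?m z\<bar> * (g z + ?m z)) x \<le> sqrt (V * (4 * c))" by (rule real_le_rsqrt)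
    also have "sqrt (V * (4 * c)) = 2 * sqrt (c * V)" by (simp add: real_sqrt_mult)
    finally show "ce I (\<lambda>z. \<bar>g z - ?m z\<bar> * (g z + ?m z)) x \<le> 2 * sqrt (c * V)" .
    have "V * V \<le> c * V" using Vc V0 by (intro mult_right_mono)
    thus "V \<le> sqrt (c * V)" by (intro real_le_rsqrt) (simp add: power2_eq_square)
  qed
  finally have le: "ce I (\<lambda>z. \<bar>?h z - ce {i} ?h z\<bar>) x \<le> 3 * sqrt (c * V)" by simp
  have "0 \<le> ce I (\<lambda>z. \<bar>?h z - ce {i} ?h z\<bar>) x" by (rule ce_nonneg[OF x]) simp
  from power_mono[OF le this, of 2] show ?thesis
    using c0 V0 by (simp add: power_mult_distrib c_def V_def)
qed

text \<open>
  The entropy of a marginal is at most its variance divided by its mean \<open>c\<close>. By \<open>site_L1_of_square\<close> the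
  marginal variances carry a factor \<open>c\<close> as well, so the mean cancels. If \<open>c = 0\<close> then \<open>g\<close> vanishes
  on the fibre.
\<close>

theorem log_sobolev_tensorization:
  assumes g: "\<And>z. z \<in> cube m n \<Longrightarrow> 0 \<le> g z" and "I \<subseteq> {..<n}" "x \<in> cube m n"
  shows "ce I (\<lambda>z. (g z)\<^sup>2 * ln ((g z)\<^sup>2)) x - ce I (\<lambda>z. (g z)\<^sup>2) x * ln (ce I (\<lambda>z. (g z)\<^sup>2) x)
    \<le> 36 / (\<beta>0 * \<delta>\<^sup>2) * (\<Sum>i\<in>I. ce I (Var1 i g) x)"
proof -
  define h where "h z = (g z)\<^sup>2" for z
  define \<Psi> where "\<Psi> I x = ce I (\<lambda>z. h z * ln (h z)) x - ce I h x * ln (ce I h x)" for I x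
  have "\<Psi> I x \<le> 36 / (\<beta>0 * \<delta>\<^sup>2) * (\<Sum>i\<in>I. ce I (Var1 i g) x)"
  proof (rule tensorization_induction[where \<Psi>=\<Psi>, OF _ _ assms(2,3)])
    fix I x assume I: "I \<subseteq> {..<n}" "I \<noteq> {}" and x: "x \<in> cube m n"
    define c where "c = ce I h x"
    let ?w = "\<lambda>i. ce (I - {i}) h"
    let ?V = "\<lambda>i. ce I (\<lambda>z. (?w i z - ce I h x)\<^sup>2) x"
    have c0: "0 \<le> c" unfolding c_def by (rule ce_nonneg[OF x]) (simp add: h_def)
    have chain: "\<Psi> I x = ce I (\<Psi> (I - {i})) x + (ce I (\<lambda>z. ?w i z * ln (?w i z)) x - c * ln c)" for i
    proof -
      have "ce I (\<Psi> (I - {i})) x = ce I (ce (I - {i}) (\<lambda>z. h z * ln (h z))) x - ce I (\<lambda>z. ?w i z * ln (?w i z)) x"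
        unfolding \<Psi>_def[abs_def] by (rule ce_diff)
      also have "ce I (ce (I - {i}) (\<lambda>z. h z * ln (h z))) x = ce I (\<lambda>z. h z * ln (h z)) x"
        by (rule ce_tower[OF _ x]) auto
      finally show ?thesis unfolding \<Psi>_def[of I x] c_def by simp
    qed
    have ent: "c * (ce I (\<lambda>z. ?w i z * ln (?w i z)) x - c * ln c) \<le> ?V i" for i
    proof -
      have w: "ce I (?w i) x = c" unfolding c_def by (rule ce_tower[OF _ x]) auto
      have w0: "0 \<le> ?w i z" if "z \<in> fib I x" for z
        by (rule ce_nonneg[OF fib_cube[OF that]]) (simp add: h_def)
      have "ce I (\<lambda>z. c * (?w i z * ln (?w i z))) x \<le> ce I (\<lambda>z. (c * ln c + c) * ?w i z + ((?w i z - c)\<^sup>2 - c * c)) x"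
      proof (rule ce_mono[OF x])
        fix z assume z: "z \<in> fib I x"
        show "c * (?w i z * ln (?w i z)) \<le> (c * ln c + c) * ?w i z + ((?w i z - c)\<^sup>2 - c * c)"
        proof (cases "c = 0 \<or> ?w i z = 0")
          case True
          thus ?thesis using w0[OF z] by (auto simp: power2_eq_square)
        next
          case False
          hence p: "0 < c" "0 < ?w i z" using c0 w0[OF z] by auto
          have "ln (?w i z / c) \<le> ?w i z / c - 1" using p by (intro ln_le_minus_one) simp
          hence "ln (?w i z) \<le> ln c + ?w i z / c - 1" using p by (simp add: ln_div)
          hence "(c * ?w i z) * ln (?w i z) \<le> (c * ?w i z) * (ln c + ?w i z / c - 1)"
            using p by (intro mult_left_mono) auto
          also have "\<dots> = (c * ln c + c) * ?w i z + ((?w i z - c)\<^sup>2 - c * c)"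
            using p by (simp add: field_simps power2_eq_square)
          finally show ?thesis by (simp add: mult_ac)
        qed
      qed
      hence "c * ce I (\<lambda>z. ?w i z * ln (?w i z)) x \<le> (c * ln c + c) * c + (ce I (\<lambda>z. (?w i z - c)\<^sup>2) x - c * c)"
        by (simp only: ce_add ce_diff ce_cmult w ce_const[OF x])
      thus ?thesis by (simp add: c_def[symmetric] algebra_simps)
    qed
    define e where "e i = ce I (\<lambda>z. ?w i z * ln (?w i z)) x - c * ln c" for i
    have "(\<Sum>i\<in>I. e i) \<le> 36 / (\<beta>0 * \<delta>\<^sup>2) * (\<Sum>i\<in>I. ce I (Var1 i g) x)"
    proof (cases "c = 0")
      case True
      have h0: "h z = 0" if z: "z \<in> fib I x" for z
        using ce_zero[OF x _ True[unfolded c_def] z] by (simp add: h_def)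
      have "e i = 0" for i
      proof -
        have "?w i z * ln (?w i z) = 0" if z: "z \<in> fib I x" for z
        proof -
          have "?w i z = ce (I - {i}) (\<lambda>_. 0) z"
            by (rule ce_cong) (use z in \<open>auto intro!: h0 fib_trans[of "I - {i}" I z x]\<close>)
          thus ?thesis by (simp add: ce_const fib_cube[OF z])
        qed
        hence "ce I (\<lambda>z. ?w i z * ln (?w i z)) x = ce I (\<lambda>_. 0) x" by (rule ce_cong)
        thus ?thesis by (simp add: e_def True ce_const x)
      qed
      moreover have "0 \<le> ce I (Var1 i g) x" for i by (rule ce_nonneg[OF x]) (simp add: Var1_def)
      ultimately show ?thesis using \<beta>0 by (simp add: sum_nonneg)
    next
      case False
      hence c: "0 < c" using c0 by simp
      have "c * (\<Sum>i\<in>I. e i) \<le> (\<Sum>i\<in>I. ?V i)"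
        unfolding sum_distrib_left e_def by (intro sum_mono ent)
      also have "\<dots> \<le> 4 / (\<beta>0 * \<delta>\<^sup>2) * (\<Sum>i\<in>I. (ce I (\<lambda>z. \<bar>h z - ce {i} h z\<bar>) x)\<^sup>2)"
        by (rule marginal_variance_bound[OF I x])
      also have "\<dots> \<le> 4 / (\<beta>0 * \<delta>\<^sup>2) * (\<Sum>i\<in>I. 9 * (c * ce I (Var1 i g) x))"
        unfolding c_def h_def using \<beta>0 by (intro mult_left_mono sum_mono site_L1_of_square x g) auto
      also have "\<dots> = c * (36 / (\<beta>0 * \<delta>\<^sup>2) * (\<Sum>i\<in>I. ce I (Var1 i g) x))"
        by (simp add: mult_ac flip: sum_distrib_left)
      finally show ?thesis using c by (rule mult_left_le_imp_le)
    qed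
    moreover have "real (card I) * \<Psi> I x = (\<Sum>i\<in>I. ce I (\<Psi> (I - {i})) x) + (\<Sum>i\<in>I. e i)"
      unfolding sum.distrib[symmetric] e_def chain[symmetric] by simp
    ultimately show "real (card I) * \<Psi> I x \<le> (\<Sum>i\<in>I. ce I (\<Psi> (I - {i})) x) + 36 / (\<beta>0 * \<delta>\<^sup>2) * (\<Sum>i\<in>I. ce I (Var1 i g) x)"
      by simp
  qed (simp add: \<Psi>_def ce_empty)
  thus ?thesis unfolding \<Psi>_def h_def[abs_def] .
qed

end

section \<open>Weights satisfying the hypotheses of the theorem\<close>

lemma tv_dist_bdd: "bdd_above (range (\<lambda>A. \<bar>measure_pmf.prob p A - measure_pmf.prob q A\<bar>))"
proof (rule bdd_aboveI2)
  fix A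
  show "\<bar>measure_pmf.prob p A - measure_pmf.prob q A\<bar> \<le> 1"
    using measure_pmf.prob_le_1[of p A] measure_pmf.prob_le_1[of q A]
      measure_nonneg[of "measure_pmf p" A] measure_nonneg[of "measure_pmf q" A] by (simp only: abs_le_iff) linarith
qed

lemma tv_dist_ge: "\<bar>measure_pmf.prob p A - measure_pmf.prob q A\<bar> \<le> tv_dist p q"
  unfolding tv_dist_def by (rule cSUP_upper[OF UNIV_I tv_dist_bdd])

lemma tv_dist_nonneg: "0 \<le> tv_dist p q"
  using tv_dist_ge[of p "{}" q] by simp

lemma tv_dist_le_1: "tv_dist p q \<le> 1"
  unfolding tv_dist_def
proof (rule cSUP_least)
  fix A
  show "\<bar>measure_pmf.prob p A - measure_pmf.prob q A\<bar> \<le> 1"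
    using measure_pmf.prob_le_1[of p A] measure_pmf.prob_le_1[of q A]
      measure_nonneg[of "measure_pmf p" A] measure_nonneg[of "measure_pmf q" A] by (simp only: abs_le_iff) linarith
qed simp

lemma tv_dist_commute: "tv_dist p q = tv_dist q p"
  unfolding tv_dist_def by (simp add: abs_minus_commute)

text \<open>
  Subtract the minimum of the function and keep only the points where \<open>p\<close> exceeds \<open>q\<close>: their total excess
  is one of the differences in the definition of the distance.
\<close>

lemma tv_dist_osc_one_sided:
  assumes B: "finite B" "B \<noteq> {}" "set_pmf p \<subseteq> B" "set_pmf q \<subseteq> B"
    and d: "\<And>a c. a \<in> B \<Longrightarrow> c \<in> B \<Longrightarrow> \<bar>\<psi> a - \<psi> c\<bar> \<le> d"
  shows "(\<Sum>a\<in>B. pmf p a * \<psi> a) - (\<Sum>a\<in>B. pmf q a * \<psi> a) \<le> tv_dist p q * d"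
proof -
  obtain c where c: "c \<in> B" "\<And>a. a \<in> B \<Longrightarrow> \<psi> c \<le> \<psi> a"
    using B(1,2) by (metis arg_min_if_finite(1) arg_min_least)
  have d0: "0 \<le> d" using d[OF c(1) c(1)] by simp
  define A where "A = {a \<in> B. pmf q a \<le> pmf p a}"
  have sums: "(\<Sum>a\<in>B. pmf p a) = 1" "(\<Sum>a\<in>B. pmf q a) = 1"
    using B by (auto intro: sum_pmf_eq_1)
  have "(\<Sum>a\<in>B. pmf p a * \<psi> a) - (\<Sum>a\<in>B. pmf q a * \<psi> a) = (\<Sum>a\<in>B. (pmf p a - pmf q a) * (\<psi> a - \<psi> c))"
    using sums by (simp add: algebra_simps sum.distrib sum_subtractf flip: sum_distrib_left sum_distrib_right)
  also have "\<dots> \<le> (\<Sum>a\<in>B. if a \<in> A then (pmf p a - pmf q a) * d else 0)"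
  proof (rule sum_mono)
    fix a assume a: "a \<in> B"
    have le: "\<psi> a - \<psi> c \<le> d" "0 \<le> \<psi> a - \<psi> c" using d[OF a c(1)] c(2)[OF a] by auto
    show "(pmf p a - pmf q a) * (\<psi> a - \<psi> c) \<le> (if a \<in> A then (pmf p a - pmf q a) * d else 0)"
      using le a by (auto simp: A_def mult_left_mono mult_nonpos_nonneg)
  qed
  also have "\<dots> = (\<Sum>a\<in>A. pmf p a - pmf q a) * d"
    using B(1) by (simp add: A_def sum.inter_filter[symmetric] sum_distrib_right)
  also have "(\<Sum>a\<in>A. pmf p a - pmf q a) = measure_pmf.prob p A - measure_pmf.prob q A"
    using B(1) by (simp add: A_def measure_measure_pmf_finite sum_subtractf)
  also have "(measure_pmf.prob p A - measure_pmf.prob q A) * d \<le> tv_dist p q * d"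
    using tv_dist_ge[of p A q] d0 by (intro mult_right_mono) auto
  finally show ?thesis .
qed

lemma tv_dist_osc:
  assumes "finite B" "B \<noteq> {}" "set_pmf p \<subseteq> B" "set_pmf q \<subseteq> B"
    and "\<And>a c. a \<in> B \<Longrightarrow> c \<in> B \<Longrightarrow> \<bar>\<psi> a - \<psi> c\<bar> \<le> d"
  shows "\<bar>(\<Sum>a\<in>B. pmf p a * \<psi> a) - (\<Sum>a\<in>B. pmf q a * \<psi> a)\<bar> \<le> tv_dist p q * d"
proof -
  have "(\<Sum>a\<in>B. pmf p a * \<psi> a) - (\<Sum>a\<in>B. pmf q a * \<psi> a) \<le> tv_dist p q * d"
    by (rule tv_dist_osc_one_sided) (use assms in auto)
  moreover have "(\<Sum>a\<in>B. pmf q a * \<psi> a) - (\<Sum>a\<in>B. pmf p a * \<psi> a) \<le> tv_dist q p * d"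
    by (rule tv_dist_osc_one_sided) (use assms in auto)
  ultimately show ?thesis by (simp add: tv_dist_commute[of q p] abs_le_iff)
qed

text \<open>
  The supremum in the definition is taken over a set that is bounded because the dimension is finite;
  otherwise it would carry no information.
\<close>

lemma spectral_norm_bound:
  "L2_set (\<lambda>i. \<Sum>j<n. R i j * v j) {..<n} \<le> spectral_norm n R * L2_set v {..<n}"
proof (cases "L2_set v {..<n} = 0")
  case True
  hence "\<And>j. j < n \<Longrightarrow> v j = 0" by (simp add: L2_set_eq_0_iff)
  hence "L2_set (\<lambda>i. \<Sum>j<n. R i j * v j) {..<n} = L2_set (\<lambda>i. 0) {..<n}"
    by (intro L2_set_cong) auto
  thus ?thesis using True by (simp add: L2_set_0')
next
  case False
  define c where "c = L2_set v {..<n}"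
  have c: "0 < c" using False by (simp add: c_def less_le)
  have bdd: "bdd_above ((\<lambda>v. L2_set (\<lambda>i. \<Sum>j<n. R i j * v j) {..<n}) ` {v. L2_set v {..<n} \<le> 1})"
  proof (rule bdd_aboveI2)
    fix v assume "v \<in> {v. L2_set v {..<n} \<le> 1}"
    hence v: "L2_set v {..<n} \<le> 1" by simp
    have "\<bar>\<Sum>j<n. R i j * v j\<bar> \<le> (\<Sum>j<n. \<bar>R i j\<bar>)" for i
    proof -
      have "\<bar>\<Sum>j<n. R i j * v j\<bar> \<le> (\<Sum>j<n. \<bar>R i j * v j\<bar>)" by (rule sum_abs)
      also have "\<dots> \<le> (\<Sum>j<n. \<bar>R i j\<bar> * 1)"
      proof (rule sum_mono)
        fix j assume "j \<in> {..<n}"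
        hence "\<bar>v j\<bar> \<le> L2_set v {..<n}"
          using member_le_L2_set[of "{..<n}" j "\<lambda>j. \<bar>v j\<bar>"] by (simp add: L2_set_def)
        thus "\<bar>R i j * v j\<bar> \<le> \<bar>R i j\<bar> * 1" unfolding abs_mult using v by (intro mult_left_mono) auto
      qed
      finally show ?thesis by simp
    qed
    hence "L2_set (\<lambda>i. \<bar>\<Sum>j<n. R i j * v j\<bar>) {..<n} \<le> L2_set (\<lambda>i. \<Sum>j<n. \<bar>R i j\<bar>) {..<n}"
      by (intro L2_set_mono) auto
    thus "L2_set (\<lambda>i. \<Sum>j<n. R i j * v j) {..<n} \<le> L2_set (\<lambda>i. \<Sum>j<n. \<bar>R i j\<bar>) {..<n}"
      by (simp add: L2_set_def)
  qed
  have unit: "L2_set (\<lambda>j. 1 / c * v j) {..<n} \<le> 1"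
  proof -
    have "L2_set (\<lambda>j. 1 / c * v j) {..<n} = 1 / c * L2_set v {..<n}"
      by (rule L2_set_right_distrib[symmetric]) (use c in simp)
    thus ?thesis using c by (simp add: c_def)
  qed
  have "L2_set (\<lambda>i. \<Sum>j<n. R i j * (1 / c * v j)) {..<n} \<le> spectral_norm n R"
    unfolding spectral_norm_def by (rule cSUP_upper[OF _ bdd]) (use unit in simp)
  moreover have "L2_set (\<lambda>i. \<Sum>j<n. R i j * (1 / c * v j)) {..<n} = 1 / c * L2_set (\<lambda>i. \<Sum>j<n. R i j * v j) {..<n}"
  proof -
    have "(\<lambda>i. \<Sum>j<n. R i j * (1 / c * v j)) = (\<lambda>i. 1 / c * (\<Sum>j<n. R i j * v j))"
      by (simp add: sum_distrib_left)
    moreover have "L2_set (\<lambda>i. 1 / c * (\<Sum>j<n. R i j * v j)) {..<n} = 1 / c * L2_set (\<lambda>i. \<Sum>j<n. R i j * v j) {..<n}"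
      by (rule L2_set_right_distrib[symmetric]) (use c in simp)
    ultimately show ?thesis by (simp only:)
  qed
  ultimately show ?thesis using c by (simp add: c_def field_simps)
qed

text \<open>
  The hypotheses of the theorem for a single distribution.
\<close>

locale dobrushin_pmf =
  fixes m n :: nat and p :: "(nat \<Rightarrow> nat) pmf" and b C0 \<delta> :: real
  assumes m2: "2 \<le> m" and n1: "1 \<le> n" and b: "0 < b" "b \<le> 1" and C0: "0 < C0" and \<delta>: "0 < \<delta>" "\<delta> \<le> 1"
    and supp: "set_pmf p = cube m n"
    and ratio: "i < n \<Longrightarrow> k \<in> {1..<m} \<Longrightarrow> x \<in> cube m n \<Longrightarrow> b \<le> sqrt (pmf p (coord_shift m i k x) / pmf p x)"
      "i < n \<Longrightarrow> k \<in> {1..<m} \<Longrightarrow> x \<in> cube m n \<Longrightarrow> sqrt (pmf p (coord_shift m i k x) / pmf p x) \<le> 1 / b"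
    and col: "col_sum_norm n (Dobrushin m n p) \<le> C0"
    and spec: "spectral_norm n (Dobrushin m n p) \<le> 1 - \<delta>"
begin

abbreviation R where "R \<equiv> Dobrushin m n p"

sublocale cube_weight m n "pmf p"
  by unfold_locales (simp add: pmf_positive supp)

lemma cond_law_pmf:
  assumes x: "x \<in> cube m n" and i: "i < n"
  shows "set_pmf (cond_law n p i x) \<subseteq> {..<m}" "a < m \<Longrightarrow> pmf (cond_law n p i x) a = cp i x a"
proof -
  define s where "s = {z. \<forall>l<n. l \<noteq> i \<longrightarrow> z l = x l}"
  have s_fib: "s \<inter> cube m n = fib {i} x" by (auto simp: s_def fib_def)
  have ne: "set_pmf p \<inter> s \<noteq> {}" using fib_refl[OF x, of "{i}"] s_fib supp by auto
  have set: "set_pmf (cond_pmf p s) = fib {i} x" using ne s_fib supp by (auto simp: set_cond_pmf)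
  show "set_pmf (cond_law n p i x) \<subseteq> {..<m}"
    using i by (auto simp: cond_law_def set_map_pmf set[unfolded s_def] fib_def cube_def)
  assume a: "a < m"
  have ms: "measure_pmf.prob p s = (\<Sum>c<m. pmf p (x(i := c)))"
  proof -
    have "measure_pmf.prob p s = measure_pmf.prob p (s \<inter> set_pmf p)" by (simp add: measure_Int_set_pmf)
    also have "\<dots> = sum (pmf p) (fib {i} x)" using s_fib finite_fib by (simp add: supp measure_measure_pmf_finite)
    also have "\<dots> = (\<Sum>c<m. pmf p (x(i := c)))" by (rule sum.reindex_bij_betw[OF fib_single[OF x i], symmetric])
    finally show ?thesis .
  qed
  have "pmf (cond_law n p i x) a = measure_pmf.prob (cond_pmf p s) ((\<lambda>z. z i) -` {a})"
    by (simp add: cond_law_def s_def pmf_map)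
  also have "\<dots> = measure_pmf.prob (cond_pmf p s) {x(i := a)}"
  proof -
    have "((\<lambda>z. z i) -` {a}) \<inter> fib {i} x = {x(i := a)}"
    proof -
      have im: "fib {i} x = (\<lambda>c. x(i := c)) ` {..<m}" using fib_single[OF x i] by (simp add: bij_betw_def)
      show ?thesis unfolding im using a by auto
    qed
    thus ?thesis using measure_Int_set_pmf[of "cond_pmf p s"] set by (metis (no_types, lifting))
  qed
  also have "\<dots> = pmf (cond_pmf p s) (x(i := a))" by (simp add: measure_pmf_single)
  also have "\<dots> = pmf p (x(i := a)) / measure_pmf.prob p s"
    using pmf_cond[OF ne, of "x(i := a)"] by (simp add: s_def)
  finally show "pmf (cond_law n p i x) a = cp i x a" by (simp add: ms cp_def)
qed

lemma R_ge:
  assumes "x \<in> cube m n" "y \<in> cube m n" "\<And>l. l < n \<Longrightarrow> l \<noteq> j \<Longrightarrow> x l = y l"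
  shows "tv_dist (cond_law n p i x) (cond_law n p i y) \<le> R i j"
proof -
  let ?f = "\<lambda>(x, y). tv_dist (cond_law n p i x) (cond_law n p i y)"
  have "?f (x, y) \<le> R i j"
    unfolding Dobrushin_def
  proof (rule cSUP_upper)
    show "(x, y) \<in> {(x, y) \<in> cube m n \<times> cube m n. \<forall>l<n. l \<noteq> j \<longrightarrow> x l = y l}" using assms by auto
    show "bdd_above (?f ` {(x, y) \<in> cube m n \<times> cube m n. \<forall>l<n. l \<noteq> j \<longrightarrow> x l = y l})"
      by (rule bdd_aboveI2[of _ _ 1]) (auto simp: tv_dist_le_1)
  qed
  thus ?thesis by simp
qed

lemma cube_bound: "x \<in> cube m n \<Longrightarrow> i < n \<Longrightarrow> x i < m"
  by (auto simp: cube_def)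

lemma cube_nonempty: "(\<lambda>l. if l < n then 0 else undefined) \<in> cube m n"
  using m2 by (auto simp: cube_def PiE_iff extensional_def)

lemma R_nonneg: "0 \<le> R i j"
  using R_ge[OF cube_nonempty cube_nonempty, of j i] tv_dist_nonneg order_trans by blast

lemma R_influence:
  assumes "i < n" "x \<in> cube m n" "y \<in> cube m n" "\<And>l. l < n \<Longrightarrow> l \<noteq> j \<Longrightarrow> x l = y l"
    and d: "\<And>a c. a < m \<Longrightarrow> c < m \<Longrightarrow> \<bar>\<psi> a - \<psi> c\<bar> \<le> d"
  shows "\<bar>(\<Sum>a<m. cp i x a * \<psi> a) - (\<Sum>a<m. cp i y a * \<psi> a)\<bar> \<le> R i j * d"
proof -
  have d0: "0 \<le> d" using d[of 0 0] m2 by simp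
  have ne: "{..<m} \<noteq> {}" using m2 by (simp add: lessThan_empty_iff)
  have "\<bar>(\<Sum>a\<in>{..<m}. pmf (cond_law n p i x) a * \<psi> a) - (\<Sum>a\<in>{..<m}. pmf (cond_law n p i y) a * \<psi> a)\<bar>
      \<le> tv_dist (cond_law n p i x) (cond_law n p i y) * d"
    by (rule tv_dist_osc) (use ne cond_law_pmf(1) assms d in auto)
  also have "\<dots> \<le> R i j * d" using d0 by (intro mult_right_mono R_ge assms)
  finally show ?thesis using cond_law_pmf(2) assms by simp
qed

lemma R_col: "j < n \<Longrightarrow> (\<Sum>i<n. R i j) \<le> C0"
proof -
  assume j: "j < n"
  have "(\<Sum>i<n. \<bar>R i j\<bar>) \<le> col_sum_norm n R"
    unfolding col_sum_norm_def by (rule Max_ge) (use j in auto)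
  thus ?thesis using col R_nonneg by simp
qed

lemma R_norm: "L2_set (\<lambda>i. \<Sum>j<n. R i j * v j) {..<n} \<le> (1 - \<delta>) * L2_set v {..<n}"
  by (rule order_trans[OF spectral_norm_bound mult_right_mono[OF spec]]) simp

lemma shift_to:
  assumes x: "x \<in> cube m n" and i: "i < n" and "a < m" "c < m" "a \<noteq> c"
  shows "\<exists>k\<in>{1..<m}. coord_shift m i k (x(i := a)) = x(i := c)"
proof (rule bexI[of _ "if a < c then c - a else m + c - a"])
  show "coord_shift m i (if a < c then c - a else m + c - a) (x(i := a)) = x(i := c)"
    using assms by (auto simp: coord_shift_def)
qed (use assms in auto)

definition \<beta>0 :: real where "\<beta>0 = b\<^sup>2 / real m"

lemma \<beta>0: "0 < \<beta>0" using b m2 by (simp add: \<beta>0_def)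

text \<open>
  Any two points on a line parallel to an axis differ by one admissible shift, so marginal boundedness compares
  all of their masses.
\<close>

lemma pmf_compare:
  assumes x: "x \<in> cube m n" and i: "i < n" and a: "a < m" and c: "c < m"
  shows "b\<^sup>2 * pmf p (x(i := c)) \<le> pmf p (x(i := a))"
proof (cases "a = c")
  case True
  have "b\<^sup>2 \<le> 1" using b by (simp add: power_le_one)
  thus ?thesis using True mult_right_mono[of "b\<^sup>2" 1 "pmf p (x(i := a))"] by simp
next
  case False
  then obtain k where k: "k \<in> {1..<m}" "coord_shift m i k (x(i := c)) = x(i := a)"
    using shift_to[OF x i c a] by auto
  have xc: "x(i := c) \<in> cube m n" by (rule update_cube[OF x i c])
  have "b \<le> sqrt (pmf p (x(i := a)) / pmf p (x(i := c)))" using ratio(1)[OF i k(1) xc] k(2) by simp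
  hence "b\<^sup>2 \<le> (sqrt (pmf p (x(i := a)) / pmf p (x(i := c))))\<^sup>2" using b by (intro power_mono) auto
  hence "b\<^sup>2 \<le> pmf p (x(i := a)) / pmf p (x(i := c))" by simp
  thus ?thesis using \<mu>_pos[OF xc] by (simp add: field_simps)
qed

lemma cp_lower:
  assumes x: "x \<in> cube m n" and i: "i < n" and a: "a < m"
  shows "\<beta>0 \<le> cp i x a"
proof -
  have pos: "0 < (\<Sum>c<m. pmf p (x(i := c)))"
    using a by (intro sum_pos) (auto intro!: \<mu>_pos update_cube x i)
  have "b\<^sup>2 * (\<Sum>c<m. pmf p (x(i := c))) \<le> (\<Sum>c<m. pmf p (x(i := a)))"
    unfolding sum_distrib_left by (intro sum_mono pmf_compare x i a) auto
  hence "b\<^sup>2 * (\<Sum>c<m. pmf p (x(i := c))) \<le> real m * pmf p (x(i := a))" by simp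
  thus ?thesis using pos m2 by (simp add: \<beta>0_def cp_def field_simps)
qed

sublocale W: dobrushin_weight m n "pmf p" R \<beta>0 \<delta>
  by unfold_locales (use \<beta>0 cp_lower \<delta> R_nonneg R_influence R_norm in auto)

abbreviation KS where "KS \<equiv> {1..<m}"
definition rot :: "nat \<times> nat \<Rightarrow> (nat \<Rightarrow> nat) \<Rightarrow> nat \<Rightarrow> nat" where
  "rot a x = coord_shift m (fst a) (snd a) x"
definition unshift :: "nat \<times> nat \<Rightarrow> nat \<times> nat" where "unshift a = (fst a, m - snd a)"

lemma rot_cube: "fst a < n \<Longrightarrow> x \<in> cube m n \<Longrightarrow> rot a x \<in> cube m n"
  using m2 by (simp add: rot_def coord_shift_def update_cube)

sublocale F: flow "cube m n" "{..<n} \<times> KS" rot unshift "pmf p" b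
proof
  fix a assume a: "a \<in> {..<n} \<times> KS"
  show "unshift a \<in> {..<n} \<times> KS" "unshift (unshift a) = a" using a by (auto simp: unshift_def)
next
  fix a x assume a: "a \<in> {..<n} \<times> KS" and x: "x \<in> cube m n"
  show "rot a x \<in> cube m n" using a x by (auto intro: rot_cube)
  have "x (fst a) < m" by (rule cube_bound[OF x]) (use a in auto)
  moreover have "((y + k) mod m + (m - k)) mod m = y" if "y < m" "k < m" for y k
  proof -
    have "((y + k) mod m + (m - k)) mod m = (y + k + (m - k)) mod m" by (rule mod_add_left_eq)
    also have "y + k + (m - k) = y + m" using that by linarith
    finally show ?thesis using that by simp
  qed
  ultimately have e: "((x (fst a) + snd a) mod m + (m - snd a)) mod m = x (fst a)" using a by auto
  show "rot (unshift a) (rot a x) = x"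
    unfolding rot_def unshift_def coord_shift_def fst_conv snd_conv fun_upd_same fun_upd_upd e by (rule fun_upd_triv)
  show "b \<le> sqrt (pmf p (rot a x) / pmf p x)" "sqrt (pmf p (rot a x) / pmf p x) \<le> 1 / b"
    using ratio[of "fst a" "snd a" x] a x by (auto simp: rot_def)
next
  fix a c x
  show "rot a (rot c x) = rot c (rot a x)"
  proof (cases "fst a = fst c")
    case True
    have "((y + k) mod m + l) mod m = ((y + l) mod m + k) mod m" for y k l
      unfolding mod_add_left_eq by (simp only: add_ac)
    thus ?thesis using True by (simp only: rot_def coord_shift_def fun_upd_same fun_upd_upd)
  next
    case False
    thus ?thesis by (simp add: rot_def coord_shift_def fun_upd_twist)
  qed
qed (use finite_cube b in \<open>auto simp: \<mu>_pos supp sum_pmf_eq_1\<close>)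

lemma expectation_E: "measure_pmf.expectation p f = F.E f"
  unfolding F.E_def by (subst integral_measure_pmf_real[of "cube m n"]) (auto simp: finite_cube supp mult.commute)


text \<open>
  The Lipschitz constant of the rates as functions of the conditional law.
\<close>

definition cR :: real where "cR = (1 / b\<^sup>2 + 1) / (4 * b * \<beta>0)"
definition Nr :: real where "Nr = real (card KS)"
text \<open>
  What the diagonal of the commutator costs: its first term, the coupling to other coordinates
  through a column of \<open>R\<close>, and the coupling within the same coordinate.
\<close>

definition dR :: real where "dR = 1 / (2 * b) + Nr * (cR * C0) + Nr / (2 * b)"
definition \<beta> :: "nat \<Rightarrow> nat \<Rightarrow> real" where "\<beta> i j = cR * R i j + (if i = j then dR else 0)"
definition \<kappa> :: real where "\<kappa> = cR + dR"
definition \<alpha> :: real where "\<alpha> = 36 / (\<beta>0 * \<delta>\<^sup>2) * (4 / b)"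

lemma cR: "0 < cR" using b \<beta>0 by (auto simp: cR_def intro!: divide_pos_pos add_pos_pos mult_pos_pos)
lemma Nr: "1 \<le> Nr" using m2 by (simp add: Nr_def)
lemma dR: "0 < dR" using b Nr cR C0 by (auto simp: dR_def intro!: add_pos_nonneg)
lemma \<kappa>: "0 < \<kappa>" using cR dR by (simp add: \<kappa>_def)
lemma \<alpha>: "0 < \<alpha>" using b \<beta>0 \<delta> by (auto simp: \<alpha>_def)

text \<open>
  The rate is half the square root of the odds \<open>u\<close> of two values of coordinate \<open>i\<close>. The odds are a Lipschitz
  function of the conditional law because the single probabilities are at least \<open>\<beta>0\<close>, and the square
  root is Lipschitz because \<open>sqrt u \<ge> b\<close>. Within the same coordinate, only the range of the rates
  is used.
\<close>

lemma rate_difference: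
  assumes a: "i < n" "k \<in> KS" and c: "j < n" "l \<in> KS" and x: "x \<in> cube m n"
  shows "\<bar>F.q (i, k) (rot (j, l) x) - F.q (i, k) x\<bar> \<le> cR * R i j + (if i = j then 1 / (2 * b) else 0)"
proof (cases "i = j")
  case True
  have A: "(i, k) \<in> {..<n} \<times> KS" using a by simp
  have y: "rot (j, l) x \<in> cube m n" using c x by (simp add: rot_cube)
  have "\<bar>F.q (i, k) (rot (j, l) x) - F.q (i, k) x\<bar> \<le> 1 / (2 * b)"
    using F.q_bounds[OF A x] F.q_bounds[OF A y] b by (simp only: abs_le_iff) linarith
  moreover have "0 \<le> cR * R i j" using cR R_nonneg by simp
  ultimately show ?thesis using True by simp
next
  case False
  define y where "y = rot (j, l) x"
  have y: "y \<in> cube m n" using c x by (simp add: y_def rot_cube)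
  define s s' where "s = x i" and "s' = (x i + k) mod m"
  have ss: "s < m" "s' < m" using x a m2 by (auto simp: s_def s'_def cube_def)
  have yi: "y i = x i" using False by (simp add: y_def rot_def coord_shift_def)
  have sx: "x = x(i := s)" "rot (i, k) x = x(i := s')"
    by (simp_all add: s_def s'_def rot_def coord_shift_def)
  have sy: "y = y(i := s)" "rot (i, k) y = y(i := s')"
    using yi by (simp_all add: s_def s'_def rot_def coord_shift_def fun_eq_iff)
  have Zpos: "0 < (\<Sum>c<m. pmf p (z(i := c)))" if "z \<in> cube m n" for z
    using ss by (intro sum_pos) (auto intro!: \<mu>_pos update_cube that a)
  have rat: "pmf p (z(i := s')) / pmf p (z(i := s)) = cp i z s' / cp i z s" if "z \<in> cube m n" for z
    using Zpos[OF that] by (simp add: cp_def)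
  define u v where "u = cp i x s' / cp i x s" and "v = cp i y s' / cp i y s"
  have qx: "F.q (i, k) x = 1 / 2 * sqrt u"
    unfolding F.q_def sx(2) u_def rat[OF x, symmetric] using sx(1) by simp
  have qy: "F.q (i, k) y = 1 / 2 * sqrt v"
    unfolding F.q_def sy(2) v_def rat[OF y, symmetric] using sy(1) by simp
  have A: "(i, k) \<in> {..<n} \<times> KS" using a by simp
  have su: "b \<le> sqrt u" "sqrt u \<le> 1 / b" "b \<le> sqrt v" "sqrt v \<le> 1 / b"
    using F.q_bounds[OF A x] F.q_bounds[OF A y] unfolding qx qy by auto
  have uv0: "0 \<le> u" "0 \<le> v" using su b by (smt (verit) real_sqrt_ge_0_iff)+
  have ub: "u \<le> 1 / b\<^sup>2"
    using power_mono[OF su(2), of 2] uv0 by (simp add: power_divide)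
  have cpx: "\<beta>0 \<le> cp i x s" "\<beta>0 \<le> cp i y s" using cp_lower[OF x a(1) ss(1)] cp_lower[OF y a(1) ss(1)] by auto
  have dcp: "\<bar>cp i x e - cp i y e\<bar> \<le> R i j" if e: "e < m" for e
  proof -
    have "\<bar>(\<Sum>a<m. cp i x a * (if a = e then 1 else 0)) - (\<Sum>a<m. cp i y a * (if a = e then 1 else 0))\<bar> \<le> R i j * 1"
      by (rule R_influence[OF a(1) x y]) (auto simp: y_def rot_def coord_shift_def)
    thus ?thesis using e by (simp add: sum_indicator_mult(2))
  qed
  have "\<bar>u - v\<bar> \<le> (1 / b\<^sup>2 + 1) / \<beta>0 * R i j"
  proof -
    have "u - v = (u * (cp i y s - cp i x s) + (cp i x s' - cp i y s')) / cp i y s"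
      using cpx \<beta>0 by (simp add: u_def v_def field_simps)
    hence "\<bar>u - v\<bar> = \<bar>u * (cp i y s - cp i x s) + (cp i x s' - cp i y s')\<bar> / cp i y s" using cpx \<beta>0 by simp
    also have "\<dots> \<le> (1 / b\<^sup>2 * R i j + R i j) / \<beta>0"
    proof (rule frac_le)
      have "\<bar>u * (cp i y s - cp i x s)\<bar> \<le> 1 / b\<^sup>2 * R i j"
        unfolding abs_mult using ub uv0 dcp[OF ss(1)] by (intro mult_mono) (auto simp: abs_minus_commute)
      thus "\<bar>u * (cp i y s - cp i x s) + (cp i x s' - cp i y s')\<bar> \<le> 1 / b\<^sup>2 * R i j + R i j"
        using dcp[OF ss(2)] by linarith
    qed (use cpx \<beta>0 R_nonneg in auto)
    finally show ?thesis by (simp add: field_simps)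
  qed
  moreover have "2 * b * \<bar>sqrt u - sqrt v\<bar> \<le> \<bar>u - v\<bar>"
  proof -
    have "u - v = (sqrt u + sqrt v) * (sqrt u - sqrt v)" using uv0 by (simp add: algebra_simps)
    hence "\<bar>u - v\<bar> = (sqrt u + sqrt v) * \<bar>sqrt u - sqrt v\<bar>" using uv0 by (simp add: abs_mult)
    moreover have "2 * b * \<bar>sqrt u - sqrt v\<bar> \<le> (sqrt u + sqrt v) * \<bar>sqrt u - sqrt v\<bar>"
      using su by (intro mult_right_mono) auto
    ultimately show ?thesis by simp
  qed
  ultimately have "2 * b * \<bar>sqrt u - sqrt v\<bar> \<le> (1 / b\<^sup>2 + 1) / \<beta>0 * R i j" by linarith
  hence "1 / (4 * b) * (2 * b * \<bar>sqrt u - sqrt v\<bar>) \<le> 1 / (4 * b) * ((1 / b\<^sup>2 + 1) / \<beta>0 * R i j)"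
    using b by (intro mult_left_mono) auto
  hence "1 / 2 * \<bar>sqrt u - sqrt v\<bar> \<le> cR * R i j" using b by (simp add: cR_def)
  moreover have "\<bar>F.q (i, k) y - F.q (i, k) x\<bar> = 1 / 2 * \<bar>sqrt u - sqrt v\<bar>"
    unfolding qx qy right_diff_distrib[symmetric] abs_mult by (simp add: abs_minus_commute)
  ultimately show ?thesis using False by (simp add: y_def)
qed

text \<open>
  The diagonal term sums the changes of all rates when coordinate \<open>i\<close> moves, which is a column sum of \<open>R\<close>.
\<close>

lemma \<beta>_Bc:
  assumes a: "i < n" "k \<in> KS" and c: "j < n" "l \<in> KS" and x: "x \<in> cube m n"
  shows "\<bar>F.Bc (i, k) (j, l) x\<bar> \<le> \<beta> i j"
proof -
  have out: "\<bar>\<Sum>d\<in>{..<n} \<times> KS. F.q d (rot (i, k) x) - F.q d x\<bar> \<le> Nr * (cR * C0) + Nr / (2 * b)"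
  proof -
    have "\<bar>\<Sum>d\<in>{..<n} \<times> KS. F.q d (rot (i, k) x) - F.q d x\<bar>
        \<le> (\<Sum>d\<in>{..<n} \<times> KS. cR * R (fst d) i + (if fst d = i then 1 / (2 * b) else 0))"
    proof (rule order_trans[OF sum_abs sum_mono])
      fix d assume "d \<in> {..<n} \<times> KS"
      hence "fst d < n" "snd d \<in> KS" by auto
      from rate_difference[OF this a x]
      show "\<bar>F.q d (rot (i, k) x) - F.q d x\<bar> \<le> cR * R (fst d) i + (if fst d = i then 1 / (2 * b) else 0)"
        by (simp only: prod.collapse)
    qed
    also have "\<dots> = (\<Sum>e<n. Nr * (cR * R e i + (if e = i then 1 / (2 * b) else 0)))"
      unfolding sum.cartesian_product' by (simp add: Nr_def)
    also have "\<dots> = Nr * (cR * (\<Sum>e<n. R e i)) + Nr / (2 * b)"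
      using a by (simp add: sum.distrib sum_distrib_left distrib_left if_distrib[of "\<lambda>t. Nr * t"] cong: if_cong)
    also have "\<dots> \<le> Nr * (cR * C0) + Nr / (2 * b)"
      using R_col[OF a(1)] cR Nr by simp
    finally show ?thesis .
  qed
  have rd: "\<bar>F.q (i, k) (rot (j, l) x) - F.q (i, k) x\<bar> \<le> cR * R i j + (if i = j then 1 / (2 * b) else 0)"
    by (rule rate_difference[OF a c x])
  show ?thesis
  proof (cases "(i, k) = (j, l)")
    case True
    thus ?thesis using rd out unfolding F.Bc_def \<beta>_def dR_def by simp
  next
    case False
    have "(if i = j then 1 / (2 * b) else 0) \<le> (if i = j then dR else 0)"
      using Nr cR C0 b by (simp add: dR_def)
    thus ?thesis using rd False unfolding F.Bc_def \<beta>_def by auto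
  qed
qed

lemma \<beta>_form: "(\<Sum>i<n. \<Sum>j<n. v i * \<beta> i j * v j) \<le> \<kappa> * (\<Sum>i<n. (v i)\<^sup>2)"
proof -
  have "(\<Sum>i<n. \<Sum>j<n. v i * \<beta> i j * v j) = (\<Sum>i<n. cR * (v i * (\<Sum>j<n. R i j * v j)) + dR * (v i)\<^sup>2)"
  proof (rule sum.cong[OF refl])
    fix i assume i: "i \<in> {..<n}"
    have "(\<Sum>j<n. v i * \<beta> i j * v j) = (\<Sum>j<n. cR * (v i * (R i j * v j)) + (if i = j then dR * (v j)\<^sup>2 else 0))"
      by (rule sum.cong) (auto simp: \<beta>_def algebra_simps power2_eq_square)
    also have "\<dots> = cR * (v i * (\<Sum>j<n. R i j * v j)) + dR * (v i)\<^sup>2"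
      using i by (simp add: sum.distrib sum_distrib_left)
    finally show "(\<Sum>j<n. v i * \<beta> i j * v j) = cR * (v i * (\<Sum>j<n. R i j * v j)) + dR * (v i)\<^sup>2" .
  qed
  also have "\<dots> = cR * (\<Sum>i<n. v i * (\<Sum>j<n. R i j * v j)) + dR * (\<Sum>i<n. (v i)\<^sup>2)"
    by (simp add: sum.distrib sum_distrib_left)
  finally have eq: "(\<Sum>i<n. \<Sum>j<n. v i * \<beta> i j * v j) = cR * (\<Sum>i<n. v i * (\<Sum>j<n. R i j * v j)) + dR * (\<Sum>i<n. (v i)\<^sup>2)" .
  have "(\<Sum>i<n. v i * (\<Sum>j<n. R i j * v j)) \<le> (\<Sum>i<n. \<bar>v i\<bar> * \<bar>\<Sum>j<n. R i j * v j\<bar>)"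
    by (intro sum_mono) (simp flip: abs_mult)
  also have "\<dots> \<le> L2_set v {..<n} * L2_set (\<lambda>i. \<Sum>j<n. R i j * v j) {..<n}" by (rule L2_set_mult_ineq)
  also have "\<dots> \<le> L2_set v {..<n} * (1 * L2_set v {..<n})"
    using \<delta> by (intro mult_left_mono order_trans[OF R_norm mult_right_mono]) auto
  also have "\<dots> = (\<Sum>i<n. (v i)\<^sup>2)" by (simp add: L2_set_def sum_nonneg)
  finally have "(\<Sum>i<n. v i * (\<Sum>j<n. R i j * v j)) \<le> (\<Sum>i<n. (v i)\<^sup>2)" .
  hence "cR * (\<Sum>i<n. v i * (\<Sum>j<n. R i j * v j)) \<le> cR * (\<Sum>i<n. (v i)\<^sup>2)" using cR by (intro mult_left_mono) auto
  thus ?thesis unfolding eq \<kappa>_def by (simp add: algebra_simps)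
qed

lemma ce_full: "x \<in> cube m n \<Longrightarrow> ce {..<n} h x = F.E h"
proof -
  have fib: "fib {..<n} x = cube m n" by (auto simp: fib_def)
  have "mass {..<n} x = 1" unfolding mass_def fib by (rule F.\<mu>_sum)
  thus ?thesis by (simp add: ce_def fib F.E_def)
qed

text \<open>
  The variance is at most the second moment about the value at the current point; the values of the
  coordinate other than the current one are reached by the shifts.
\<close>

lemma single_site_variance:
  assumes i: "i < n" and z: "z \<in> cube m n"
  shows "ce {i} (W.Var1 i g) z \<le> (\<Sum>k\<in>KS. (g (rot (i, k) z) - g z)\<^sup>2)"
proof -
  let ?s = "\<lambda>a. (g (z(i := a)) - g z)\<^sup>2"
  have zi: "z i < m" using z i by (auto simp: cube_def)
  have "ce {i} (W.Var1 i g) z \<le> ce {i} (\<lambda>w. (g w - g z)\<^sup>2) z"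
  proof -
    have "ce {i} (\<lambda>w. (g w - g z)\<^sup>2) z = ce {i} (\<lambda>w. (g w)\<^sup>2 - 2 * g z * g w + (g z)\<^sup>2) z"
      by (rule ce_cong) (simp add: power2_diff)
    also have "\<dots> = ce {i} (\<lambda>w. (g w)\<^sup>2) z - 2 * g z * ce {i} g z + (g z)\<^sup>2"
      by (simp only: ce_add ce_diff ce_cmult ce_const[OF z])
    finally have "ce {i} (\<lambda>w. (g w - g z)\<^sup>2) z - ce {i} (W.Var1 i g) z = (ce {i} g z - g z)\<^sup>2"
      by (simp add: W.ce_variance_le[OF z] power2_diff)
    thus ?thesis by (metis zero_le_power2 diff_ge_0_iff_ge)
  qed
  also have "\<dots> = (\<Sum>a<m. cp i z a * ?s a)" by (rule ce_single[OF z i])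
  also have "\<dots> \<le> (\<Sum>a<m. 1 * ?s a)"
  proof (intro sum_mono mult_right_mono)
    fix a assume "a \<in> {..<m}"
    thus "cp i z a \<le> 1"
      using member_le_sum[of a "{..<m}" "cp i z"] cp_nonneg[OF z i] by (simp add: cp_sum z i)
  qed simp
  also have "\<dots> = (\<Sum>a\<in>{..<m} - {z i}. ?s a)"
    using zi by (subst sum.remove[of _ "z i"]) auto
  also have "\<dots> = (\<Sum>k\<in>KS. ?s ((z i + k) mod m))"
  proof (rule sum.reindex_bij_betw[symmetric])
    show "bij_betw (\<lambda>k. (z i + k) mod m) KS ({..<m} - {z i})"
    proof (rule bij_betw_byWitness[where f'="\<lambda>a. (a + m - z i) mod m"])
      have *: "(z i + k) mod m = (if z i + k < m then z i + k else z i + k - m)" if "k \<in> KS" for k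
        using that zi by (auto simp: mod_if)
      show "\<forall>k\<in>KS. ((z i + k) mod m + m - z i) mod m = k"
        using zi by (auto simp: *)
      show "\<forall>a\<in>{..<m} - {z i}. (z i + (a + m - z i) mod m) mod m = a"
        using zi by (auto simp: mod_add_right_eq)
      show "(\<lambda>k. (z i + k) mod m) ` KS \<subseteq> {..<m} - {z i}"
        using zi by (auto simp: * split: if_splits)
      show "(\<lambda>a. (a + m - z i) mod m) ` ({..<m} - {z i}) \<subseteq> KS"
        using zi by (auto simp: mod_if)
    qed
  qed
  also have "\<dots> = (\<Sum>k\<in>KS. (g (rot (i, k) z) - g z)\<^sup>2)" by (simp add: rot_def coord_shift_def)
  finally show ?thesis .
qed

lemma tensorization_to_dirichlet:
  assumes "0 \<le> C" "C \<le> 36 / (\<beta>0 * \<delta>\<^sup>2)" and x: "x \<in> cube m n"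
  shows "C * (\<Sum>i<n. ce {..<n} (W.Var1 i g) x) \<le> \<alpha> * F.dir g g"
proof -
  have each: "ce {..<n} (W.Var1 i g) x \<le> F.E (\<lambda>z. \<Sum>k\<in>KS. (g (rot (i, k) z) - g z)\<^sup>2)" if i: "i < n" for i
  proof -
    have "ce {..<n} (W.Var1 i g) x = ce {..<n} (ce {i} (W.Var1 i g)) x"
      by (rule ce_tower[symmetric]) (use i x in auto)
    also have "\<dots> = F.E (ce {i} (W.Var1 i g))" by (rule ce_full[OF x])
    also have "\<dots> \<le> F.E (\<lambda>z. \<Sum>k\<in>KS. (g (rot (i, k) z) - g z)\<^sup>2)"
      by (intro F.E_mono single_site_variance i)
    finally show ?thesis .
  qed
  have "(\<Sum>i<n. ce {..<n} (W.Var1 i g) x) \<le> (\<Sum>i<n. F.E (\<lambda>z. \<Sum>k\<in>KS. (g (rot (i, k) z) - g z)\<^sup>2))"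
    by (intro sum_mono each) simp
  also have "\<dots> = F.E (\<lambda>z. \<Sum>a\<in>{..<n} \<times> KS. (g (rot a z) - g z)\<^sup>2)"
    by (simp only: F.E_sum sum.cartesian_product')
  also have "\<dots> \<le> F.E (\<lambda>z. \<Sum>a\<in>{..<n} \<times> KS. 2 / b * (F.q a z * ((g (rot a z) - g z) * (g (rot a z) - g z))))"
  proof (intro F.E_mono sum_mono)
    fix z a assume "z \<in> cube m n" "a \<in> {..<n} \<times> KS"
    hence "1 \<le> 2 / b * F.q a z" using F.q_bounds(1)[of a z] b by (simp add: field_simps)
    from mult_right_mono[OF this zero_le_power2[of "g (rot a z) - g z"]]
    show "(g (rot a z) - g z)\<^sup>2 \<le> 2 / b * (F.q a z * ((g (rot a z) - g z) * (g (rot a z) - g z)))"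
      by (simp add: power2_eq_square mult.assoc)
  qed
  also have "\<dots> = 4 / b * F.dir g g"
    unfolding sum_distrib_left[symmetric] F.E_cmult F.dir_def by simp
  finally have S: "(\<Sum>i<n. ce {..<n} (W.Var1 i g) x) \<le> 4 / b * F.dir g g" .
  have "C * (\<Sum>i<n. ce {..<n} (W.Var1 i g) x) \<le> 36 / (\<beta>0 * \<delta>\<^sup>2) * (4 / b * F.dir g g)"
    using S assms by (intro mult_mono sum_nonneg ce_nonneg) (auto simp: W.Var1_def less_imp_le[OF \<beta>0])
  thus ?thesis by (simp add: \<alpha>_def)
qed

sublocale coupled_flow "cube m n" n KS rot unshift "pmf p" b \<beta> \<kappa> \<alpha>
proof
  show "KS \<noteq> {}" using m2 by auto
  show "0 \<le> \<beta> i j" for i j using cR dR R_nonneg by (simp add: \<beta>_def)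
  fix g
  have x: "(\<lambda>l. if l < n then 0 else undefined) \<in> cube m n" by (rule cube_nonempty)
  have K: "4 / (\<beta>0 * \<delta>\<^sup>2) \<le> 36 / (\<beta>0 * \<delta>\<^sup>2)" using \<beta>0 by (intro divide_right_mono) auto
  show "F.var g \<le> \<alpha> * F.dir g g"
    using W.variance_tensorization[OF subset_refl x, of g] tensorization_to_dirichlet[OF _ K x, of g] \<beta>0
    by (simp add: ce_full[OF x] F.var_def)
  assume g: "\<And>x. x \<in> cube m n \<Longrightarrow> 0 \<le> g x"
  have "ce {..<n} (\<lambda>z. (g z)\<^sup>2 * ln ((g z)\<^sup>2)) (\<lambda>l. if l < n then 0 else undefined)
      - ce {..<n} (\<lambda>z. (g z)\<^sup>2) (\<lambda>l. if l < n then 0 else undefined) * ln (ce {..<n} (\<lambda>z. (g z)\<^sup>2) (\<lambda>l. if l < n then 0 else undefined))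
      \<le> 36 / (\<beta>0 * \<delta>\<^sup>2) * (\<Sum>i<n. ce {..<n} (W.Var1 i g) (\<lambda>l. if l < n then 0 else undefined))"
    by (rule W.log_sobolev_tensorization[OF g subset_refl x])
  thus "F.E (\<lambda>x. (g x)\<^sup>2 * ln ((g x)\<^sup>2)) - F.E (\<lambda>x. (g x)\<^sup>2) * ln (F.E (\<lambda>x. (g x)\<^sup>2)) \<le> \<alpha> * F.dir g g"
    using tensorization_to_dirichlet[of "36 / (\<beta>0 * \<delta>\<^sup>2)" _ g, OF _ order_refl x] \<beta>0
    by (simp add: ce_full[OF x])
qed (use \<kappa> \<alpha> \<beta>_form \<beta>_Bc in auto)

end

section \<open>The theorem\<close>

context dobrushin_pmf
begin

lemma qstar_q: "qstar m p i k x = F.q (i, k) x"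
  by (simp add: qstar_def F.q_def rot_def)

lemma gen_coord_Lc: "gen_coord m p i f x = Lc i f x"
  unfolding gen_coord_def Lc_def F.D_def qstar_q rot_def fst_conv snd_conv ..

lemma gen_L: "gen m n p = F.L"
  unfolding gen_def[abs_def] F.L_def[abs_def] F.D_def sum.cartesian_product' qstar_q rot_def fst_conv snd_conv ..

lemma heat_P: "heat m n p t f x = F.P t f x"
  unfolding heat_def expo_def gen_L ..

lemma Gamma_star_Gstar: "Gamma_star m n p f x = F.Gstar f x"
  unfolding Gamma_star_def F.Gstar_def F.D_def sum.cartesian_product' qstar_q rot_def fst_conv snd_conv power_mult_distrib ..

lemma prob_E: "measure_pmf.prob p B = F.E (indicator B)"
  using expectation_E[of "indicator B"] by simp

lemma Influence_E: "Influence m p i f = F.E (\<lambda>x. real (csens f i x))"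
proof -
  have "real (csens f i x) = (\<Sum>k\<in>KS. indicator {x. f x \<noteq> f (coord_shift m i k x)} x)" for x
  proof -
    have "(\<Sum>k\<in>KS. indicator {x. f x \<noteq> f (coord_shift m i k x)} x) = (\<Sum>k\<in>KS. if f (rot (i, k) x) \<noteq> f x then 1 else (0::real))"
      by (intro sum.cong refl) (auto simp: indicator_def rot_def)
    also have "\<dots> = real (csens f i x)"
      unfolding csens_def by (subst sum.inter_filter[symmetric]) simp_all
    finally show ?thesis by simp
  qed
  thus ?thesis unfolding Influence_def prob_E F.E_sum[symmetric] by simp
qed

lemma surface_area_SA: "surface_area m n p f = SA f"
proof -
  have "{(i, k) \<in> {..<n} \<times> KS. f (coord_shift m i k x) \<noteq> f x} = {a \<in> {..<n} \<times> KS. f (rot a x) \<noteq> f x}" for x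
    by (auto simp: rot_def)
  thus ?thesis unfolding surface_area_def SA_def sensitivity_def sens_def expectation_E by simp
qed

lemma SqInf_SI: "SqInf m n p f = SI f"
proof -
  have "{k \<in> KS. f x \<noteq> f (coord_shift m i k x)} = {k \<in> KS. f (rot (i, k) x) \<noteq> f x}" for i x
    by (auto simp: rot_def)
  thus ?thesis unfolding SqInf_def SI_def csens_def expectation_E by simp
qed

lemma variance_var: "measure_pmf.variance p f = F.var f"
  unfolding expectation_E F.var_eq ..

lemma lp_norm_2: "lp_norm 2 p h = sqrt (F.E (\<lambda>x. (h x)\<^sup>2))"
  using F.E_nonneg[of "\<lambda>x. (h x)\<^sup>2"] by (simp add: lp_norm_def expectation_E powr_half_sqrt)

lemma lp_norm_1: "lp_norm 1 p h = F.E (\<lambda>x. \<bar>h x\<bar>)"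
  using F.E_nonneg[of "\<lambda>x. \<bar>h x\<bar>"] by (simp add: lp_norm_def expectation_E)

lemma talagrand_term:
  "(if \<forall>x\<in>cube m n. gen_coord m p i f x = 0 then 0
     else (lp_norm 2 p (gen_coord m p i f))\<^sup>2 / (1 + ln (lp_norm 2 p (gen_coord m p i f) / lp_norm 1 p (gen_coord m p i f))))
   = influence_term f i"
  using F.E_nonneg[of "\<lambda>x. (Lc i f x)\<^sup>2"]
  unfolding influence_term_def lp_norm_2 lp_norm_1 gen_coord_Lc by simp

lemma boolean_inequalities:
  assumes f: "f \<in> cube m n \<rightarrow> {-1, 1 :: real}"
    and c: "0 < c" "c * C_kkl \<le> 1" "c * C_infl \<le> 1" "c * C_surf \<le> 1" "c * C_eg \<le> 1"
  shows "(MAX i \<in> {..<n}. Influence m p i f) \<ge> c * (ln (real n) / real n) * measure_pmf.variance p f"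
    and "c * measure_pmf.variance p f \<le> (\<Sum>i<n. if \<forall>x\<in>cube m n. gen_coord m p i f x = 0 then 0
                 else (lp_norm 2 p (gen_coord m p i f))\<^sup>2 /
                   (1 + ln (lp_norm 2 p (gen_coord m p i f) / lp_norm 1 p (gen_coord m p i f))))"
    and "surface_area m n p f \<ge> (if measure_pmf.variance p f = 0 then 0
            else c * measure_pmf.variance p f * sqrt (ln (exp 1 / measure_pmf.variance p f)))"
    and "surface_area m n p f \<ge> (if measure_pmf.variance p f = 0 then 0
            else c * measure_pmf.variance p f * sqrt (ln (1 + exp 1 / SqInf m n p f)))"
proof -
  have bool: "f x = - 1 \<or> f x = 1" if "x \<in> cube m n" for x using f that by auto
  have scale: "c * X \<le> Y" if "X \<le> C * Y" "0 \<le> Y" "c * C \<le> 1" for X Y C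
  proof -
    have "c * X \<le> c * (C * Y)" using that c by (intro mult_left_mono) auto
    also have "\<dots> = (c * C) * Y" by simp
    also have "\<dots> \<le> 1 * Y" using that by (intro mult_right_mono) auto
    finally show ?thesis by simp
  qed
  have SA0: "0 \<le> SA f" by (rule SA_nonneg[OF bool])
  let ?M = "MAX i \<in> {..<n}. Influence m p i f"
  have M: "F.E (\<lambda>x. real (csens f i x)) \<le> ?M" if "i < n" for i
    unfolding Influence_E by (rule Max_ge) (use that in auto)
  have "0 \<le> F.E (\<lambda>x. real (csens f 0 x))" by (rule F.E_nonneg) simp
  also have "\<dots> \<le> ?M" using M[of 0] n1 by simp
  finally have M0: "0 \<le> ?M" .
  show "c * (ln (real n) / real n) * measure_pmf.variance p f \<le> ?M"
    unfolding variance_var mult.assoc by (rule scale[OF kkl[OF bool n1 M] M0 c(2)])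
  show "c * measure_pmf.variance p f \<le> (\<Sum>i<n. if \<forall>x\<in>cube m n. gen_coord m p i f x = 0 then 0
                 else (lp_norm 2 p (gen_coord m p i f))\<^sup>2 /
                   (1 + ln (lp_norm 2 p (gen_coord m p i f) / lp_norm 1 p (gen_coord m p i f))))"
    unfolding talagrand_term variance_var
    by (rule scale[OF influence_inequality[OF bool] sum_nonneg[OF influence_term_nonneg] c(3)])
  have pos: "0 < F.var f" if "F.var f \<noteq> 0" using F.var_nonneg[of f] that by simp
  show "surface_area m n p f \<ge> (if measure_pmf.variance p f = 0 then 0
            else c * measure_pmf.variance p f * sqrt (ln (exp 1 / measure_pmf.variance p f)))"
    unfolding variance_var surface_area_SA mult.assoc
    using SA0 scale[OF talagrand_surface_area[OF bool pos] SA0 c(4)] by auto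
  show "surface_area m n p f \<ge> (if measure_pmf.variance p f = 0 then 0
            else c * measure_pmf.variance p f * sqrt (ln (1 + exp 1 / SqInf m n p f)))"
    unfolding variance_var surface_area_SA SqInf_SI mult.assoc
    using SA0 scale[OF eldan_gross[OF bool pos] SA0 c(5)] by auto
qed

lemma bobkov_inequality:
  assumes "f \<in> cube m n \<rightarrow> {0..1 :: real}" "0 \<le> t" "x \<in> cube m n"
  shows "gauss_profile (heat m n p t f x)
     \<le> heat m n p t (\<lambda>y. sqrt ((gauss_profile (f y))\<^sup>2 + bobkov_gamma b (- K) t * Gamma_star m n p f y)) x"
  unfolding heat_P Gamma_star_Gstar
  by (rule local_bobkov_gam[OF assms(2,3)]) (use assms(1) in auto)

end

theorem theorem7p20:
  fixes m :: nat and b C\<^sub>0 \<delta> :: real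
  assumes "m \<ge> 2" and "0 < b" "b \<le> 1" and "C\<^sub>0 > 0" and "0 < \<delta>" "\<delta> \<le> 1"
  shows "\<exists>C > 0. \<exists>\<rho> :: real. \<forall>(n :: nat) \<ge> 1. \<forall>\<mu> :: (nat \<Rightarrow> nat) pmf.
    set_pmf \<mu> = cube m n \<and>
    (\<forall>i<n. \<forall>k\<in>{1..<m}. \<forall>x\<in>cube m n.
       b \<le> sqrt (pmf \<mu> (coord_shift m i k x) / pmf \<mu> x) \<and>
       sqrt (pmf \<mu> (coord_shift m i k x) / pmf \<mu> x) \<le> 1 / b) \<and>
    col_sum_norm n (Dobrushin m n \<mu>) \<le> C\<^sub>0 \<and>
    spectral_norm n (Dobrushin m n \<mu>) \<le> 1 - \<delta>
    \<longrightarrow>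
    (\<forall>f \<in> cube m n \<rightarrow> {-1, 1 :: real}.
       (MAX i \<in> {..<n}. Influence m \<mu> i f)
         \<ge> C * (ln (real n) / real n) * measure_pmf.variance \<mu> f \<and>
       C * measure_pmf.variance \<mu> f
         \<le> (\<Sum>i<n. if \<forall>x\<in>cube m n. gen_coord m \<mu> i f x = 0 then 0
                 else (lp_norm 2 \<mu> (gen_coord m \<mu> i f))\<^sup>2 /
                   (1 + ln (lp_norm 2 \<mu> (gen_coord m \<mu> i f) / lp_norm 1 \<mu> (gen_coord m \<mu> i f)))) \<and>
       surface_area m n \<mu> f
         \<ge> (if measure_pmf.variance \<mu> f = 0 then 0
            else C * measure_pmf.variance \<mu> f * sqrt (ln (exp 1 / measure_pmf.variance \<mu> f))) \<and>
       surface_area m n \<mu> f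
         \<ge> (if measure_pmf.variance \<mu> f = 0 then 0
            else C * measure_pmf.variance \<mu> f * sqrt (ln (1 + exp 1 / SqInf m n \<mu> f)))) \<and>
    (\<forall>f \<in> cube m n \<rightarrow> {0..1 :: real}. \<forall>t \<ge> 0. \<forall>x \<in> cube m n.
       gauss_profile (heat m n \<mu> t f x)
         \<le> heat m n \<mu> t
             (\<lambda>y. sqrt ((gauss_profile (f y))\<^sup>2 + bobkov_gamma b \<rho> t * Gamma_star m n \<mu> f y)) x)"
proof -
  \<comment> \<open>The constants of the interpreted locales mention only \<open>m\<close>, \<open>b\<close>, \<open>C\<^sub>0\<close> and \<open>\<delta>\<close>, so they can be chosen before
      \<open>n\<close> and \<open>\<mu>\<close>; \<open>c\<close> is small enough for all four inequalities at once.\<close>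
  define kap alp where "kap = dobrushin_pmf.\<kappa> m b C\<^sub>0" and "alp = dobrushin_pmf.\<alpha> m b \<delta>"
  define k1 k2 k3 k5 where "k1 = coupled_flow.C_kkl {1..<m} b kap alp" and "k2 = coupled_flow.C_infl {1..<m} b kap alp"
    and "k3 = coupled_flow.C_surf {1..<m} b kap alp" and "k5 = coupled_flow.C_eg {1..<m} b kap alp"
  define s where "s = 1 + \<bar>k1\<bar> + \<bar>k2\<bar> + \<bar>k3\<bar> + \<bar>k5\<bar>"
  have s: "0 < s" "k1 \<le> s" "k2 \<le> s" "k3 \<le> s" "k5 \<le> s" by (auto simp: s_def)
  define c where "c = 1 / s"
  have c: "0 < c" "c * k1 \<le> 1" "c * k2 \<le> 1" "c * k3 \<le> 1" "c * k5 \<le> 1"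
    using s by (auto simp: c_def)
  show ?thesis
  proof (rule exI[of _ c], intro conjI[OF c(1)], rule exI[of _ "- coupled_flow.K {1..<m} kap"], intro allI impI)
    fix n :: nat and \<mu> :: "(nat \<Rightarrow> nat) pmf"
    assume n: "1 \<le> n" and h: "set_pmf \<mu> = cube m n \<and>
      (\<forall>i<n. \<forall>k\<in>{1..<m}. \<forall>x\<in>cube m n.
       b \<le> sqrt (pmf \<mu> (coord_shift m i k x) / pmf \<mu> x) \<and>
       sqrt (pmf \<mu> (coord_shift m i k x) / pmf \<mu> x) \<le> 1 / b) \<and>
      col_sum_norm n (Dobrushin m n \<mu>) \<le> C\<^sub>0 \<and>
      spectral_norm n (Dobrushin m n \<mu>) \<le> 1 - \<delta>"
    interpret dobrushin_pmf m n \<mu> b C\<^sub>0 \<delta>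
      by unfold_locales (use assms n h in blast)+
    note c' = c[unfolded k1_def k2_def k3_def k5_def kap_def alp_def]
    show "(\<forall>f \<in> cube m n \<rightarrow> {-1, 1 :: real}.
       (MAX i \<in> {..<n}. Influence m \<mu> i f)
         \<ge> c * (ln (real n) / real n) * measure_pmf.variance \<mu> f \<and>
       c * measure_pmf.variance \<mu> f
         \<le> (\<Sum>i<n. if \<forall>x\<in>cube m n. gen_coord m \<mu> i f x = 0 then 0
                 else (lp_norm 2 \<mu> (gen_coord m \<mu> i f))\<^sup>2 /
                   (1 + ln (lp_norm 2 \<mu> (gen_coord m \<mu> i f) / lp_norm 1 \<mu> (gen_coord m \<mu> i f)))) \<and>
       surface_area m n \<mu> f
         \<ge> (if measure_pmf.variance \<mu> f = 0 then 0
            else c * measure_pmf.variance \<mu> f * sqrt (ln (exp 1 / measure_pmf.variance \<mu> f))) \<and>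
       surface_area m n \<mu> f
         \<ge> (if measure_pmf.variance \<mu> f = 0 then 0
            else c * measure_pmf.variance \<mu> f * sqrt (ln (1 + exp 1 / SqInf m n \<mu> f)))) \<and>
      (\<forall>f \<in> cube m n \<rightarrow> {0..1 :: real}. \<forall>t \<ge> 0. \<forall>x \<in> cube m n.
       gauss_profile (heat m n \<mu> t f x)
         \<le> heat m n \<mu> t
             (\<lambda>y. sqrt ((gauss_profile (f y))\<^sup>2 + bobkov_gamma b (- coupled_flow.K {1..<m} kap) t * Gamma_star m n \<mu> f y)) x)"
      unfolding kap_def
      by (intro conjI ballI allI impI boolean_inequalities bobkov_inequality c')
  qed
qed

end
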